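(* For every prime $p$, the group $$\Lambda_p=\langle a,s,t \mid a^p,\ [s,t],\ [a^t,a],\ a^s=a^ta\rangle$$ (Baumslag's finitely presented metabelian group) has quadratic Dehn function.
   Context: Here $a^t$ denotes the conjugate of $a$ by $t$ and $[x,y]$ the commutator of $x$ and $y$. Dehn function: let $\Gamma$ be a finitely presented group with finite symmetric generating set $S$, and let $\ell$ be an integer such that $\Gamma$ has a presentation with generating set $S$ and relators of length $\le \ell$. A relation is a word in the letters of $S$ representing the trivial element of $\Gamma$; its area is the least $m$ such that it is, in the free group on $S$, a product of $\le m$ conjugates of relations of length $\le \ell$. The Dehn function is $\delta(n)=\sup\{\mathrm{area}(w) : w \text{ a relation of length}\le n\}$. It is considered up to the equivalence $\approx$, where $u\approx v$ if there are positive constants $a_1,\dots,a_4,b_1,\dots,b_4$ with $a_1u(a_2n)-a_3n-a_4\le v(n)\le b_1u(b_2n)+b_3n+b_4$ for all $n\ge 0$; up to $\approx$ it does not depend on $(S,\ell)$. "Quadratic Dehn function" means $\delta(n)\approx n^2$. *)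

theory Defs
  imports Complex_Main "HOL-Algebra.Generated_Groups" "HOL-Computational_Algebra.Primes"
begin

section \<open>Free groups\<close>

text \<open>The letter \<open>(x, True)\<close> stands for \<open>x\<close>, the letter \<open>(x, False)\<close> for its formal inverse.\<close>

type_synonym 'a letter = "'a \<times> bool"

definition inv_letter :: "'a letter \<Rightarrow> 'a letter" where
  "inv_letter l = (fst l, \<not> snd l)"

definition reduced :: "'a letter list \<Rightarrow> bool" where
  "reduced w = successively (\<lambda>k l. l \<noteq> inv_letter k) w"

fun free_cons :: "'a letter \<Rightarrow> 'a letter list \<Rightarrow> 'a letter list" where
  "free_cons k [] = [k]"
| "free_cons k (l # w) = (if l = inv_letter k then w else k # l # w)"

definition free_group :: "'a set \<Rightarrow> 'a letter list monoid" where
  "free_group X =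
     \<lparr>carrier = {w \<in> lists (X \<times> UNIV). reduced w},
      monoid.mult = (\<lambda>u v. foldr free_cons u v),
      one = []\<rparr>"

definition free_gen :: "'a \<Rightarrow> 'a letter list" where
  "free_gen x = [(x, True)]"

definition free_lift :: "('g, 'm) monoid_scheme \<Rightarrow> ('a \<Rightarrow> 'g) \<Rightarrow> 'a letter list \<Rightarrow> 'g" where
  "free_lift G f w =
     foldr (\<lambda>(x, b) g. (if b then f x else inv\<^bsub>G\<^esub> (f x)) \<otimes>\<^bsub>G\<^esub> g) w \<one>\<^bsub>G\<^esub>"

lemma inv_letter_inv_letter [simp]: "inv_letter (inv_letter l) = l"
  by (simp add: inv_letter_def)

lemma inv_letter_neq [simp]: "inv_letter l \<noteq> l" "l \<noteq> inv_letter l"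
  by (simp_all add: inv_letter_def prod_eq_iff)

lemma reduced_simps [simp]:
  "reduced []" "reduced [l]"
  "reduced (k # l # w) \<longleftrightarrow> l \<noteq> inv_letter k \<and> reduced (l # w)"
  by (simp_all add: reduced_def)

lemma reduced_ConsD: "reduced (l # w) \<Longrightarrow> reduced w"
  by (cases w) auto

lemma reduced_free_cons: "reduced w \<Longrightarrow> reduced (free_cons l w)"
  by (cases w) (auto dest: reduced_ConsD)

lemma free_cons_reduced: "reduced (l # w) \<Longrightarrow> free_cons l w = l # w"
  by (cases w) auto

lemma free_cons_cancel: "reduced w \<Longrightarrow> free_cons l (free_cons (inv_letter l) w) = w"
  by (cases w) (auto simp: free_cons_reduced)

lemma reduced_foldr: "reduced v \<Longrightarrow> reduced (foldr free_cons u v)"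
  by (induction u) (auto intro: reduced_free_cons)

lemma foldr_free_cons:
  "reduced v \<Longrightarrow> foldr free_cons (free_cons l u) v = free_cons l (foldr free_cons u v)"
  by (cases u) (auto simp: free_cons_cancel reduced_foldr)

lemma foldr_free_cons_assoc:
  "reduced w \<Longrightarrow>
     foldr free_cons (foldr free_cons u v) w = foldr free_cons u (foldr free_cons v w)"
  by (induction u) (auto simp: foldr_free_cons)

lemma foldr_free_cons_Nil: "reduced u \<Longrightarrow> foldr free_cons u [] = u"
proof (induction u)
  case (Cons l u)
  then show ?case
    by (simp add: free_cons_reduced reduced_ConsD[OF Cons.prems])
qed simp

lemma free_cons_in_lists:
  "l \<in> X \<times> UNIV \<Longrightarrow> w \<in> lists (X \<times> UNIV) \<Longrightarrow> free_cons l w \<in> lists (X \<times> UNIV)"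
  by (cases w) auto

lemma foldr_in_lists:
  "u \<in> lists (X \<times> UNIV) \<Longrightarrow> v \<in> lists (X \<times> UNIV) \<Longrightarrow>
     foldr free_cons u v \<in> lists (X \<times> UNIV)"
proof (induction u)
  case (Cons l u)
  then show ?case
    using free_cons_in_lists[of l X "foldr free_cons u v"] by simp
qed simp

lemma free_group_left_inv:
  "foldr free_cons (rev (map inv_letter u)) u = []"
  by (induction u) auto

theorem group_free_group: "group (free_group X)"
proof (rule groupI)
  fix u v w
  assume u: "u \<in> carrier (free_group X)" and v: "v \<in> carrier (free_group X)"
    and w: "w \<in> carrier (free_group X)"
  show "u \<otimes>\<^bsub>free_group X\<^esub> v \<in> carrier (free_group X)"
    using u v by (simp add: free_group_def reduced_foldr foldr_in_lists del: in_lists_conv_set)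
  show "u \<otimes>\<^bsub>free_group X\<^esub> v \<otimes>\<^bsub>free_group X\<^esub> w
      = u \<otimes>\<^bsub>free_group X\<^esub> (v \<otimes>\<^bsub>free_group X\<^esub> w)"
    using w by (simp add: free_group_def foldr_free_cons_assoc)
next
  fix u assume u: "u \<in> carrier (free_group X)"
  let ?u' = "foldr free_cons (rev (map inv_letter u)) []"
  have "rev (map inv_letter u) \<in> lists (X \<times> UNIV)"
    using u by (force simp: free_group_def inv_letter_def)
  then have "?u' \<in> carrier (free_group X)"
    by (simp add: free_group_def reduced_foldr foldr_in_lists del: in_lists_conv_set)
  moreover have "?u' \<otimes>\<^bsub>free_group X\<^esub> u = \<one>\<^bsub>free_group X\<^esub>"
    using u by (simp add: free_group_def foldr_free_cons_assoc free_group_left_inv)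
  ultimately show "\<exists>v\<in>carrier (free_group X). v \<otimes>\<^bsub>free_group X\<^esub> u = \<one>\<^bsub>free_group X\<^esub>"
    by blast
qed (simp_all add: free_group_def)

lemma free_gen_closed: "x \<in> X \<Longrightarrow> free_gen x \<in> carrier (free_group X)"
  by (simp add: free_group_def free_gen_def)

section \<open>Presentations\<close>

definition conjugates :: "('g, 'm) monoid_scheme \<Rightarrow> 'g set \<Rightarrow> 'g set" where
  "conjugates G R = {g \<otimes>\<^bsub>G\<^esub> r \<otimes>\<^bsub>G\<^esub> inv\<^bsub>G\<^esub> g | g r. g \<in> carrier G \<and> r \<in> R}"

definition normal_closure :: "('g, 'm) monoid_scheme \<Rightarrow> 'g set \<Rightarrow> 'g set" where
  "normal_closure G R = generate G (conjugates G R)"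

definition presented_group :: "'a set \<Rightarrow> 'a letter list set \<Rightarrow> 'a letter list set monoid" where
  "presented_group X R = free_group X Mod normal_closure (free_group X) R"

lemma (in group) normal_closure_normal:
  assumes R: "R \<subseteq> carrier G"
  shows "normal_closure G R \<lhd> G"
  unfolding normal_closure_def
proof (rule normal_generateI)
  show "conjugates G R \<subseteq> carrier G"
    using R by (auto simp: conjugates_def)
next
  fix h g assume h: "h \<in> conjugates G R" and g: "g \<in> carrier G"
  then obtain k r where k: "k \<in> carrier G" "r \<in> R" "h = k \<otimes> r \<otimes> inv k"
    by (auto simp: conjugates_def)
  then have "g \<otimes> h \<otimes> inv g = (g \<otimes> k) \<otimes> r \<otimes> inv (g \<otimes> k)"
    using R g by (auto simp: m_assoc inv_mult_group subset_iff)
  then show "g \<otimes> h \<otimes> inv g \<in> conjugates G R"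
    using g k unfolding conjugates_def by blast
qed

theorem group_presented_group:
  "R \<subseteq> carrier (free_group X) \<Longrightarrow> group (presented_group X R)"
  unfolding presented_group_def
  by (intro normal.factorgroup_is_group group.normal_closure_normal group_free_group)

section \<open>Dehn functions\<close>

text \<open>Words in the letters of \<open>S\<close> are elements of \<open>lists S\<close>.\<close>

definition word_prod :: "('g, 'm) monoid_scheme \<Rightarrow> 'g list \<Rightarrow> 'g" where
  "word_prod G w = foldr (\<otimes>\<^bsub>G\<^esub>) w \<one>\<^bsub>G\<^esub>"

definition free_word :: "'a set \<Rightarrow> 'a list \<Rightarrow> 'a letter list" where
  "free_word S w = word_prod (free_group S) (map free_gen w)"

definition relations :: "('g, 'm) monoid_scheme \<Rightarrow> 'g set \<Rightarrow> 'g list set" where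
  "relations G S = {w \<in> lists S. word_prod G w = \<one>\<^bsub>G\<^esub>}"

definition symmetric_generating_set :: "('g, 'm) monoid_scheme \<Rightarrow> 'g set \<Rightarrow> bool" where
  "symmetric_generating_set G S \<longleftrightarrow>
     S \<subseteq> carrier G \<and> (\<forall>s\<in>S. inv\<^bsub>G\<^esub> s \<in> S) \<and> generate G S = carrier G"

text \<open>The relators \<open>R\<close> present \<open>G\<close> on the generating set \<open>S\<close> when the canonical
  homomorphism from the free group on \<open>S\<close> to \<open>G\<close> has the normal closure of \<open>R\<close> as its kernel.\<close>

definition presented_in_length :: "('g, 'm) monoid_scheme \<Rightarrow> 'g set \<Rightarrow> nat \<Rightarrow> bool" where
  "presented_in_length G S l \<longleftrightarrow>
     finite S \<and> symmetric_generating_set G S \<and>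
     (\<exists>R \<subseteq> {w \<in> lists S. length w \<le> l}.
        kernel (free_group S) G (free_lift G (\<lambda>s. s))
          = normal_closure (free_group S) (free_word S ` R))"

text \<open>In the free group on the set \<open>S\<close>, the generators \<open>s\<close> and \<open>inv s\<close> of the symmetric set
  \<open>S\<close> are independent, so the inverse of a relation need not be a word in the letters of \<open>S\<close>.
  Inverses of relations therefore have to be admitted explicitly in the area.\<close>

definition short_relators :: "('g, 'm) monoid_scheme \<Rightarrow> 'g set \<Rightarrow> nat \<Rightarrow> 'g letter list set" where
  "short_relators G S l =
     (let R = free_word S ` {r \<in> relations G S. length r \<le> l}
      in R \<union> (\<lambda>r. inv\<^bsub>free_group S\<^esub> r) ` R)"

definition area :: "('g, 'm) monoid_scheme \<Rightarrow> 'g set \<Rightarrow> nat \<Rightarrow> 'g list \<Rightarrow> nat" where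
  "area G S l w =
     (LEAST m. \<exists>cs \<in> lists (conjugates (free_group S) (short_relators G S l)).
        length cs \<le> m \<and> free_word S w = word_prod (free_group S) cs)"

text \<open>The argument is real because the equivalence below rescales it by real constants.
  For finite \<open>S\<close> the supremum is over a finite set.\<close>

definition dehn_function :: "('g, 'm) monoid_scheme \<Rightarrow> 'g set \<Rightarrow> nat \<Rightarrow> real \<Rightarrow> real" where
  "dehn_function G S l x =
     real (SUP w \<in> {w \<in> relations G S. real (length w) \<le> x}. area G S l w)"

definition dehn_equiv :: "(real \<Rightarrow> real) \<Rightarrow> (real \<Rightarrow> real) \<Rightarrow> bool" where
  "dehn_equiv u v \<longleftrightarrow>
     (\<exists>a1 a2 a3 a4 b1 b2 b3 b4.
        a1 > 0 \<and> a2 > 0 \<and> a3 > 0 \<and> a4 > 0 \<and> b1 > 0 \<and> b2 > 0 \<and> b3 > 0 \<and> b4 > 0 \<and>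
        (\<forall>x\<ge>0. a1 * u (a2 * x) - a3 * x - a4 \<le> v x \<and>
               v x \<le> b1 * u (b2 * x) + b3 * x + b4))"

definition finitely_presented :: "('g, 'm) monoid_scheme \<Rightarrow> bool" where
  "finitely_presented G \<longleftrightarrow> (\<exists>S l. presented_in_length G S l)"

definition has_quadratic_dehn_function :: "('g, 'm) monoid_scheme \<Rightarrow> bool" where
  "has_quadratic_dehn_function G \<longleftrightarrow>
     finitely_presented G \<and>
     (\<forall>S l. presented_in_length G S l \<longrightarrow> dehn_equiv (dehn_function G S l) (\<lambda>x. x\<^sup>2))"

section \<open>Baumslag's groups\<close>

definition conj_by :: "('g, 'm) monoid_scheme \<Rightarrow> 'g \<Rightarrow> 'g \<Rightarrow> 'g" where
  "conj_by G x y = inv\<^bsub>G\<^esub> y \<otimes>\<^bsub>G\<^esub> x \<otimes>\<^bsub>G\<^esub> y"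

definition commutator :: "('g, 'm) monoid_scheme \<Rightarrow> 'g \<Rightarrow> 'g \<Rightarrow> 'g" where
  "commutator G x y = inv\<^bsub>G\<^esub> x \<otimes>\<^bsub>G\<^esub> inv\<^bsub>G\<^esub> y \<otimes>\<^bsub>G\<^esub> x \<otimes>\<^bsub>G\<^esub> y"

datatype baumslag_gen = Gen_a | Gen_s | Gen_t

definition baumslag_relators :: "nat \<Rightarrow> baumslag_gen letter list set" where
  "baumslag_relators p =
     (let F = free_group UNIV; a = free_gen Gen_a; s = free_gen Gen_s; t = free_gen Gen_t
      in {a [^]\<^bsub>F\<^esub> p,
          commutator F s t,
          commutator F (conj_by F a t) a,
          conj_by F a s \<otimes>\<^bsub>F\<^esub> inv\<^bsub>F\<^esub> (conj_by F a t \<otimes>\<^bsub>F\<^esub> a)})"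

definition baumslag_group :: "nat \<Rightarrow> baumslag_gen letter list set monoid" where
  "baumslag_group p = presented_group UNIV (baumslag_relators p)"

lemma baumslag_relators_closed: "baumslag_relators p \<subseteq> carrier (free_group UNIV)"
proof -
  interpret F: group "free_group (UNIV :: baumslag_gen set)" by (rule group_free_group)
  show ?thesis
    by (simp add: baumslag_relators_def Let_def commutator_def conj_by_def free_gen_closed)
qed

theorem group_baumslag_group: "group (baumslag_group p)"
  unfolding baumslag_group_def by (intro group_presented_group baumslag_relators_closed)

end

theory Submission
  imports Defs "HOL-Library.Function_Algebras" "HOL-Computational_Algebra.Group_Closure"
begin

text \<open>At each place the residue classes form a tree of nested balls, and a flat picks one line
  in each of the three trees, tied together by the heights \<open>i + j\<close>, \<open>i\<close>
  and \<open>j\<close>. A coordinate can be changed only far out: \<open>i + j\<close> has to be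
  large for the first, \<open>i\<close> small for the second, \<open>j\<close> small for the third.
  Any two of these half planes meet, but all three have no common point. So no single detour leads
  from one element to another, and a path needs two corners. Areas are counted in a free group, so
  sides that cancel have to be equal as words and not only as group elements. Therefore each edge of
  a flat carries one canonical word, computed from data that depend on residues modulo
  \<open>p\<close> only. No filling of a single square is ever written down. There are finitely many
  words of bounded length, and those that are trivial in the group have a common filling bound. To
  use this one has to know that closed walks are trivial in the presented group, and this is the
  purpose of the computation with the presentation.\<close>

text \<open>The normal closure of \<open>a\<close> is the ring \<open>F\<^sub>p[t, t\<^sup>-\<^sup>1, (1 + t)\<^sup>-\<^sup>1]\<close>, on which \<open>t\<close> and \<open>s\<close> act as
  multiplication by \<open>t\<close> and \<open>1 + t\<close>. By partial fractions, an element of the group with image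
  \<open>(i, j)\<close> in \<open>\<int>\<^sup>2\<close> is the same as a triple of residue classes, at the places \<open>\<infinity>\<close>, \<open>0\<close> and \<open>-1\<close>, to
  precisions determined by \<open>(i, j)\<close>. So every triple \<open>(f, g, h)\<close> of ring elements spans a flat, that is,
  a copy of \<open>\<int>\<^sup>2\<close> in the group, and two flats that differ in one coordinate only agree on a half plane.
  The three half planes cut out a triangle, and any two elements at distance \<open>n\<close> can be joined by a path
  through the corners of such a triangle of size \<open>O(n)\<close>, changing one or two coordinates at each corner.
  A geodesic triangle of such paths is filled by a bounded number of triangles in flats, each of quadratic
  area, because the remaining sides cancel in pairs. Halving a word repeatedly and summing the geometric series gives
  the quadratic upper bound. For the lower bound, the relations of the quotient \<open>\<int>\<^sup>2\<close> are measured in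
  the centre of the Heisenberg group.\<close>

section \<open>Products of conjugates\<close>

text \<open>An upper bound instead of the least number: this form passes through products,
  conjugation and homomorphisms, and minimality returns only with
  \<open>area_eq_Least_fills\<close>.\<close>

definition fills :: "('g, 'm) monoid_scheme \<Rightarrow> 'g set \<Rightarrow> nat \<Rightarrow> 'g \<Rightarrow> bool" where
  "fills G Q m g \<longleftrightarrow> (\<exists>cs \<in> lists (conjugates G Q). length cs \<le> m \<and> g = word_prod G cs)"

lemma area_eq_Least_fills:
  "area G S l w = (LEAST m. fills (free_group S) (short_relators G S l) m (free_word S w))"
  by (simp add: area_def fills_def)

lemma fills_subset: "fills G Q m x \<Longrightarrow> Q \<subseteq> Q' \<Longrightarrow> fills G Q' m x"
  unfolding fills_def conjugates_def by (auto simp: subset_iff) blast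

context group
begin

lemma inv_mult_cancel [simp]:
  "x \<in> carrier G \<Longrightarrow> y \<in> carrier G \<Longrightarrow> inv x \<otimes> (x \<otimes> y) = y"
  "x \<in> carrier G \<Longrightarrow> y \<in> carrier G \<Longrightarrow> x \<otimes> (inv x \<otimes> y) = y"
  by (simp_all flip: m_assoc)

lemma word_prod_closed [simp]: "w \<in> lists (carrier G) \<Longrightarrow> word_prod G w \<in> carrier G"
  by (induction w) (auto simp: word_prod_def)

lemma word_prod_append:
  "u \<in> lists (carrier G) \<Longrightarrow> v \<in> lists (carrier G) \<Longrightarrow>
     word_prod G (u @ v) = word_prod G u \<otimes> word_prod G v"
proof (induction u)
  case (Cons x u)
  then show ?case
    using word_prod_closed[of u] word_prod_closed[of v] by (auto simp: word_prod_def m_assoc)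
qed (use word_prod_closed[of v] in \<open>auto simp: word_prod_def\<close>)

lemma conjugates_closed: "Q \<subseteq> carrier G \<Longrightarrow> conjugates G Q \<subseteq> carrier G"
  by (auto simp: conjugates_def)

lemma fills_closed: "Q \<subseteq> carrier G \<Longrightarrow> fills G Q m x \<Longrightarrow> x \<in> carrier G"
  using conjugates_closed[of Q] by (auto simp: fills_def intro!: word_prod_closed)

lemma fills_mono: "fills G Q m x \<Longrightarrow> m \<le> n \<Longrightarrow> fills G Q n x"
  unfolding fills_def by (meson le_trans)

lemma fills_one [simp]: "fills G Q m \<one>"
  unfolding fills_def by (rule bexI[of _ "[]"]) (auto simp: word_prod_def)

lemma fills_zero: "fills G Q 0 x \<longleftrightarrow> x = \<one>"
  by (auto simp: fills_def word_prod_def)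

lemma fills_base: "Q \<subseteq> carrier G \<Longrightarrow> r \<in> Q \<Longrightarrow> fills G Q 1 r"
  unfolding fills_def conjugates_def
  by (rule bexI[of _ "[r]"]) (force simp: word_prod_def)+

lemma fills_mult:
  assumes "Q \<subseteq> carrier G" "fills G Q m x" "fills G Q n y"
  shows "fills G Q (m + n) (x \<otimes> y)"
proof -
  obtain c d where "c \<in> lists (conjugates G Q)" "length c \<le> m" "x = word_prod G c"
    "d \<in> lists (conjugates G Q)" "length d \<le> n" "y = word_prod G d"
    using assms unfolding fills_def by blast
  moreover have "word_prod G (c @ d) = word_prod G c \<otimes> word_prod G d"
    using calculation conjugates_closed[OF assms(1)] by (intro word_prod_append) auto
  ultimately show ?thesis
    unfolding fills_def by (intro bexI[of _ "c @ d"] conjI) auto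
qed

lemma fills_induct [consumes 2, case_names one mult]:
  assumes "Q \<subseteq> carrier G" "fills G Q m x"
    and one: "\<And>m. P m \<one>"
    and mult: "\<And>m g r y. g \<in> carrier G \<Longrightarrow> r \<in> Q \<Longrightarrow> fills G Q m y \<Longrightarrow> P m y \<Longrightarrow>
                 P (Suc m) (g \<otimes> r \<otimes> inv g \<otimes> y)"
  shows "P m x"
proof -
  obtain cs where cs: "cs \<in> lists (conjugates G Q)" "length cs \<le> m" "x = word_prod G cs"
    using assms(2) unfolding fills_def by blast
  have "P m (word_prod G cs)" using cs(1,2)
  proof (induction cs arbitrary: m rule: list.induct)
    case Nil
    then show ?case using one by (simp add: word_prod_def)
  next
    case (Cons c cs)
    then obtain n where n: "m = Suc n" by (cases m) auto
    have "fills G Q n (word_prod G cs)" "P n (word_prod G cs)"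
      using Cons n unfolding fills_def by auto
    moreover obtain g r where "g \<in> carrier G" "r \<in> Q" "c = g \<otimes> r \<otimes> inv g"
      using Cons.prems(1) by (auto simp: conjugates_def)
    ultimately show ?case using mult n by (simp add: word_prod_def)
  qed
  with cs show ?thesis by simp
qed

lemma fills_conj:
  assumes Q: "Q \<subseteq> carrier G" and "fills G Q m x" and g: "g \<in> carrier G"
  shows "fills G Q m (g \<otimes> x \<otimes> inv g)"
  using Q assms(2)
proof (induction rule: fills_induct)
  case (one m)
  then show ?case using g by simp
next
  case (mult m h r y)
  have "fills G Q 1 ((g \<otimes> h) \<otimes> r \<otimes> inv (g \<otimes> h))"
    using mult g unfolding fills_def conjugates_def
    by (intro bexI[of _ "[(g \<otimes> h) \<otimes> r \<otimes> inv (g \<otimes> h)]"])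
       (use Q in \<open>auto simp: word_prod_def subset_iff\<close>)
  from fills_mult[OF Q this mult(4)]
  have "fills G Q (Suc m) ((g \<otimes> h) \<otimes> r \<otimes> inv (g \<otimes> h) \<otimes> (g \<otimes> y \<otimes> inv g))" by simp
  also have "(g \<otimes> h) \<otimes> r \<otimes> inv (g \<otimes> h) \<otimes> (g \<otimes> y \<otimes> inv g) = g \<otimes> (h \<otimes> r \<otimes> inv h \<otimes> y) \<otimes> inv g"
    using mult g Q fills_closed[OF Q mult(3)] by (auto simp: m_assoc inv_mult_group subset_iff)
  finally show ?case .
qed

lemma fills_inv:
  assumes Q: "Q \<subseteq> carrier G" and inv: "\<And>r. r \<in> Q \<Longrightarrow> inv r \<in> Q" and "fills G Q m x"
  shows "fills G Q m (inv x)"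
  using Q assms(3)
proof (induction rule: fills_induct)
  case (mult m g r y)
  have "fills G Q 1 (g \<otimes> inv r \<otimes> inv g)"
    using fills_conj[OF Q fills_base[OF Q inv[OF mult(2)]] mult(1)] .
  from fills_mult[OF Q mult(4) this]
  have "fills G Q (Suc m) (inv y \<otimes> (g \<otimes> inv r \<otimes> inv g))" by simp
  also have "inv y \<otimes> (g \<otimes> inv r \<otimes> inv g) = inv (g \<otimes> r \<otimes> inv g \<otimes> y)"
    using mult Q fills_closed[OF Q mult(3)] by (auto simp: m_assoc inv_mult_group subset_iff)
  finally show ?case .
qed simp

text \<open>\<open>generate\<close> admits inverses while \<open>fills\<close> only multiplies given
  conjugates, so the relators are symmetrized first.\<close>

lemma normal_closure_fills_iff:
  assumes R: "R \<subseteq> carrier G"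
  shows "x \<in> normal_closure G R \<longleftrightarrow> (\<exists>m. fills G (R \<union> (\<lambda>r. inv r) ` R) m x)" (is "_ \<longleftrightarrow> (\<exists>m. fills G ?Q m x)")
proof
  have Q: "?Q \<subseteq> carrier G" using R by auto
  have Qi: "inv r \<in> ?Q" if "r \<in> ?Q" for r using that R by auto
  assume "x \<in> normal_closure G R"
  then show "\<exists>m. fills G ?Q m x"
    unfolding normal_closure_def
  proof (induction rule: generate.induct)
    case (incl h)
    then have "h \<in> conjugates G ?Q" by (auto simp: conjugates_def)
    then have "fills G ?Q 1 h"
      using conjugates_closed[OF Q] unfolding fills_def
      by (intro bexI[of _ "[h]"]) (auto simp: word_prod_def)
    then show ?case by blast
  next
    case (inv h)
    then have "h \<in> conjugates G ?Q" by (auto simp: conjugates_def)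
    then have "fills G ?Q 1 h"
      using conjugates_closed[OF Q] unfolding fills_def
      by (intro bexI[of _ "[h]"]) (auto simp: word_prod_def)
    from fills_inv[OF Q Qi this] show ?case by blast
  next
    case (eng h1 h2)
    then show ?case using fills_mult[OF Q] by blast
  qed (use fills_one in blast)
next
  have Q: "?Q \<subseteq> carrier G" using R by auto
  interpret N: normal "normal_closure G R" G using R by (rule normal_closure_normal)
  have base: "r \<in> normal_closure G R" if "r \<in> R" for r
  proof -
    have "r = \<one> \<otimes> r \<otimes> inv \<one>" using that R by auto
    then have "r \<in> conjugates G R" using that unfolding conjugates_def by blast
    then show ?thesis unfolding normal_closure_def by (rule generate.incl)
  qed
  assume "\<exists>m. fills G ?Q m x"
  then obtain m where "fills G ?Q m x" by blast
  with Q show "x \<in> normal_closure G R"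
  proof (induction rule: fills_induct)
    case (mult m g r y)
    have "r \<in> normal_closure G R" using mult(2) base by auto
    then show ?case using mult N.inv_op_closed2 by simp
  qed simp
qed

text \<open>A conjugate of a relator goes to a conjugate of its image, and conjugation is free of
  charge, so each factor costs at most \<open>K\<close>.\<close>

lemma fills_hom:
  assumes "group H" "h \<in> hom G H" and Q: "Q \<subseteq> carrier G" and Q': "Q' \<subseteq> carrier H"
    and K: "\<And>r. r \<in> Q \<Longrightarrow> fills H Q' K (h r)" and "fills G Q m x"
  shows "fills H Q' (m * K) (h x)"
proof -
  interpret H: group H by fact
  interpret h: group_hom G H h by unfold_locales fact
  show ?thesis using Q assms(6)
  proof (induction rule: fills_induct)
    case (mult m g r y)
    have "fills H Q' K (h g \<otimes>\<^bsub>H\<^esub> h r \<otimes>\<^bsub>H\<^esub> inv\<^bsub>H\<^esub> h g)"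
      using H.fills_conj[OF Q' K[OF mult(2)]] mult(1) by simp
    from H.fills_mult[OF Q' this mult(4)] show ?case
      using mult Q fills_closed[OF Q mult(3)] by (auto simp: subset_iff)
  qed simp
qed

end

section \<open>Homotopies between words and their area\<close>

locale filled_group = group G for G (structure) +
  fixes Q :: "'a set"
  assumes Q_closed: "Q \<subseteq> carrier G"
    and Q_inv: "r \<in> Q \<Longrightarrow> inv r \<in> Q"
begin

definition homotopic :: "nat \<Rightarrow> 'a \<Rightarrow> 'a \<Rightarrow> bool" where
  "homotopic m u v \<longleftrightarrow> u \<in> carrier G \<and> v \<in> carrier G \<and> fills G Q m (u \<otimes> inv v)"

lemma homotopicD [dest]:
  "homotopic m u v \<Longrightarrow> u \<in> carrier G" "homotopic m u v \<Longrightarrow> v \<in> carrier G"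
  by (auto simp: homotopic_def)

lemma homotopic_refl [simp]: "u \<in> carrier G \<Longrightarrow> homotopic m u u"
  by (simp add: homotopic_def)

lemma homotopic_mono: "homotopic m u v \<Longrightarrow> m \<le> n \<Longrightarrow> homotopic n u v"
  by (auto simp: homotopic_def intro: fills_mono)

lemma homotopic_sym: "homotopic m u v \<Longrightarrow> homotopic m v u"
  using fills_inv[OF Q_closed Q_inv, of m "u \<otimes> inv v"] by (auto simp: homotopic_def inv_mult_group)

lemma homotopic_trans:
  assumes "homotopic m u v" "homotopic n v w"
  shows "homotopic (m + n) u w"
proof -
  have "fills G Q (m + n) ((u \<otimes> inv v) \<otimes> (v \<otimes> inv w))"
    using assms fills_mult[OF Q_closed] unfolding homotopic_def by blast
  then show ?thesis using assms by (auto simp: homotopic_def m_assoc)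
qed

text \<open>The difference of the products is the difference of the second factors conjugated by
  \<open>u\<close>, times the difference of the first factors.\<close>

lemma homotopic_mult:
  assumes "homotopic m u v" "homotopic n u' v'"
  shows "homotopic (m + n) (u \<otimes> u') (v \<otimes> v')"
proof -
  have c: "u \<in> carrier G" "v \<in> carrier G" "u' \<in> carrier G" "v' \<in> carrier G"
    using assms by auto
  have "fills G Q n (u \<otimes> (u' \<otimes> inv v') \<otimes> inv u)"
    using assms c fills_conj[OF Q_closed] unfolding homotopic_def by blast
  moreover have "fills G Q m (u \<otimes> inv v)" using assms unfolding homotopic_def by blast
  ultimately have "fills G Q (n + m) ((u \<otimes> (u' \<otimes> inv v') \<otimes> inv u) \<otimes> (u \<otimes> inv v))"
    using fills_mult[OF Q_closed] by blast
  also have "(u \<otimes> (u' \<otimes> inv v') \<otimes> inv u) \<otimes> (u \<otimes> inv v) = (u \<otimes> u') \<otimes> inv (v \<otimes> v')"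
    using c by (simp add: m_assoc inv_mult_group)
  finally show ?thesis using c by (simp add: homotopic_def add.commute)
qed

lemma homotopic_mult_left: "homotopic m u v \<Longrightarrow> x \<in> carrier G \<Longrightarrow> homotopic m (x \<otimes> u) (x \<otimes> v)"
  using homotopic_mult[of 0 x x m u v] by simp

lemma homotopic_mult_right: "homotopic m u v \<Longrightarrow> x \<in> carrier G \<Longrightarrow> homotopic m (u \<otimes> x) (v \<otimes> x)"
  using homotopic_mult[of m u v 0 x x] by simp

lemma homotopic_inv:
  assumes "homotopic m u v"
  shows "homotopic m (inv u) (inv v)"
proof -
  have c: "u \<in> carrier G" "v \<in> carrier G" using assms by auto
  have "homotopic m (inv u \<otimes> (v \<otimes> inv v)) (inv u \<otimes> (u \<otimes> inv v))"
    using homotopic_mult_left[OF homotopic_mult_right[OF homotopic_sym[OF assms], of "inv v"], of "inv u"] c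
    by simp
  then show ?thesis using c by (simp add: r_inv)
qed

lemma homotopic_one_iff: "homotopic m u \<one> \<longleftrightarrow> u \<in> carrier G \<and> fills G Q m u"
  by (auto simp: homotopic_def)

end

section \<open>Homomorphisms from free groups\<close>

lemma free_group_simps [simp]:
  "u \<otimes>\<^bsub>free_group X\<^esub> v = foldr free_cons u v" "\<one>\<^bsub>free_group X\<^esub> = []"
  by (simp_all add: free_group_def)

lemma free_group_carrier: "w \<in> carrier (free_group X) \<longleftrightarrow> w \<in> lists (X \<times> UNIV) \<and> reduced w"
  by (simp add: free_group_def)

lemma letter_closed [simp]: "[(x, b)] \<in> carrier (free_group X) \<longleftrightarrow> x \<in> X"
  by (simp add: free_group_carrier)

lemma free_group_inv:
  assumes "w \<in> carrier (free_group X)"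
  shows "inv\<^bsub>free_group X\<^esub> w = foldr free_cons (rev (map inv_letter w)) []" (is "_ = ?v")
proof -
  interpret F: group "free_group X" by (rule group_free_group)
  have "rev (map inv_letter w) \<in> lists (X \<times> UNIV)"
    using assms by (force simp: free_group_carrier inv_letter_def)
  then have "?v \<in> carrier (free_group X)"
    by (simp add: free_group_carrier reduced_foldr foldr_in_lists del: in_lists_conv_set)
  moreover have "?v \<otimes>\<^bsub>free_group X\<^esub> w = \<one>\<^bsub>free_group X\<^esub>"
    using assms by (simp add: free_group_carrier foldr_free_cons_assoc free_group_left_inv)
  ultimately show ?thesis using F.inv_equality assms by blast
qed

lemma inv_letter_word: "x \<in> X \<Longrightarrow> inv\<^bsub>free_group X\<^esub> [(x, b)] = [(x, \<not> b)]"
  by (simp add: free_group_inv inv_letter_def)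

lemma length_foldr_free_cons: "length (foldr free_cons u v) \<le> length u + length v"
proof (induction u)
  case (Cons l u)
  have "length (free_cons l w) \<le> Suc (length w)" for w by (cases w) auto
  from this[of "foldr free_cons u v"] show ?case using Cons by simp
qed simp

lemma length_free_inv: "w \<in> carrier (free_group X) \<Longrightarrow> length (inv\<^bsub>free_group X\<^esub> w) \<le> length w"
  using length_foldr_free_cons[of "rev (map inv_letter w)" "[]"] by (simp add: free_group_inv)

lemma finite_short_words: "finite X \<Longrightarrow> finite {w \<in> carrier (free_group X). length w \<le> n}"
proof -
  assume X: "finite X"
  have "{w \<in> carrier (free_group X). length w \<le> n} \<subseteq> {w. set w \<subseteq> X \<times> UNIV \<and> length w \<le> n}"
    by (auto simp: free_group_carrier)
  moreover have "finite \<dots>" using X by (intro finite_lists_length_le) simp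
  ultimately show ?thesis by (rule finite_subset)
qed

text \<open>In a reduced word, putting a letter in front is multiplication in the free group; the
  induction step supplies this equation because homomorphisms can be applied to it.\<close>

lemma free_induct [consumes 1, case_names Nil Cons]:
  assumes "w \<in> carrier (free_group X)" "P []"
    and "\<And>x b w. x \<in> X \<Longrightarrow> w \<in> carrier (free_group X) \<Longrightarrow> reduced ((x, b) # w) \<Longrightarrow>
      (x, b) # w = [(x, b)] \<otimes>\<^bsub>free_group X\<^esub> w \<Longrightarrow> P w \<Longrightarrow> P ((x, b) # w)"
  shows "P w"
  using assms(1)
proof (induction w)
  case (Cons l w)
  obtain x b where l: "l = (x, b)" by force
  have w: "w \<in> carrier (free_group X)" "x \<in> X" "reduced (l # w)"
    using Cons.prems reduced_ConsD by (auto simp: free_group_carrier l)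
  then have "l # w = [l] \<otimes>\<^bsub>free_group X\<^esub> w" by (simp add: free_cons_reduced)
  then show ?case using assms(3)[of x w b] w Cons.IH l by simp
qed (rule assms(2))

lemma free_lift_simps [simp]:
  "free_lift G f [] = \<one>\<^bsub>G\<^esub>"
  "free_lift G f ((x, b) # w) = (if b then f x else inv\<^bsub>G\<^esub> f x) \<otimes>\<^bsub>G\<^esub> free_lift G f w"
  by (simp_all add: free_lift_def)

context group
begin

lemma free_lift_closed:
  "f \<in> X \<rightarrow> carrier G \<Longrightarrow> w \<in> lists (X \<times> UNIV) \<Longrightarrow> free_lift G f w \<in> carrier G"
  by (induction w) (auto simp: Pi_iff)

lemma free_lift_foldr:
  assumes f: "f \<in> X \<rightarrow> carrier G" and "u \<in> lists (X \<times> UNIV)" "v \<in> lists (X \<times> UNIV)"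
  shows "free_lift G f (foldr free_cons u v) = free_lift G f u \<otimes> free_lift G f v"
  using assms(2)
proof (induction u)
  case Nil
  then show ?case using free_lift_closed[OF f assms(3)] by simp
next
  case (Cons l u)
  obtain x b where l: "l = (x, b)" by force
  have fx: "f x \<in> carrier G" using Cons f l by auto
  have cons: "free_lift G f (free_cons l w) = free_lift G f (l # w)" if "w \<in> lists (X \<times> UNIV)" for w
  proof (cases w)
    case (Cons k w')
    then have "free_lift G f w' \<in> carrier G" using that free_lift_closed[OF f] by simp
    then show ?thesis using Cons fx by (cases b) (auto simp: l inv_letter_def)
  qed simp
  have "foldr free_cons u v \<in> lists (X \<times> UNIV)" using Cons assms(3) by (intro foldr_in_lists) auto
  then show ?case
    using Cons cons fx free_lift_closed[OF f] assms(3) by (simp add: l m_assoc)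
qed

lemma free_lift_hom: "f \<in> X \<rightarrow> carrier G \<Longrightarrow> free_lift G f \<in> hom (free_group X) G"
  by (rule homI) (simp_all add: free_group_carrier free_lift_foldr free_lift_closed)

lemma free_lift_letter:
  "f \<in> X \<rightarrow> carrier G \<Longrightarrow> x \<in> X \<Longrightarrow> free_lift G f [(x, b)] = (if b then f x else inv f x)"
  by (auto simp: Pi_iff)

lemma free_hom_eqI:
  assumes "h \<in> hom (free_group X) G" "k \<in> hom (free_group X) G"
    and eq: "\<And>x. x \<in> X \<Longrightarrow> h (free_gen x) = k (free_gen x)" and "w \<in> carrier (free_group X)"
  shows "h w = k w"
  using assms(4)
proof (induction rule: free_induct)
  case Nil
  interpret F: group "free_group X" by (rule group_free_group)
  show ?case using hom_one[OF assms(1)] hom_one[OF assms(2)] F.group_axioms group_axioms by simp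
next
  case (Cons x b w)
  interpret F: group "free_group X" by (rule group_free_group)
  interpret h: group_hom "free_group X" G h by unfold_locales (rule assms)
  interpret k: group_hom "free_group X" G k by unfold_locales (rule assms)
  have "h [(x, b)] = k [(x, b)]"
    using eq[OF Cons(1)] Cons(1) h.hom_inv[of "[(x, True)]"] k.hom_inv[of "[(x, True)]"]
    by (cases b) (simp_all add: free_gen_def inv_letter_word)
  then show ?case unfolding Cons(4)
    using Cons(1,2,5) h.hom_mult[of "[(x, b)]" w] k.hom_mult[of "[(x, b)]" w] by simp
qed

end

lemma length_free_lift:
  assumes "\<And>x. x \<in> X \<Longrightarrow> f x \<in> carrier (free_group Y) \<and> length (f x) \<le> L"
    and "w \<in> lists (X \<times> UNIV)"
  shows "length (free_lift (free_group Y) f w) \<le> L * length w"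
  using assms(2)
proof (induction w)
  case (Cons l w)
  obtain x b where l: "l = (x, b)" by force
  let ?g = "if b then f x else inv\<^bsub>free_group Y\<^esub> f x"
  have "length ?g \<le> L"
    using assms(1)[of x] Cons length_free_inv[of "f x" Y] by (auto simp: l)
  then show ?case
    using length_foldr_free_cons[of ?g "free_lift (free_group Y) f w"] Cons by (simp add: l)
qed simp

section \<open>Change of presentation\<close>

lemma free_word_Nil [simp]: "free_word S [] = []"
  by (simp add: free_word_def word_prod_def)

lemma free_word_Cons [simp]: "free_word S (x # w) = free_cons (x, True) (free_word S w)"
  by (simp add: free_word_def word_prod_def free_gen_def)

lemma free_word_closed: "w \<in> lists S \<Longrightarrow> free_word S w \<in> carrier (free_group S)"
proof (induction w)
  case (Cons x w)
  interpret F: group "free_group S" by (rule group_free_group)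
  have "[(x, True)] \<otimes>\<^bsub>free_group S\<^esub> free_word S w \<in> carrier (free_group S)"
    using Cons by (intro F.m_closed) auto
  then show ?case by simp
qed (simp add: free_group_carrier)

lemma length_free_word: "length (free_word S w) \<le> length w"
proof (induction w)
  case (Cons x w)
  then show ?case using length_foldr_free_cons[of "[(x, True)]" "free_word S w"] by simp
qed simp

lemma (in group) free_lift_free_word:
  "S \<subseteq> carrier G \<Longrightarrow> w \<in> lists S \<Longrightarrow> free_lift G (\<lambda>s. s) (free_word S w) = word_prod G w"
proof (induction w)
  case (Cons x w)
  have "free_lift G (\<lambda>s. s) (foldr free_cons [(x, True)] (free_word S w)) =
      free_lift G (\<lambda>s. s) [(x, True)] \<otimes> free_lift G (\<lambda>s. s) (free_word S w)"
    using Cons free_word_closed[of w S]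
    by (intro free_lift_foldr[of _ S]) (auto simp: free_group_carrier)
  then show ?case using Cons by (auto simp: word_prod_def)
qed (simp add: word_prod_def)

lemma (in group) symmetric_generating_set_words:
  assumes "symmetric_generating_set G S" "g \<in> carrier G"
  obtains w where "w \<in> lists S" "word_prod G w = g"
proof -
  have S: "S \<subseteq> carrier G" using assms by (simp add: symmetric_generating_set_def)
  have "g \<in> generate G S" using assms by (simp add: symmetric_generating_set_def)
  then have "\<exists>w\<in>lists S. word_prod G w = g"
  proof (induction rule: generate.induct)
    case one
    then show ?case by (intro bexI[of _ "[]"]) (auto simp: word_prod_def)
  next
    case (incl h)
    then show ?case using S by (intro bexI[of _ "[h]"]) (auto simp: word_prod_def)
  next
    case (inv h)
    then show ?case using S assms
      by (intro bexI[of _ "[inv h]"]) (auto simp: word_prod_def symmetric_generating_set_def)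
  next
    case (eng h k)
    then obtain u v where "u \<in> lists S" "word_prod G u = h" "v \<in> lists S" "word_prod G v = k" by blast
    then show ?case using S word_prod_append[of u v] by (intro bexI[of _ "u @ v"]) auto
  qed
  then show thesis using that by blast
qed

text \<open>A convenient presentation with letters \<open>X\<close> in which the area is estimated;
  the lemmas below carry the estimate over to every finite symmetric generating set
  \<open>S\<close>.\<close>

locale finite_presentation = group G for G (structure) +
  fixes X :: "'x set" and Q :: "'x letter list set" and q :: "'x letter list \<Rightarrow> 'a"
  assumes finite_gens: "finite X" and finite_Q: "finite Q"
    and filled_Q: "filled_group (free_group X) Q"
    and q_hom: "q \<in> hom (free_group X) G"
    and q_surj: "g \<in> carrier G \<Longrightarrow> \<exists>w\<in>carrier (free_group X). q w = g"
    and q_kernel: "w \<in> carrier (free_group X) \<Longrightarrow> q w = \<one> \<longleftrightarrow> (\<exists>m. fills (free_group X) Q m w)"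
begin

context
  fixes S :: "'a set"
  assumes S: "finite S" "symmetric_generating_set G S"
begin

abbreviation eval :: "'a letter list \<Rightarrow> 'a" where
  "eval \<equiv> free_lift G (\<lambda>s. s)"

lemma S_closed: "S \<subseteq> carrier G"
  using S by (simp add: symmetric_generating_set_def)

lemma eval_hom: "eval \<in> hom (free_group S) G"
  using S_closed by (intro free_lift_hom) auto

text \<open>\<open>to_X\<close> and \<open>to_S\<close> are homomorphisms of free groups lying over
  the identity of \<open>G\<close>. Hence \<open>v\<close> and \<open>to_S (to_X v)\<close>
  represent the same element without being equal, and their differences on the letters act as
  additional relators.\<close>

definition to_X :: "'a letter list \<Rightarrow> 'x letter list" where
  "to_X = free_lift (free_group X) (\<lambda>x. SOME w. w \<in> carrier (free_group X) \<and> q w = x)"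

definition to_S :: "'x letter list \<Rightarrow> 'a letter list" where
  "to_S = free_lift (free_group S) (\<lambda>y. SOME w. w \<in> carrier (free_group S) \<and> eval w = q (free_gen y))"

lemma to_X_gen:
  assumes "x \<in> S"
  shows "(SOME w. w \<in> carrier (free_group X) \<and> q w = x) \<in> carrier (free_group X)"
    and "q (SOME w. w \<in> carrier (free_group X) \<and> q w = x) = x"
  using someI_ex[of "\<lambda>w. w \<in> carrier (free_group X) \<and> q w = x"] q_surj[of x] assms S_closed by auto

lemma to_S_gen:
  assumes "y \<in> X"
  shows "(SOME w. w \<in> carrier (free_group S) \<and> eval w = q (free_gen y)) \<in> carrier (free_group S)"
    and "eval (SOME w. w \<in> carrier (free_group S) \<and> eval w = q (free_gen y)) = q (free_gen y)"
proof -
  have "q (free_gen y) \<in> carrier G" by (rule hom_in_carrier[OF q_hom free_gen_closed[OF assms]])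
  then obtain w where "w \<in> lists S" "word_prod G w = q (free_gen y)"
    using S symmetric_generating_set_words by blast
  then have "free_word S w \<in> carrier (free_group S) \<and> eval (free_word S w) = q (free_gen y)"
    using S_closed by (simp add: free_word_closed free_lift_free_word)
  from someI[of "\<lambda>w. w \<in> carrier (free_group S) \<and> eval w = q (free_gen y)", OF this]
  show "(SOME w. w \<in> carrier (free_group S) \<and> eval w = q (free_gen y)) \<in> carrier (free_group S)"
    "eval (SOME w. w \<in> carrier (free_group S) \<and> eval w = q (free_gen y)) = q (free_gen y)" by auto
qed

lemma to_X_hom: "to_X \<in> hom (free_group S) (free_group X)"
  unfolding to_X_def by (intro group.free_lift_hom group_free_group) (auto simp: to_X_gen)

lemma to_S_hom: "to_S \<in> hom (free_group X) (free_group S)"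
  unfolding to_S_def by (intro group.free_lift_hom group_free_group) (auto simp: to_S_gen)

lemma q_to_X: "v \<in> carrier (free_group S) \<Longrightarrow> q (to_X v) = eval v"
proof -
  assume v: "v \<in> carrier (free_group S)"
  have "(q \<circ> to_X) v = eval v"
  proof (rule free_hom_eqI[OF Group.hom_compose[OF to_X_hom q_hom] eval_hom _ v])
    fix x assume x: "x \<in> S"
    interpret F: group "free_group X" by (rule group_free_group)
    have "to_X (free_gen x) = (SOME w. w \<in> carrier (free_group X) \<and> q w = x)"
      unfolding to_X_def free_gen_def using x to_X_gen(1)[OF x] F.r_one by simp
    then show "(q \<circ> to_X) (free_gen x) = eval (free_gen x)"
      using x to_X_gen(2)[OF x] S_closed by (auto simp: free_gen_def)
  qed
  then show ?thesis by simp
qed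

lemma eval_to_S: "w \<in> carrier (free_group X) \<Longrightarrow> eval (to_S w) = q w"
proof -
  assume w: "w \<in> carrier (free_group X)"
  have "(eval \<circ> to_S) w = q w"
  proof (rule free_hom_eqI[OF Group.hom_compose[OF to_S_hom eval_hom] q_hom _ w])
    fix y assume y: "y \<in> X"
    interpret F: group "free_group S" by (rule group_free_group)
    have "to_S (free_gen y) = (SOME w. w \<in> carrier (free_group S) \<and> eval w = q (free_gen y))"
      unfolding to_S_def free_gen_def using y to_S_gen(1)[OF y] F.r_one by (simp add: free_gen_def)
    then show "(eval \<circ> to_S) (free_gen y) = q (free_gen y)"
      using y to_S_gen(2)[OF y] by simp
  qed
  then show ?thesis by simp
qed

lemma length_to_X: "\<exists>L. \<forall>v\<in>carrier (free_group S). length (to_X v) \<le> L * length v"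
proof -
  let ?L = "Max ((\<lambda>x. length (SOME w. w \<in> carrier (free_group X) \<and> q w = x)) ` S)"
  have "length (to_X v) \<le> ?L * length v" if "v \<in> carrier (free_group S)" for v
    unfolding to_X_def using that S(1) to_X_gen(1)
    by (intro length_free_lift[of S]) (auto simp: free_group_carrier)
  then show ?thesis by blast
qed

lemma eval_kernel_to_S:
  assumes "r \<in> Q"
  shows "to_S r \<in> carrier (free_group S)" "eval (to_S r) = \<one>"
proof -
  interpret F: filled_group "free_group X" Q by (rule filled_Q)
  have r: "r \<in> carrier (free_group X)" using assms F.Q_closed by blast
  then show "to_S r \<in> carrier (free_group S)" by (rule hom_in_carrier[OF to_S_hom])
  have "q r = \<one>" using q_kernel[OF r] F.fills_base[OF F.Q_closed assms] by blast
  then show "eval (to_S r) = \<one>" using eval_to_S r by simp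
qed

lemma eval_kernel_gen:
  assumes "x \<in> S"
  shows "free_gen x \<otimes>\<^bsub>free_group S\<^esub> inv\<^bsub>free_group S\<^esub> to_S (to_X (free_gen x)) \<in> carrier (free_group S)"
    "eval (free_gen x \<otimes>\<^bsub>free_group S\<^esub> inv\<^bsub>free_group S\<^esub> to_S (to_X (free_gen x))) = \<one>"
proof -
  interpret FS: group "free_group S" by (rule group_free_group)
  interpret e: group_hom "free_group S" G eval by unfold_locales (rule eval_hom)
  have x: "free_gen x \<in> carrier (free_group S)" using assms by (rule free_gen_closed)
  then have k: "to_X (free_gen x) \<in> carrier (free_group X)" by (rule hom_in_carrier[OF to_X_hom])
  then have h: "to_S (to_X (free_gen x)) \<in> carrier (free_group S)" by (rule hom_in_carrier[OF to_S_hom])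
  show "free_gen x \<otimes>\<^bsub>free_group S\<^esub> inv\<^bsub>free_group S\<^esub> to_S (to_X (free_gen x)) \<in> carrier (free_group S)"
    using x h by (intro FS.m_closed FS.inv_closed)
  have "eval (to_S (to_X (free_gen x))) = eval (free_gen x)" using eval_to_S[OF k] q_to_X[OF x] by simp
  then show "eval (free_gen x \<otimes>\<^bsub>free_group S\<^esub> inv\<^bsub>free_group S\<^esub> to_S (to_X (free_gen x))) = \<one>"
    using e.hom_mult[OF x FS.inv_closed[OF h]] e.hom_inv[OF h] e.hom_closed[OF x] r_inv by metis
qed

text \<open>Passing from \<open>v\<close> to \<open>to_S (to_X v)\<close> costs \<open>K\<close> per
  letter; pushing a filling of \<open>to_X v\<close> forward by \<open>to_S\<close> costs
  \<open>K\<close> per relator.\<close>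

lemma fills_transfer:
  assumes T: "filled_group (free_group S) T"
    and K1: "\<And>r. r \<in> Q \<Longrightarrow> fills (free_group S) T K (to_S r)"
    and K2: "\<And>x. x \<in> S \<Longrightarrow> fills (free_group S) T K
      (free_gen x \<otimes>\<^bsub>free_group S\<^esub> inv\<^bsub>free_group S\<^esub> to_S (to_X (free_gen x)))"
    and v: "v \<in> carrier (free_group S)" and m: "fills (free_group X) Q m (to_X v)"
  shows "fills (free_group S) T (K * length v + m * K) v"
proof -
  interpret FX: filled_group "free_group X" Q by (rule filled_Q)
  interpret FS: filled_group "free_group S" T by (rule T)
  define hk where "hk = to_S \<circ> to_X"
  have "hk \<in> hom (free_group S) (free_group S)"
    unfolding hk_def by (rule Group.hom_compose[OF to_X_hom to_S_hom])
  then interpret hk: group_hom "free_group S" "free_group S" hk by unfold_locales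
  have "FS.homotopic (K * length v) v (hk v)" using v
  proof (induction rule: free_induct)
    case Nil
    show ?case using hk.hom_one by (simp add: free_group_carrier)
  next
    case (Cons x b w)
    have g: "free_gen x \<in> carrier (free_group S)" using Cons by (rule_tac free_gen_closed)
    have K: "FS.homotopic K (free_gen x) (hk (free_gen x))"
      using K2[OF Cons(1)] g hk.hom_closed[OF g] unfolding FS.homotopic_def hk_def comp_def by blast
    have i: "[(x, False)] = inv\<^bsub>free_group S\<^esub> free_gen x"
      using Cons(1) by (simp add: free_gen_def inv_letter_word)
    have "FS.homotopic K [(x, b)] (hk [(x, b)])"
    proof (cases b)
      case True
      then show ?thesis using K by (simp add: free_gen_def)
    next
      case False
      then show ?thesis using FS.homotopic_inv[OF K] hk.hom_inv[OF g] i by simp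
    qed
    from FS.homotopic_mult[OF this Cons(5)]
    have "FS.homotopic (K + K * length w) ((x, b) # w) (hk ((x, b) # w))"
      unfolding Cons(4) using Cons(1,2) hk.hom_mult[of "[(x, b)]" w] by simp
    then show ?case by simp
  qed
  moreover have "fills (free_group S) T (m * K) (hk v)"
    using FX.fills_hom[OF FS.group_axioms to_S_hom FX.Q_closed FS.Q_closed K1 m] by (simp add: hk_def)
  then have "FS.homotopic (m * K) (hk v) \<one>\<^bsub>free_group S\<^esub>"
    using v hk.hom_closed by (simp only: FS.homotopic_one_iff)
  ultimately show ?thesis using FS.homotopic_trans FS.homotopic_one_iff by blast
qed

lemma uniform_fills:
  assumes T: "filled_group (free_group S) T"
    and exQ: "\<And>r. r \<in> Q \<Longrightarrow> \<exists>m. fills (free_group S) T m (to_S r)"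
    and exS: "\<And>x. x \<in> S \<Longrightarrow> \<exists>m. fills (free_group S) T m
      (free_gen x \<otimes>\<^bsub>free_group S\<^esub> inv\<^bsub>free_group S\<^esub> to_S (to_X (free_gen x)))"
  obtains K where "\<And>r. r \<in> Q \<Longrightarrow> fills (free_group S) T K (to_S r)"
    and "\<And>x. x \<in> S \<Longrightarrow> fills (free_group S) T K
      (free_gen x \<otimes>\<^bsub>free_group S\<^esub> inv\<^bsub>free_group S\<^esub> to_S (to_X (free_gen x)))"
proof -
  interpret FS: filled_group "free_group S" T by (rule T)
  define V where "V = to_S ` Q \<union> (\<lambda>x. free_gen x \<otimes>\<^bsub>free_group S\<^esub> inv\<^bsub>free_group S\<^esub> to_S (to_X (free_gen x))) ` S"
  have "finite V" using finite_Q S by (simp add: V_def)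
  moreover have "\<forall>v\<in>V. \<exists>m. fills (free_group S) T m v"
    unfolding V_def using exQ exS by blast
  ultimately have "\<exists>K. \<forall>v\<in>V. fills (free_group S) T K v"
  proof (induction rule: finite_induct)
    case (insert v V)
    then obtain K m where "\<forall>v\<in>V. fills (free_group S) T K v" "fills (free_group S) T m v" by blast
    then have "\<forall>v\<in>insert v V. fills (free_group S) T (max K m) v"
      using FS.fills_mono[OF _ max.cobounded1] FS.fills_mono[OF _ max.cobounded2] by blast
    then show ?case by blast
  qed simp
  then show thesis using that unfolding V_def by blast
qed


section \<open>Short relations of an arbitrary generating set\<close>

lemma short_relators_filled: "filled_group (free_group S) (short_relators G S l)"
proof -
  interpret FS: group "free_group S" by (rule group_free_group)
  have "free_word S ` {r \<in> relations G S. length r \<le> l} \<subseteq> carrier (free_group S)"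
    by (auto simp: relations_def intro!: free_word_closed)
  then show ?thesis
    by unfold_locales (auto simp: short_relators_def Let_def subset_iff)
qed

lemma eval_short_relators: "r \<in> short_relators G S l \<Longrightarrow> eval r = \<one>"
proof -
  assume r: "r \<in> short_relators G S l"
  interpret FS: group "free_group S" by (rule group_free_group)
  interpret e: group_hom "free_group S" G eval by unfold_locales (rule eval_hom)
  have *: "free_word S w \<in> carrier (free_group S)" "eval (free_word S w) = \<one>" if "w \<in> relations G S" for w
    using that S_closed by (auto simp: relations_def free_word_closed free_lift_free_word)
  show ?thesis using r * e.hom_inv by (auto simp: short_relators_def Let_def)
qed

lemma eval_fills:
  assumes "\<And>r. r \<in> T \<Longrightarrow> eval r = \<one>" "T \<subseteq> carrier (free_group S)" "fills (free_group S) T m v"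
  shows "eval v = \<one>"
proof -
  interpret FS: group "free_group S" by (rule group_free_group)
  \<comment> \<open>Without relators and at cost 0, being filled means being trivial.\<close>
  have "fills G {} (m * 0) (eval v)"
    by (rule FS.fills_hom[OF group_axioms eval_hom assms(2) _ _ assms(3)]) (simp_all add: fills_zero assms(1))
  then show ?thesis by (simp add: fills_zero)
qed

text \<open>The relators of the given presentation are relations of length at most \<open>l\<close>,
  so whatever their normal closure contains is also filled by \<open>short_relators\<close>.\<close>

lemma presented_fills:
  assumes "presented_in_length G S l" "v \<in> carrier (free_group S)" "eval v = \<one>"
  shows "\<exists>m. fills (free_group S) (short_relators G S l) m v"
proof -
  interpret FS: group "free_group S" by (rule group_free_group)
  obtain R where R: "R \<subseteq> {w \<in> lists S. length w \<le> l}"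
    and ker: "kernel (free_group S) G eval = normal_closure (free_group S) (free_word S ` R)"
    using assms(1) unfolding presented_in_length_def by blast
  have RC: "free_word S ` R \<subseteq> carrier (free_group S)" using R by (auto intro!: free_word_closed)
  have "R \<subseteq> {r \<in> relations G S. length r \<le> l}"
  proof
    fix r assume r: "r \<in> R"
    have "fills (free_group S) (free_word S ` R \<union> (\<lambda>r. inv\<^bsub>free_group S\<^esub> r) ` free_word S ` R) 1 (free_word S r)"
      using r RC by (intro FS.fills_base) auto
    then have "free_word S r \<in> kernel (free_group S) G eval"
      unfolding ker using FS.normal_closure_fills_iff[OF RC] by blast
    then have "eval (free_word S r) = \<one>" by (simp add: kernel_def)
    then show "r \<in> {r \<in> relations G S. length r \<le> l}"
      using r R S_closed by (auto simp: relations_def free_lift_free_word subset_iff)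
  qed
  then have sub: "free_word S ` R \<union> (\<lambda>r. inv\<^bsub>free_group S\<^esub> r) ` free_word S ` R \<subseteq> short_relators G S l"
    by (auto simp: short_relators_def Let_def)
  have "v \<in> kernel (free_group S) G eval" using assms by (simp add: kernel_def)
  then show ?thesis unfolding ker using FS.normal_closure_fills_iff[OF RC] fills_subset[OF _ sub] by blast
qed

text \<open>\<open>to_X\<close> multiplies lengths by at most a constant \<open>L\<close> and
  \<open>fills_transfer\<close> adds only a linear term, so the quadratic order survives.\<close>

lemma quadratic_fills:
  assumes C: "\<And>w. w \<in> carrier (free_group X) \<Longrightarrow> q w = \<one> \<Longrightarrow> fills (free_group X) Q (C * (length w)\<^sup>2 + C) w"
    and "presented_in_length G S l"
  shows "\<exists>D. \<forall>w\<in>relations G S. fills (free_group S) (short_relators G S l) (D * (length w)\<^sup>2 + D) (free_word S w)"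
proof -
  interpret FS: filled_group "free_group S" "short_relators G S l" by (rule short_relators_filled)
  obtain K where K1: "\<And>r. r \<in> Q \<Longrightarrow> fills (free_group S) (short_relators G S l) K (to_S r)"
    and K2: "\<And>x. x \<in> S \<Longrightarrow> fills (free_group S) (short_relators G S l) K
      (free_gen x \<otimes>\<^bsub>free_group S\<^esub> inv\<^bsub>free_group S\<^esub> to_S (to_X (free_gen x)))"
    using uniform_fills[OF short_relators_filled] presented_fills[OF assms(2)]
      eval_kernel_to_S eval_kernel_gen by metis
  obtain L where L: "\<And>v. v \<in> carrier (free_group S) \<Longrightarrow> length (to_X v) \<le> L * length v"
    using length_to_X by blast
  let ?D = "K + C * L\<^sup>2 * K + C * K"
  have "fills (free_group S) (short_relators G S l) (?D * (length w)\<^sup>2 + ?D) (free_word S w)"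
    if w: "w \<in> relations G S" for w
  proof -
    define v where "v = free_word S w"
    have v: "v \<in> carrier (free_group S)" "eval v = \<one>" "length v \<le> length w"
      using w S_closed by (auto simp: v_def relations_def free_word_closed free_lift_free_word length_free_word)
    have "length (to_X v) \<le> L * length w" using L[OF v(1)] v(3) by (meson le_trans mult_le_mono2)
    then have "(length (to_X v))\<^sup>2 \<le> L\<^sup>2 * (length w)\<^sup>2" by (metis power_mono power_mult_distrib zero_le)
    then have le: "C * (length (to_X v))\<^sup>2 \<le> C * L\<^sup>2 * (length w)\<^sup>2" by (simp add: mult.assoc)
    have "fills (free_group X) Q (C * (length (to_X v))\<^sup>2 + C) (to_X v)"
      using v q_to_X hom_in_carrier[OF to_X_hom] by (intro C) auto
    from fills_transfer[OF short_relators_filled K1 K2 v(1) this]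
    have "fills (free_group S) (short_relators G S l)
        (K * length v + (C * (length (to_X v))\<^sup>2 + C) * K) v" .
    moreover have "K * length v + (C * (length (to_X v))\<^sup>2 + C) * K \<le> ?D * (length w)\<^sup>2 + ?D"
    proof -
      have "length w \<le> (length w)\<^sup>2" by (cases "length w") (auto simp: power2_eq_square)
      then have "K * length v \<le> K * (length w)\<^sup>2" using v(3) by (intro mult_le_mono2) linarith
      moreover have "(C * (length (to_X v))\<^sup>2 + C) * K \<le> (C * L\<^sup>2 * (length w)\<^sup>2 + C) * K"
        using le by simp
      ultimately have "K * length v + (C * (length (to_X v))\<^sup>2 + C) * K
          \<le> K * (length w)\<^sup>2 + (C * L\<^sup>2 * (length w)\<^sup>2 + C) * K" by (rule add_mono)
      also have "\<dots> \<le> ?D * (length w)\<^sup>2 + ?D" by (simp add: algebra_simps)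
      finally show ?thesis .
    qed
    ultimately show ?thesis unfolding v_def by (rule FS.fills_mono)
  qed
  then show ?thesis by blast
qed

lemma eval_positive:
  "v \<in> lists (S \<times> UNIV) \<Longrightarrow> eval v = word_prod G (map (\<lambda>(x, b). if b then x else inv x) v)"
  by (induction v) (auto simp: word_prod_def)

text \<open>Relations are words in positive letters. Each letter \<open>(x, False)\<close> is first
  traded for \<open>(inv x, True)\<close> by the relation \<open>[inv x, x]\<close>, whence
  \<open>2 \<le> l\<close>.\<close>

lemma kernel_fills_length:
  assumes v: "v \<in> carrier (free_group S)" and "eval v = \<one>" and l: "2 \<le> l" "length v \<le> l"
  shows "\<exists>m. fills (free_group S) (short_relators G S l) m v"
proof -
  interpret FS: filled_group "free_group S" "short_relators G S l" by (rule short_relators_filled)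
  let ?pos = "map (\<lambda>(x, b). if b then x else inv x)"
  have S_inv: "x \<in> S \<Longrightarrow> inv x \<in> S" for x using S by (simp add: symmetric_generating_set_def)
  have pos: "?pos w \<in> lists S" if "w \<in> lists (S \<times> UNIV)" for w
    using that S_inv by (induction w) auto
  have "\<exists>m. FS.homotopic m v (free_word S (?pos v))" using v
  proof (induction rule: free_induct)
    case Nil
    then show ?case by (auto simp: free_group_carrier)
  next
    case (Cons x b w)
    then obtain m where m: "FS.homotopic m w (free_word S (?pos w))" by blast
    let ?y = "if b then x else inv x"
    have y: "?y \<in> S" using Cons S_inv by auto
    have "FS.homotopic 1 [(x, b)] [(?y, True)]"
    proof (cases b)
      case True
      then show ?thesis using Cons by simp
    next
      case False
      have "[inv x, x] \<in> relations G S"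
        using Cons S_inv S_closed by (auto simp: relations_def word_prod_def)
      then have "inv\<^bsub>free_group S\<^esub> free_word S [inv x, x] \<in> short_relators G S l"
        unfolding short_relators_def Let_def using l by (intro UnI2 imageI) auto
      from FS.fills_base[OF FS.Q_closed this]
      have "fills (free_group S) (short_relators G S l) 1 (inv\<^bsub>free_group S\<^esub> ([(inv x, True)] \<otimes>\<^bsub>free_group S\<^esub> [(x, True)]))"
        by simp
      moreover have "inv\<^bsub>free_group S\<^esub> ([(inv x, True)] \<otimes>\<^bsub>free_group S\<^esub> [(x, True)])
          = [(x, False)] \<otimes>\<^bsub>free_group S\<^esub> inv\<^bsub>free_group S\<^esub> [(inv x, True)]"
        using Cons S_inv by (subst FS.inv_mult_group) (simp_all add: inv_letter_word)
      ultimately show ?thesis unfolding FS.homotopic_def using False Cons S_inv by simp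
    qed
    from FS.homotopic_mult[OF this m]
    have "FS.homotopic (1 + m) ((x, b) # w) (free_word S (?pos ((x, b) # w)))"
      using Cons(4)[symmetric] by simp
    then show ?case by blast
  qed
  then obtain m where m: "FS.homotopic m v (free_word S (?pos v))" by blast
  have "?pos v \<in> relations G S"
    using assms pos[of v] eval_positive[of v] by (auto simp: relations_def free_group_carrier)
  then have "free_word S (?pos v) \<in> short_relators G S l"
    using l by (auto simp: short_relators_def Let_def)
  from FS.fills_base[OF FS.Q_closed this]
  have "FS.homotopic 1 (free_word S (?pos v)) \<one>\<^bsub>free_group S\<^esub>"
    using m by (simp only: FS.homotopic_one_iff) blast
  from FS.homotopic_trans[OF m this] show ?thesis by (simp only: FS.homotopic_one_iff) blast
qed

lemma presented_in_length_exists: "\<exists>l. presented_in_length G S l"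
proof -
  interpret FS: group "free_group S" by (rule group_free_group)
  define V where "V = to_S ` Q \<union> (\<lambda>x. free_gen x \<otimes>\<^bsub>free_group S\<^esub> inv\<^bsub>free_group S\<^esub> to_S (to_X (free_gen x))) ` S"
  \<comment> \<open>\<open>V\<close> collects what \<open>fills_transfer\<close> has to fill; the
    bound 2 makes room for the relations \<open>[inv x, x]\<close>.\<close>
  define l where "l = max 2 (Max (insert 0 (length ` V)))"
  have finV: "finite V" using finite_Q S by (simp add: V_def)
  have V: "v \<in> carrier (free_group S) \<and> eval v = \<one>" if "v \<in> V" for v
    using that unfolding V_def using eval_kernel_to_S eval_kernel_gen by blast
  have len: "length v \<le> l" if "v \<in> V" for v
    using that finV by (auto simp: l_def intro: max.coboundedI2)
  have ex: "\<exists>m. fills (free_group S) (short_relators G S l) m v" if "v \<in> V" for v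
    using kernel_fills_length[of v l] V[OF that] len[OF that] by (auto simp: l_def)
  obtain K where K1: "\<And>r. r \<in> Q \<Longrightarrow> fills (free_group S) (short_relators G S l) K (to_S r)"
    and K2: "\<And>x. x \<in> S \<Longrightarrow> fills (free_group S) (short_relators G S l) K
      (free_gen x \<otimes>\<^bsub>free_group S\<^esub> inv\<^bsub>free_group S\<^esub> to_S (to_X (free_gen x)))"
    by (rule uniform_fills[OF short_relators_filled, of l]) (use ex V_def in blast)+
  let ?R = "{r \<in> relations G S. length r \<le> l}"
  interpret SR: filled_group "free_group S" "short_relators G S l" by (rule short_relators_filled)
  have RC: "free_word S ` ?R \<subseteq> carrier (free_group S)"
    by (auto simp: relations_def intro!: free_word_closed)
  have nc: "x \<in> normal_closure (free_group S) (free_word S ` ?R) \<longleftrightarrow>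
      (\<exists>m. fills (free_group S) (short_relators G S l) m x)" for x
    using FS.normal_closure_fills_iff[OF RC] by (simp add: short_relators_def)
  have "kernel (free_group S) G eval = normal_closure (free_group S) (free_word S ` ?R)"
  proof (intro equalityI subsetI)
    fix v assume "v \<in> kernel (free_group S) G eval"
    then have v: "v \<in> carrier (free_group S)" "eval v = \<one>" by (auto simp: kernel_def)
    then have "q (to_X v) = \<one>" using q_to_X by simp
    then obtain m where "fills (free_group X) Q m (to_X v)"
      using q_kernel hom_in_carrier[OF to_X_hom v(1)] by blast
    from fills_transfer[OF short_relators_filled K1 K2 v(1) this]
    show "v \<in> normal_closure (free_group S) (free_word S ` ?R)" unfolding nc by blast
  next
    fix v assume "v \<in> normal_closure (free_group S) (free_word S ` ?R)"
    then obtain m where m: "fills (free_group S) (short_relators G S l) m v" unfolding nc by blast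
    then have "eval v = \<one>" using eval_fills[of "short_relators G S l" m v] eval_short_relators SR.Q_closed by blast
    then show "v \<in> kernel (free_group S) G eval"
      using FS.fills_closed[OF SR.Q_closed m] by (simp add: kernel_def)
  qed
  then have "presented_in_length G S l"
    unfolding presented_in_length_def using S
    by (intro conjI exI[of _ ?R]) (auto simp: relations_def)
  then show ?thesis by blast
qed

end

end

section \<open>Filling loops in a union of flats\<close>

context group
begin

primrec up_prod :: "(int \<Rightarrow> 'a) \<Rightarrow> nat \<Rightarrow> 'a" where
  "up_prod s 0 = \<one>"
| "up_prod s (Suc n) = up_prod s n \<otimes> s (int n)"

primrec down_prod :: "(int \<Rightarrow> 'a) \<Rightarrow> nat \<Rightarrow> 'a" where
  "down_prod s 0 = \<one>"
| "down_prod s (Suc n) = down_prod s n \<otimes> inv (s (- int n - 1))"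

definition potential :: "(int \<Rightarrow> 'a) \<Rightarrow> int \<Rightarrow> 'a" where
  "potential s i = (if 0 \<le> i then up_prod s (nat i) else down_prod s (nat (- i)))"

text \<open>For \<open>i \<le> j\<close> this is the product of \<open>s k\<close> over \<open>i \<le> k < j\<close>. Writing it as a quotient of two
  values of one potential makes it additive in \<open>(i, j)\<close> for arbitrary signs.\<close>

definition seg :: "(int \<Rightarrow> 'a) \<Rightarrow> int \<Rightarrow> int \<Rightarrow> 'a" where
  "seg s i j = inv (potential s i) \<otimes> potential s j"

context
  fixes s :: "int \<Rightarrow> 'a"
  assumes s_closed: "\<And>i. s i \<in> carrier G"
begin

lemma potential_closed: "potential s i \<in> carrier G"
proof -
  have "up_prod s n \<in> carrier G" "down_prod s n \<in> carrier G" for n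
    by (induction n) (simp_all add: s_closed)
  then show ?thesis by (simp add: potential_def)
qed

lemma potential_step: "potential s (i + 1) = potential s i \<otimes> s i"
proof (cases "0 \<le> i")
  case True
  then have "nat (i + 1) = Suc (nat i)" by simp
  then show ?thesis using True by (simp add: potential_def)
next
  case False
  define n where "n = nat (- i - 1)"
  have n: "i = - int n - 1" "nat (- i) = Suc n" using False by (auto simp: n_def)
  have "potential s i = down_prod s n \<otimes> inv (s i)" using False n by (simp add: potential_def)
  moreover have "potential s (i + 1) = down_prod s n"
  proof (cases n)
    case 0
    then show ?thesis using n by (simp add: potential_def)
  next
    case (Suc k)
    then have "\<not> 0 \<le> i + 1" "nat (- (i + 1)) = n" using n by auto
    then show ?thesis by (simp only: potential_def if_False)
  qed
  moreover have "down_prod s n \<in> carrier G"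
    by (induction n) (simp_all add: s_closed)
  ultimately show ?thesis by (simp add: m_assoc s_closed)
qed

lemma seg_closed: "seg s i j \<in> carrier G"
  by (simp add: seg_def potential_closed)

lemma seg_refl: "seg s i i = \<one>"
  by (simp add: seg_def potential_closed)

lemma seg_trans: "seg s i j \<otimes> seg s j k = seg s i k"
  by (simp add: seg_def potential_closed m_assoc)

lemma seg_inv: "inv (seg s i j) = seg s j i"
  by (simp add: seg_def potential_closed inv_mult_group)

lemma seg_Suc: "seg s i (j + 1) = seg s i j \<otimes> s j"
  by (simp add: seg_def potential_step potential_closed s_closed m_assoc)

lemma seg_pred: "seg s i (j - 1) = seg s i j \<otimes> inv (s (j - 1))"
  using seg_Suc[of i "j - 1"] by (simp add: m_assoc seg_closed s_closed)

end

lemma seg_cong: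
  assumes "\<And>i. s i \<in> carrier G" "\<And>i. s' i \<in> carrier G"
    and "\<And>k. min i j \<le> k \<Longrightarrow> k < max i j \<Longrightarrow> s k = s' k"
  shows "seg s i j = seg s' i j"
proof -
  have *: "seg s i j = seg s' i j" if "i \<le> j" "\<And>k. i \<le> k \<Longrightarrow> k < j \<Longrightarrow> s k = s' k" for i j
    using that
  proof (induction j rule: int_ge_induct)
    case base
    then show ?case using assms by (simp add: seg_refl)
  next
    case (step j)
    then show ?case using assms(1,2) by (simp add: seg_Suc)
  qed
  show ?thesis
  proof (cases "i \<le> j")
    case True
    then show ?thesis using assms(3) by (intro *) auto
  next
    case False
    then have "seg s j i = seg s' j i" using assms(3) by (intro *) auto
    then have "inv (seg s j i) = inv (seg s' j i)" by simp
    then show ?thesis using assms(1,2) by (simp add: seg_inv)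
  qed
qed

end

context filled_group
begin

text \<open>\<open>s\<close> and \<open>s'\<close> are the rails and \<open>c\<close> the rungs; the
  word is pushed across one square after the other. Downwards, the same square is read with its two
  rail sides inverted.\<close>

lemma seg_ladder:
  assumes s: "\<And>i. s i \<in> carrier G" and s': "\<And>i. s' i \<in> carrier G" and c: "\<And>i. c i \<in> carrier G"
    and sq: "\<And>i. homotopic m (s i \<otimes> c (i + 1)) (c i \<otimes> s' i)"
  shows "homotopic (m * nat \<bar>j - i\<bar>) (seg s i j \<otimes> c j) (c i \<otimes> seg s' i j)"
proof (induction j rule: int_induct[of _ i])
  case base
  then show ?case using c by (simp add: seg_refl s s')
next
  case (step1 j)
  have "homotopic m (seg s i j \<otimes> (s j \<otimes> c (j + 1))) (seg s i j \<otimes> (c j \<otimes> s' j))"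
    by (intro homotopic_mult_left sq seg_closed s)
  moreover have "homotopic (m * nat \<bar>j - i\<bar>) (seg s i j \<otimes> c j \<otimes> s' j) (c i \<otimes> seg s' i j \<otimes> s' j)"
    by (intro homotopic_mult_right step1 s')
  ultimately have "homotopic (m + m * nat \<bar>j - i\<bar>) (seg s i j \<otimes> (s j \<otimes> c (j + 1))) (c i \<otimes> seg s' i j \<otimes> s' j)"
    by (elim homotopic_trans) (simp add: m_assoc seg_closed s s' c)
  then have "homotopic (m + m * nat \<bar>j - i\<bar>) (seg s i (j + 1) \<otimes> c (j + 1)) (c i \<otimes> seg s' i (j + 1))"
    by (simp add: m_assoc seg_Suc seg_closed s s' c)
  moreover have "nat \<bar>j + 1 - i\<bar> = Suc (nat \<bar>j - i\<bar>)" using step1 by simp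
  ultimately show ?case by (simp only: mult_Suc_right)
next
  case (step2 j)
  let ?k = "j - 1"
  have "homotopic m (inv (s ?k) \<otimes> (c ?k \<otimes> s' ?k) \<otimes> inv (s' ?k)) (inv (s ?k) \<otimes> (s ?k \<otimes> c j) \<otimes> inv (s' ?k))"
    using homotopic_sym[OF sq[of ?k]] s s' by (intro homotopic_mult_left homotopic_mult_right) auto
  then have "homotopic m (inv (s ?k) \<otimes> c ?k) (c j \<otimes> inv (s' ?k))"
    using s s' c by (simp add: m_assoc)
  then have "homotopic m (seg s i j \<otimes> (inv (s ?k) \<otimes> c ?k)) (seg s i j \<otimes> (c j \<otimes> inv (s' ?k)))"
    by (intro homotopic_mult_left seg_closed s)
  moreover have "homotopic (m * nat \<bar>j - i\<bar>) (seg s i j \<otimes> c j \<otimes> inv (s' ?k)) (c i \<otimes> seg s' i j \<otimes> inv (s' ?k))"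
    using s' by (intro homotopic_mult_right step2) auto
  ultimately have "homotopic (m + m * nat \<bar>j - i\<bar>) (seg s i j \<otimes> (inv (s ?k) \<otimes> c ?k)) (c i \<otimes> seg s' i j \<otimes> inv (s' ?k))"
    by (elim homotopic_trans) (simp add: m_assoc seg_closed s s' c)
  then have "homotopic (m + m * nat \<bar>j - i\<bar>) (seg s i ?k \<otimes> c ?k) (c i \<otimes> seg s' i ?k)"
    by (simp add: m_assoc seg_pred seg_closed s s' c)
  moreover have "nat \<bar>j - 1 - i\<bar> = Suc (nat \<bar>j - i\<bar>)" using step2 by simp
  ultimately show ?case by (simp only: mult_Suc_right)
qed

end

text \<open>A flat is a map from the grid of integer points to the states of the walk; it is given by the
  words \<open>hs\<close> and \<open>vs\<close> read along its horizontal and vertical edges, and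
  \<open>same \<phi> \<psi> i j\<close> says that two flats meet at the point \<open>(i, j)\<close>.\<close>

locale flat_complex = filled_group G Q for G (structure) and Q +
  fixes hs vs :: "'f \<Rightarrow> int \<Rightarrow> int \<Rightarrow> 'a" and same :: "'f \<Rightarrow> 'f \<Rightarrow> int \<Rightarrow> int \<Rightarrow> bool" and K :: nat
  assumes hs_closed: "hs \<phi> i j \<in> carrier G" and vs_closed: "vs \<phi> i j \<in> carrier G"
    and square: "homotopic K (hs \<phi> i j \<otimes> vs \<phi> (i + 1) j) (vs \<phi> i j \<otimes> hs \<phi> i (j + 1))"
    and hs_same: "same \<phi> \<psi> i j \<Longrightarrow> same \<phi> \<psi> (i + 1) j \<Longrightarrow> hs \<phi> i j = hs \<psi> i j"
    and vs_same: "same \<phi> \<psi> i j \<Longrightarrow> same \<phi> \<psi> i (j + 1) \<Longrightarrow> vs \<phi> i j = vs \<psi> i j"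
begin

section \<open>Paths inside one flat\<close>

definition hor :: "'f \<Rightarrow> int \<Rightarrow> int \<Rightarrow> int \<Rightarrow> 'a" where
  "hor \<phi> j i i' = seg (\<lambda>i. hs \<phi> i j) i i'"

definition vert :: "'f \<Rightarrow> int \<Rightarrow> int \<Rightarrow> int \<Rightarrow> 'a" where
  "vert \<phi> i j j' = seg (\<lambda>j. vs \<phi> i j) j j'"

text \<open>The vertical part comes first. The leg in the opposite direction therefore turns at the
  other corner of the rectangle, and which half plane a leg stays in depends on its
  direction.\<close>

definition leg :: "'f \<Rightarrow> int \<times> int \<Rightarrow> int \<times> int \<Rightarrow> 'a" where
  "leg \<phi> P P' = vert \<phi> (fst P) (snd P) (snd P') \<otimes> hor \<phi> (snd P') (fst P) (fst P')"

lemma hor_closed [simp]: "hor \<phi> j i i' \<in> carrier G"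
  by (simp add: hor_def seg_closed hs_closed)

lemma vert_closed [simp]: "vert \<phi> i j j' \<in> carrier G"
  by (simp add: vert_def seg_closed vs_closed)

lemma leg_closed [simp]: "leg \<phi> P P' \<in> carrier G"
  by (simp add: leg_def)

lemma hor_trans: "hor \<phi> j i i' \<otimes> hor \<phi> j i' i'' = hor \<phi> j i i''"
  by (simp add: hor_def seg_trans hs_closed)

lemma vert_trans: "vert \<phi> i j j' \<otimes> vert \<phi> i j' j'' = vert \<phi> i j j''"
  by (simp add: vert_def seg_trans vs_closed)

lemma leg_refl [simp]: "leg \<phi> P P = \<one>"
  by (simp add: leg_def hor_def vert_def seg_refl hs_closed vs_closed)

text \<open>A ladder of ladders: the rungs of the outer one are horizontal segments, and each of its
  squares is a strip filled by an inner ladder.\<close>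

lemma rectangle:
  "homotopic (K * nat \<bar>i' - i\<bar> * nat \<bar>j' - j\<bar>)
     (vert \<phi> i j j' \<otimes> hor \<phi> j' i i') (hor \<phi> j i i' \<otimes> vert \<phi> i' j j')"
  unfolding vert_def hor_def
proof (rule seg_ladder)
  fix j
  show "homotopic (K * nat \<bar>i' - i\<bar>) (vs \<phi> i j \<otimes> seg (\<lambda>i. hs \<phi> i (j + 1)) i i')
          (seg (\<lambda>i. hs \<phi> i j) i i' \<otimes> vs \<phi> i' j)"
    by (rule homotopic_sym, rule seg_ladder) (simp_all add: hs_closed vs_closed square)
qed (simp_all add: hs_closed vs_closed seg_closed)

text \<open>Exchanging the horizontal part of the first leg with the vertical part of the second one
  makes the remaining parts merge, so a single rectangle is filled. The two bounds are those on its
  sides.\<close>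

lemma leg_trans:
  assumes "\<bar>fst P' - fst P\<bar> \<le> int D" "\<bar>snd P'' - snd P'\<bar> \<le> int D"
  shows "homotopic (K * D * D) (leg \<phi> P P' \<otimes> leg \<phi> P' P'') (leg \<phi> P P'')"
proof -
  obtain i j i' j' i'' j'' where P: "P = (i, j)" "P' = (i', j')" "P'' = (i'', j'')"
    by (metis prod.exhaust)
  let ?n = "K * nat \<bar>i' - i\<bar> * nat \<bar>j'' - j'\<bar>"
  have "homotopic ?n
      (vert \<phi> i j j' \<otimes> (hor \<phi> j' i i' \<otimes> vert \<phi> i' j' j'') \<otimes> hor \<phi> j'' i' i'')
      (vert \<phi> i j j' \<otimes> (vert \<phi> i j' j'' \<otimes> hor \<phi> j'' i i') \<otimes> hor \<phi> j'' i' i'')"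
    by (intro homotopic_mult_left homotopic_mult_right homotopic_sym[OF rectangle]) auto
  moreover have "vert \<phi> i j j' \<otimes> (vert \<phi> i j' j'' \<otimes> hor \<phi> j'' i i') \<otimes> hor \<phi> j'' i' i''
      = (vert \<phi> i j j' \<otimes> vert \<phi> i j' j'') \<otimes> (hor \<phi> j'' i i' \<otimes> hor \<phi> j'' i' i'')"
    by (simp add: m_assoc)
  ultimately have "homotopic ?n (leg \<phi> P P' \<otimes> leg \<phi> P' P'') (leg \<phi> P P'')"
    unfolding leg_def P by (simp add: m_assoc hor_trans vert_trans)
  moreover have "?n \<le> K * D * D"
    using assms P by (intro mult_le_mono) auto
  ultimately show ?thesis by (rule homotopic_mono)
qed

lemma leg_back:
  assumes "\<bar>fst P' - fst P\<bar> \<le> int D" "\<bar>snd P' - snd P\<bar> \<le> int D"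
  shows "homotopic (K * D * D) (leg \<phi> P P') (inv (leg \<phi> P' P))"
proof -
  have "homotopic (K * D * D) (leg \<phi> P P' \<otimes> leg \<phi> P' P \<otimes> inv (leg \<phi> P' P)) (\<one> \<otimes> inv (leg \<phi> P' P))"
    using leg_trans[of P' P D P \<phi>] assms by (intro homotopic_mult_right) (auto simp: abs_minus_commute)
  then show ?thesis by (simp add: m_assoc)
qed

definition same_leg :: "'f \<Rightarrow> 'f \<Rightarrow> int \<times> int \<Rightarrow> int \<times> int \<Rightarrow> bool" where
  "same_leg \<phi> \<psi> P P' \<longleftrightarrow>
     (\<forall>j. min (snd P) (snd P') \<le> j \<and> j \<le> max (snd P) (snd P') \<longrightarrow> same \<phi> \<psi> (fst P) j) \<and>
     (\<forall>i. min (fst P) (fst P') \<le> i \<and> i \<le> max (fst P) (fst P') \<longrightarrow> same \<phi> \<psi> i (snd P'))"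

lemma leg_same:
  assumes "same_leg \<phi> \<psi> P P'"
  shows "leg \<phi> P P' = leg \<psi> P P'"
proof -
  have "hor \<phi> (snd P') (fst P) (fst P') = hor \<psi> (snd P') (fst P) (fst P')"
    unfolding hor_def using assms
    by (intro seg_cong hs_closed hs_same; unfold same_leg_def) simp_all
  moreover have "vert \<phi> (fst P) (snd P) (snd P') = vert \<psi> (fst P) (snd P) (snd P')"
    unfolding vert_def using assms
    by (intro seg_cong vs_closed vs_same; unfold same_leg_def) simp_all
  ultimately show ?thesis by (simp add: leg_def)
qed

section \<open>Paths that change the flat twice\<close>

definition connection :: "'f \<Rightarrow> 'f \<Rightarrow> 'f \<Rightarrow> int \<times> int \<Rightarrow> int \<times> int \<Rightarrow> int \<times> int \<Rightarrow> int \<times> int \<Rightarrow> 'a" where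
  "connection \<phi> \<chi> \<psi> p P P' p' = leg \<phi> p P \<otimes> leg \<chi> P P' \<otimes> leg \<psi> P' p'"

lemma connection_closed [simp]: "connection \<phi> \<chi> \<psi> p P P' p' \<in> carrier G"
  by (simp add: connection_def)

lemma connection_self:
  assumes "\<bar>fst P - fst p\<bar> \<le> int D" "\<bar>snd P' - snd P\<bar> \<le> int D"
    "\<bar>fst P' - fst p\<bar> \<le> int D" "\<bar>snd P' - snd p\<bar> \<le> int D"
  shows "homotopic (2 * (K * D * D)) (connection \<phi> \<phi> \<phi> p P P' p) \<one>"
proof -
  have "homotopic (K * D * D) (leg \<phi> p P \<otimes> leg \<phi> P P' \<otimes> leg \<phi> P' p) (leg \<phi> p P' \<otimes> leg \<phi> P' p)"
    using leg_trans[of P p D P' \<phi>] assms by (intro homotopic_mult_right) auto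
  moreover have "homotopic (K * D * D) (leg \<phi> p P' \<otimes> leg \<phi> P' p) \<one>"
    using leg_trans[of P' p D p \<phi>] assms by (simp add: abs_minus_commute)
  ultimately have "homotopic (K * D * D + K * D * D) (leg \<phi> p P \<otimes> leg \<phi> P P' \<otimes> leg \<phi> P' p) \<one>"
    by (rule homotopic_trans)
  then show ?thesis by (simp add: connection_def mult_2)
qed

definition in_box :: "nat \<Rightarrow> (int \<times> int) set \<Rightarrow> bool" where
  "in_box D A \<longleftrightarrow> (\<forall>S\<in>A. \<forall>S'\<in>A. \<bar>fst S - fst S'\<bar> \<le> int D \<and> \<bar>snd S - snd S'\<bar> \<le> int D)"

lemma in_boxD:
  assumes "in_box D A" "S \<in> A" "S' \<in> A"
  shows "\<bar>fst S - fst S'\<bar> \<le> int D" "\<bar>snd S - snd S'\<bar> \<le> int D"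
  using assms unfolding in_box_def by blast+

text \<open>The old and the new corner are joined by a leg on which the outer and the middle flat
  agree. It can be inserted in the one flat and absorbed in the other; this takes four merges of
  legs.\<close>

lemma connection_change:
  assumes box: "in_box D {p, p', P, P', R, R'}"
    and "same_leg \<phi> \<chi> R P" "same_leg \<chi> \<psi> P' R'"
  shows "homotopic (4 * (K * D * D)) (connection \<phi> \<chi> \<psi> p P P' p') (connection \<phi> \<chi> \<psi> p R R' p')"
proof -
  let ?k = "K * D * D"
  have e: "leg \<phi> R P = leg \<chi> R P" "leg \<psi> P' R' = leg \<chi> P' R'"
    using assms leg_same by auto
  have 1: "homotopic ?k (leg \<phi> p P) (leg \<phi> p R \<otimes> leg \<chi> R P)"
    unfolding e[symmetric] by (intro homotopic_sym[OF leg_trans] in_boxD[OF box]) simp_all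
  have 2: "homotopic ?k (leg \<psi> P' p') (leg \<chi> P' R' \<otimes> leg \<psi> R' p')"
    unfolding e[symmetric] by (intro homotopic_sym[OF leg_trans] in_boxD[OF box]) simp_all
  have 3: "homotopic ?k (leg \<chi> R P \<otimes> leg \<chi> P P') (leg \<chi> R P')"
    by (intro leg_trans in_boxD[OF box]) simp_all
  have 4: "homotopic ?k (leg \<chi> R P' \<otimes> leg \<chi> P' R') (leg \<chi> R R')"
    by (intro leg_trans in_boxD[OF box]) simp_all
  have "homotopic (?k + ?k) (leg \<chi> R P \<otimes> leg \<chi> P P' \<otimes> leg \<chi> P' R') (leg \<chi> R R')"
    using homotopic_trans[OF homotopic_mult_right[OF 3] 4] by simp
  then have 5: "homotopic (?k + ?k)
      (leg \<phi> p R \<otimes> (leg \<chi> R P \<otimes> leg \<chi> P P' \<otimes> leg \<chi> P' R') \<otimes> leg \<psi> R' p')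
      (leg \<phi> p R \<otimes> leg \<chi> R R' \<otimes> leg \<psi> R' p')"
    by (intro homotopic_mult_left homotopic_mult_right) auto
  have "homotopic (?k + 0 + ?k) (leg \<phi> p P \<otimes> leg \<chi> P P' \<otimes> leg \<psi> P' p')
      (leg \<phi> p R \<otimes> leg \<chi> R P \<otimes> leg \<chi> P P' \<otimes> (leg \<chi> P' R' \<otimes> leg \<psi> R' p'))"
    by (intro homotopic_mult 1 2 homotopic_refl) simp
  also have "leg \<phi> p R \<otimes> leg \<chi> R P \<otimes> leg \<chi> P P' \<otimes> (leg \<chi> P' R' \<otimes> leg \<psi> R' p')
      = leg \<phi> p R \<otimes> (leg \<chi> R P \<otimes> leg \<chi> P P' \<otimes> leg \<chi> P' R') \<otimes> leg \<psi> R' p'"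
    by (simp add: m_assoc)
  finally have "homotopic (?k + 0 + ?k + (?k + ?k)) (leg \<phi> p P \<otimes> leg \<chi> P P' \<otimes> leg \<psi> P' p')
      (leg \<phi> p R \<otimes> leg \<chi> R R' \<otimes> leg \<psi> R' p')"
    using 5 by (rule homotopic_trans)
  then show ?thesis
    by (rule_tac homotopic_mono) (simp add: connection_def, linarith)
qed

text \<open>The side \<open>PP'\<close> of the triangle \<open>P, C, P'\<close> lies in the half plane where the first
  coordinate of a flat is forgotten, so all the flats in play may be given the same first coordinate.
  The sides \<open>PC\<close> and \<open>CP'\<close> lie in the half planes of the other two coordinates, and after
  filling the triangles they cancel in the free group.\<close>

lemma connection_triangle:
  assumes box: "in_box D {p, q, r, P, P', C}"
    and "same_leg \<chi>\<^sub>0\<^sub>1 \<xi>\<^sub>0\<^sub>1 P P'" "same_leg \<phi>\<^sub>1 \<xi>\<^sub>1\<^sub>1 P P'"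
    and "same_leg \<chi>\<^sub>1\<^sub>2 \<xi>\<^sub>1\<^sub>2 P P'" "same_leg \<chi>\<^sub>0\<^sub>2 \<xi>\<^sub>0\<^sub>2 P P'"
    and "same_leg \<xi>\<^sub>0\<^sub>1 \<xi>\<^sub>0\<^sub>2 P C" "same_leg \<xi>\<^sub>0\<^sub>1 \<xi>\<^sub>1\<^sub>1 C P'"
    and "same_leg \<xi>\<^sub>1\<^sub>1 \<xi>\<^sub>1\<^sub>2 P C" "same_leg \<xi>\<^sub>1\<^sub>2 \<xi>\<^sub>0\<^sub>2 C P'"
  shows "homotopic (6 * (K * D * D))
      (connection \<phi>\<^sub>0 \<chi>\<^sub>0\<^sub>1 \<phi>\<^sub>1 p P P' q \<otimes> connection \<phi>\<^sub>1 \<chi>\<^sub>1\<^sub>2 \<phi>\<^sub>2 q P P' r)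
      (connection \<phi>\<^sub>0 \<chi>\<^sub>0\<^sub>2 \<phi>\<^sub>2 p P P' r)"
proof -
  let ?k = "K * D * D"
  have e: "leg \<xi>\<^sub>0\<^sub>1 P C = leg \<xi>\<^sub>0\<^sub>2 P C" "leg \<xi>\<^sub>0\<^sub>1 C P' = leg \<xi>\<^sub>1\<^sub>1 C P'"
      "leg \<xi>\<^sub>1\<^sub>1 P C = leg \<xi>\<^sub>1\<^sub>2 P C" "leg \<xi>\<^sub>1\<^sub>2 C P' = leg \<xi>\<^sub>0\<^sub>2 C P'"
    using assms leg_same by auto
  have e': "leg \<chi>\<^sub>0\<^sub>1 P P' = leg \<xi>\<^sub>0\<^sub>1 P P'" "leg \<phi>\<^sub>1 P P' = leg \<xi>\<^sub>1\<^sub>1 P P'"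
      "leg \<chi>\<^sub>1\<^sub>2 P P' = leg \<xi>\<^sub>1\<^sub>2 P P'" "leg \<chi>\<^sub>0\<^sub>2 P P' = leg \<xi>\<^sub>0\<^sub>2 P P'"
    using assms leg_same by auto
  have cone: "homotopic ?k (leg \<psi> P P') (leg \<psi> P C \<otimes> leg \<psi> C P')" for \<psi>
    by (intro homotopic_sym[OF leg_trans] in_boxD[OF box]) simp_all
  \<comment> \<open>Agreement of the flats is given along the leg from \<open>P\<close> to
    \<open>P'\<close>. The leg back turns at the other corner, so it is first replaced by an
    inverse.\<close>
  have "homotopic ?k (leg \<phi>\<^sub>1 P' P) (inv (leg \<xi>\<^sub>1\<^sub>1 P P'))"
    unfolding e'(2)[symmetric] by (intro leg_back in_boxD[OF box]) simp_all
  moreover have "homotopic ?k (leg \<phi>\<^sub>1 P' q \<otimes> leg \<phi>\<^sub>1 q P) (leg \<phi>\<^sub>1 P' P)"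
    by (intro leg_trans in_boxD[OF box]) simp_all
  ultimately have "homotopic (?k + ?k) (leg \<phi>\<^sub>1 P' q \<otimes> leg \<phi>\<^sub>1 q P) (inv (leg \<xi>\<^sub>1\<^sub>1 P P'))"
    using homotopic_trans by blast
  from homotopic_trans[OF this homotopic_inv[OF cone]]
  have mid: "homotopic (?k + ?k + ?k) (leg \<phi>\<^sub>1 P' q \<otimes> leg \<phi>\<^sub>1 q P) (inv (leg \<xi>\<^sub>1\<^sub>1 P C \<otimes> leg \<xi>\<^sub>1\<^sub>1 C P'))" .
  have "homotopic (?k + (?k + ?k + ?k) + ?k)
      (leg \<chi>\<^sub>0\<^sub>1 P P' \<otimes> (leg \<phi>\<^sub>1 P' q \<otimes> leg \<phi>\<^sub>1 q P) \<otimes> leg \<chi>\<^sub>1\<^sub>2 P P')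
      (leg \<xi>\<^sub>0\<^sub>1 P C \<otimes> leg \<xi>\<^sub>0\<^sub>1 C P' \<otimes> inv (leg \<xi>\<^sub>1\<^sub>1 P C \<otimes> leg \<xi>\<^sub>1\<^sub>1 C P') \<otimes> (leg \<xi>\<^sub>1\<^sub>2 P C \<otimes> leg \<xi>\<^sub>1\<^sub>2 C P'))"
    unfolding e'(1,3) by (intro homotopic_mult cone mid)
  also have "leg \<xi>\<^sub>0\<^sub>1 P C \<otimes> leg \<xi>\<^sub>0\<^sub>1 C P' \<otimes> inv (leg \<xi>\<^sub>1\<^sub>1 P C \<otimes> leg \<xi>\<^sub>1\<^sub>1 C P') \<otimes> (leg \<xi>\<^sub>1\<^sub>2 P C \<otimes> leg \<xi>\<^sub>1\<^sub>2 C P')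
      = leg \<xi>\<^sub>0\<^sub>2 P C \<otimes> leg \<xi>\<^sub>0\<^sub>2 C P'"
    unfolding e by (simp add: inv_mult_group m_assoc)
  finally have "homotopic (?k + (?k + ?k + ?k) + ?k + ?k)
      (leg \<chi>\<^sub>0\<^sub>1 P P' \<otimes> (leg \<phi>\<^sub>1 P' q \<otimes> leg \<phi>\<^sub>1 q P) \<otimes> leg \<chi>\<^sub>1\<^sub>2 P P') (leg \<chi>\<^sub>0\<^sub>2 P P')"
    unfolding e'(4) using homotopic_sym[OF cone] by (rule homotopic_trans)
  then have "homotopic (?k + (?k + ?k + ?k) + ?k + ?k)
      (leg \<phi>\<^sub>0 p P \<otimes> (leg \<chi>\<^sub>0\<^sub>1 P P' \<otimes> (leg \<phi>\<^sub>1 P' q \<otimes> leg \<phi>\<^sub>1 q P) \<otimes> leg \<chi>\<^sub>1\<^sub>2 P P') \<otimes> leg \<phi>\<^sub>2 P' r)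
      (leg \<phi>\<^sub>0 p P \<otimes> leg \<chi>\<^sub>0\<^sub>2 P P' \<otimes> leg \<phi>\<^sub>2 P' r)"
    by (intro homotopic_mult_left homotopic_mult_right) auto
  then show ?thesis
    by (rule_tac homotopic_mono) (simp add: connection_def m_assoc, linarith)
qed

end

section \<open>Laurent expansions at three places\<close>

text \<open>A Laurent polynomial in \<open>t\<close> and \<open>u = 1 + t\<close> is represented by its expansions at \<open>t = \<infinity>\<close>
  (in powers of \<open>t\<close>), at \<open>t = 0\<close> (in powers of \<open>t\<close>) and at \<open>u = 0\<close> (in powers of \<open>u\<close>).\<close>

datatype place = Infty | Zero | MinusOne

type_synonym expansion = "place \<Rightarrow> int \<Rightarrow> int"

text \<open>The generalised binomial coefficient, unfolded because Isabelle reads the library constant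
  only over fields.\<close>

definition ibinomial :: "int \<Rightarrow> int \<Rightarrow> int" where
  "ibinomial a k = (if k < 0 then 0 else (\<Prod>i = 0..<nat k. a - int i) div fact (nat k))"

lemma ibinomial_neg [simp]: "k < 0 \<Longrightarrow> ibinomial a k = 0"
  by (simp add: ibinomial_def)

lemma ibinomial_0 [simp]: "ibinomial a 0 = 1"
  by (simp add: ibinomial_def)

lemma ibinomial_pascal: "ibinomial (a + 1) k = ibinomial a k + ibinomial a (k - 1)"
proof (cases "k \<le> 0")
  case False
  define m where "m = nat (k - 1)"
  have "nat k = Suc m" "nat (k - 1) = m" using False by (auto simp: m_def)
  moreover have "\<not> k < 0" "\<not> k - 1 < 0" using False by auto
  ultimately show ?thesis
    using gbinomial_int_Suc_Suc[of a m, unfolded gbinomial_prod_rev]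
    by (simp only: ibinomial_def if_False of_nat_id)
qed (cases "k = 0"; simp)

text \<open>The expansions of \<open>t\<^sup>i u\<^sup>j\<close>, where \<open>t = u - 1\<close> at the last place.\<close>

definition parity_sign :: "int \<Rightarrow> int" where
  "parity_sign m = (if even m then 1 else - 1)"

lemma parity_sign_simps: "parity_sign (m + 1) = - parity_sign m" "parity_sign (m - 1) = - parity_sign m"
  by (auto simp: parity_sign_def)

fun monomial :: "int \<Rightarrow> int \<Rightarrow> expansion" where
  "monomial i j Infty n = ibinomial j (i + j - n)"
| "monomial i j Zero n = ibinomial j (n - i)"
| "monomial i j MinusOne n = parity_sign (i + n - j) * ibinomial i (n - j)"

text \<open>The identity \<open>u = 1 + t\<close> multiplied by \<open>t^i u^j\<close>; at each
  place it becomes Pascal's rule. All later rewriting of monomials rests on it.\<close>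

lemma monomial_pascal: "monomial i (j + 1) = monomial i j + monomial (i + 1) j"
proof (intro ext)
  fix q n
  show "monomial i (j + 1) q n = (monomial i j + monomial (i + 1) j) q n"
  proof (cases q)
    case Infty
    then show ?thesis using ibinomial_pascal[of j "i + j + 1 - n"] by (simp add: algebra_simps)
  next
    case Zero
    then show ?thesis using ibinomial_pascal[of j "n - i"] by (simp add: algebra_simps)
  next
    case MinusOne
    have "i + n - (j + 1) = i + n - j - 1" "i + 1 + n - j = i + n - j + 1" "n - (j + 1) = n - j - 1"
      by auto
    then show ?thesis using ibinomial_pascal[of i "n - j"] MinusOne
      by (simp only: monomial.simps parity_sign_simps plus_fun_apply) (simp add: algebra_simps)
  qed
qed

declare monomial.simps [simp del]

lemma monomial_left: "monomial i j = monomial (i - 1) (j + 1) - monomial (i - 1) j"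
  using monomial_pascal[of "i - 1" j] by (simp add: algebra_simps)

lemma monomial_up: "monomial i j = monomial i (j + 1) - monomial (i + 1) j"
  using monomial_pascal[of i j] by (simp add: algebra_simps)

lemma monomial_down: "monomial i j = monomial i (j - 1) + monomial (i + 1) (j - 1)"
  using monomial_pascal[of i "j - 1"] by simp

text \<open>Coefficients stay integers, and reduction modulo \<open>p\<close> is left to the
  predicates \<open>triv\<close> and \<open>ball_*\<close>. Multiplication by \<open>t\<close> and
  \<open>u\<close> appears only as a shift of exponents.\<close>

definition laurent :: "expansion set" where
  "laurent = group_closure (range (\<lambda>(i, j). monomial i j))"

lemma zero_laurent [simp]: "0 \<in> laurent"
  by (simp add: laurent_def)

lemma monomial_laurent [simp]: "monomial i j \<in> laurent"
  unfolding laurent_def by (rule group_closure.base) (auto intro: range_eqI[of _ _ "(i, j)"])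

lemma diff_laurent [simp]: "f \<in> laurent \<Longrightarrow> g \<in> laurent \<Longrightarrow> f - g \<in> laurent"
  unfolding laurent_def by (rule group_closure.diff)

lemma add_laurent [simp]: "f \<in> laurent \<Longrightarrow> g \<in> laurent \<Longrightarrow> f + g \<in> laurent"
  unfolding laurent_def by (rule group_closure_add)

lemma laurent_induct [consumes 1, case_names zero monomial diff]:
  assumes "f \<in> laurent" "D 0" "\<And>i j. D (monomial i j)" "\<And>f g. D f \<Longrightarrow> D g \<Longrightarrow> D (f - g)"
  shows "D f"
  using assms(1) unfolding laurent_def
proof (induction rule: group_closure.induct)
  case (base f)
  then show ?case using assms(2,3) by auto
next
  case (diff f g)
  then show ?case using assms(4) by blast
qed

section \<open>Rewriting monomials across the exponent plane\<close>

context
  fixes D :: "expansion \<Rightarrow> bool" and i j :: int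
  assumes D_diff: "\<And>f g. D f \<Longrightarrow> D g \<Longrightarrow> D (f - g)" and D_zero: "D 0"
begin

lemma closed_under_add: "D f \<Longrightarrow> D g \<Longrightarrow> D (f + g)"
  using D_diff[of f "- g"] D_diff[of 0 g] D_zero by simp

text \<open>The lines \<open>k = i\<close>, \<open>l = j\<close> and \<open>k + l = i + j\<close>
  cut the plane of exponents. \<open>low\<close> is the half plane of one line, and
  \<open>high\<close> is a sector of the other side bounded by the other two lines. In the remaining
  regions a form of the Pascal identity lowers the sum of the three truncated distances. The next
  two lemmas permute the roles of the lines.\<close>

lemma monomial_cases_Infty:
  assumes low: "\<And>k l. k + l < i + j \<Longrightarrow> D (monomial k l)"
    and high: "\<And>k l. i \<le> k \<Longrightarrow> j \<le> l \<Longrightarrow> D (monomial k l)"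
  shows "D (monomial k l)"
proof (induction "nat (k + l - i - j + 1) + nat (j - l) + nat (i - k)" arbitrary: k l rule: less_induct)
  case less
  consider "k + l < i + j" | "i \<le> k" "j \<le> l" | "i + j \<le> k + l" "l < j" | "i + j \<le> k + l" "k < i"
    by linarith
  then show ?case
  proof cases
    case 3
    then have "D (monomial (k - 1) (l + 1))" "D (monomial (k - 1) l)" by (auto intro!: less)
    then show ?thesis by (subst monomial_left) (rule D_diff)
  next
    case 4
    then have "D (monomial k (l - 1))" "D (monomial (k + 1) (l - 1))" by (auto intro!: less)
    then show ?thesis by (subst monomial_down) (rule closed_under_add)
  qed (simp_all add: low high)
qed

lemma monomial_cases_Zero:
  assumes low: "\<And>k l. i \<le> k \<Longrightarrow> D (monomial k l)"
    and high: "\<And>k l. j \<le> l \<Longrightarrow> k + l < i + j \<Longrightarrow> D (monomial k l)"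
  shows "D (monomial k l)"
proof (induction "nat (k + l - i - j + 1) + nat (j - l) + nat (i - k)" arbitrary: k l rule: less_induct)
  case less
  consider "i \<le> k" | "j \<le> l" "k + l < i + j" | "k < i" "l < j" | "k < i" "i + j \<le> k + l"
    by linarith
  then show ?case
  proof cases
    case 3
    then have "D (monomial k (l + 1))" "D (monomial (k + 1) l)" by (auto intro!: less)
    then show ?thesis by (subst monomial_up) (rule D_diff)
  next
    case 4
    then have "D (monomial k (l - 1))" "D (monomial (k + 1) (l - 1))" by (auto intro!: less)
    then show ?thesis by (subst monomial_down) (rule closed_under_add)
  qed (simp_all add: low high)
qed

lemma monomial_cases_MinusOne:
  assumes low: "\<And>k l. j \<le> l \<Longrightarrow> D (monomial k l)"
    and high: "\<And>k l. i \<le> k \<Longrightarrow> k + l < i + j \<Longrightarrow> D (monomial k l)"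
  shows "D (monomial k l)"
proof (induction "nat (k + l - i - j + 1) + nat (j - l) + nat (i - k)" arbitrary: k l rule: less_induct)
  case less
  consider "j \<le> l" | "i \<le> k" "k + l < i + j" | "l < j" "k < i" | "l < j" "i + j \<le> k + l"
    by linarith
  then show ?case
  proof cases
    case 3
    then have "D (monomial k (l + 1))" "D (monomial (k + 1) l)" by (auto intro!: less)
    then show ?thesis by (subst monomial_up) (rule D_diff)
  next
    case 4
    then have "D (monomial (k - 1) (l + 1))" "D (monomial (k - 1) l)" by (auto intro!: less)
    then show ?thesis by (subst monomial_left) (rule D_diff)
  qed (simp_all add: low high)
qed

end

section \<open>Congruence modulo p and balls at the three places\<close>

definition scale :: "int \<Rightarrow> expansion \<Rightarrow> expansion" where
  "scale c f = (\<lambda>q n. c * f q n)"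

lemma scale_apply [simp]: "scale c f q n = c * f q n"
  by (simp add: scale_def)

definition triv :: "int \<Rightarrow> expansion \<Rightarrow> bool" where
  "triv p f \<longleftrightarrow> (\<forall>q n. p dvd f q n)"

text \<open>Balls around 0 in the three completions. At infinity the ball bounds the degree from
  above, so it grows with \<open>m\<close>; at the other places it bounds the order from below and
  shrinks.\<close>

definition ball_Infty :: "int \<Rightarrow> int \<Rightarrow> expansion \<Rightarrow> bool" where
  "ball_Infty p m f \<longleftrightarrow> (\<forall>n\<ge>m. p dvd f Infty n)"

definition ball_Zero :: "int \<Rightarrow> int \<Rightarrow> expansion \<Rightarrow> bool" where
  "ball_Zero p m f \<longleftrightarrow> (\<forall>n<m. p dvd f Zero n)"

definition ball_MinusOne :: "int \<Rightarrow> int \<Rightarrow> expansion \<Rightarrow> bool" where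
  "ball_MinusOne p m f \<longleftrightarrow> (\<forall>n<m. p dvd f MinusOne n)"

lemmas ball_defs = ball_Infty_def ball_Zero_def ball_MinusOne_def

lemma ball_zero [simp]: "ball_Infty p m 0" "ball_Zero p m 0" "ball_MinusOne p m 0"
  by (simp_all add: ball_defs)

lemma ball_diff:
  "ball_Infty p m f \<Longrightarrow> ball_Infty p m g \<Longrightarrow> ball_Infty p m (f - g)"
  "ball_Zero p m f \<Longrightarrow> ball_Zero p m g \<Longrightarrow> ball_Zero p m (f - g)"
  "ball_MinusOne p m f \<Longrightarrow> ball_MinusOne p m g \<Longrightarrow> ball_MinusOne p m (f - g)"
  by (simp_all add: ball_defs)

lemma ball_monomial:
  "k + l < m \<Longrightarrow> ball_Infty p m (monomial k l)"
  "m \<le> k \<Longrightarrow> ball_Zero p m (monomial k l)"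
  "m \<le> l \<Longrightarrow> ball_MinusOne p m (monomial k l)"
  by (auto simp: ball_defs monomial.simps)

text \<open>\<open>near p i j f g h\<close>: the three functions vanish modulo \<open>p\<close> to the orders that are relevant at
  the grid point \<open>(i, j)\<close>, each at its own place.\<close>

definition near :: "int \<Rightarrow> int \<Rightarrow> int \<Rightarrow> expansion \<Rightarrow> expansion \<Rightarrow> expansion \<Rightarrow> bool" where
  "near p i j f g h \<longleftrightarrow> ball_Infty p (i + j) f \<and> ball_Zero p i g \<and> ball_MinusOne p j h"

lemma near_diff: "near p i j f g h \<Longrightarrow> near p i j f' g' h' \<Longrightarrow> near p i j (f - f') (g - g') (h - h')"
  by (simp add: near_def ball_diff)

lemma near_zero [simp]: "near p i j 0 0 0"
  by (auto simp: near_def)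

text \<open>For each of the three functions one finds an approximation at its own place that is
  negligible at the other two; the sum of the three works. For a monomial in the two basic regions
  the approximation is 0 or the monomial itself, and the rewriting lemmas reach all others.\<close>

lemma near_exists:
  assumes f: "f \<in> laurent" and g: "g \<in> laurent" and h: "h \<in> laurent"
  shows "\<exists>c\<in>laurent. near p i j (f - c) (g - c) (h - c)"
proof -
  define A where "A f \<longleftrightarrow> (\<exists>c\<in>laurent. near p i j (f - c) c c)" for f
  define B where "B g \<longleftrightarrow> (\<exists>c\<in>laurent. near p i j c (g - c) c)" for g
  define C where "C h \<longleftrightarrow> (\<exists>c\<in>laurent. near p i j c c (h - c))" for h
  have d: "f - g - (c - d) = (f - c) - (g - d)" for f g c d :: expansion by simp
  have A_diff: "A (f - g)" if "A f" "A g" for f g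
    using that near_diff[of p i j] diff_laurent unfolding A_def by (metis d)
  have A_mono: "A (monomial k l)" if "k + l < i + j \<or> i \<le> k \<and> j \<le> l" for k l
    using that unfolding A_def near_def
    by (cases "k + l < i + j") (force simp: ball_monomial intro: bexI[of _ 0] bexI[of _ "monomial k l"])+
  have A_zero: "A 0" unfolding A_def by (rule bexI[of _ 0]) auto
  have A_monomial: "A (monomial k l)" for k l
    by (rule monomial_cases_Infty[of A i j]) (use A_diff A_zero A_mono in blast)+
  have "A f" using f A_zero A_monomial A_diff by (rule laurent_induct)
  have B_diff: "B (f - g)" if "B f" "B g" for f g
    using that near_diff[of p i j] diff_laurent unfolding B_def by (metis d)
  have B_mono: "B (monomial k l)" if "i \<le> k \<or> j \<le> l \<and> k + l < i + j" for k l
    using that unfolding B_def near_def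
    by (cases "i \<le> k") (force simp: ball_monomial intro: bexI[of _ 0] bexI[of _ "monomial k l"])+
  have B_zero: "B 0" unfolding B_def by (rule bexI[of _ 0]) auto
  have B_monomial: "B (monomial k l)" for k l
    by (rule monomial_cases_Zero[of B i j]) (use B_diff B_zero B_mono in blast)+
  have "B g" using g B_zero B_monomial B_diff by (rule laurent_induct)
  have C_diff: "C (f - g)" if "C f" "C g" for f g
    using that near_diff[of p i j] diff_laurent unfolding C_def by (metis d)
  have C_mono: "C (monomial k l)" if "j \<le> l \<or> i \<le> k \<and> k + l < i + j" for k l
    using that unfolding C_def near_def
    by (cases "j \<le> l") (force simp: ball_monomial intro: bexI[of _ 0] bexI[of _ "monomial k l"])+
  have C_zero: "C 0" unfolding C_def by (rule bexI[of _ 0]) auto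
  have C_monomial: "C (monomial k l)" for k l
    by (rule monomial_cases_MinusOne[of C j i]) (use C_diff C_zero C_mono in blast)+
  have "C h" using h C_zero C_monomial C_diff by (rule laurent_induct)
  from \<open>A f\<close> \<open>B g\<close> \<open>C h\<close> obtain a b c where abc: "a \<in> laurent" "near p i j (f - a) a a"
    "b \<in> laurent" "near p i j b (g - b) b" "c \<in> laurent" "near p i j c c (h - c)"
    unfolding A_def B_def C_def by blast
  have e: "f - (a + b + c) = f - a - b - c" "g - (a + b + c) = g - b - a - c"
    "h - (a + b + c) = h - c - a - b" by (simp_all add: fun_eq_iff)
  have "near p i j (f - (a + b + c)) (g - (a + b + c)) (h - (a + b + c))"
    using abc unfolding e near_def by (simp add: ball_diff)
  then show ?thesis using \<open>a \<in> laurent\<close> \<open>b \<in> laurent\<close> \<open>c \<in> laurent\<close>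
    by (intro bexI[of _ "a + b + c"] add_laurent)
qed

lemma group_closure_mono: "f \<in> group_closure A \<Longrightarrow> A \<subseteq> B \<Longrightarrow> f \<in> group_closure B"
  by (induction rule: group_closure.induct) (auto intro: group_closure.intros)

lemma group_closure_invariant:
  assumes "f \<in> group_closure A" "P 0" "\<And>f. f \<in> A \<Longrightarrow> P f" "\<And>f g. P f \<Longrightarrow> P g \<Longrightarrow> P (f - g)"
  shows "P f"
  using assms(1)
proof (induction rule: group_closure.induct)
  case (base f)
  then show ?case using assms(2,3) by blast
next
  case (diff f g)
  then show ?case using assms(4) by blast
qed

lemma group_closure_insertD:
  fixes b :: expansion
  assumes "f \<in> group_closure (insert b A)"
  shows "\<exists>c. f - scale c b \<in> group_closure A"
  using assms
proof (rule group_closure_invariant)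
  fix f assume "f \<in> insert b A"
  then show "\<exists>c. f - scale c b \<in> group_closure A"
  proof
    assume "f = b"
    then have "f - scale 1 b = 0" by (auto simp: fun_eq_iff)
    then show ?thesis by (metis zero_in_group_closure)
  next
    assume "f \<in> A"
    moreover have "f - scale 0 b = f" by (auto simp: fun_eq_iff)
    ultimately show ?thesis by (metis group_closure.base insertI2)
  qed
next
  have "0 - scale 0 b = 0" by (auto simp: fun_eq_iff)
  then show "\<exists>c. 0 - scale c b \<in> group_closure A" by (metis zero_in_group_closure)
next
  fix f g assume "\<exists>c. f - scale c b \<in> group_closure A" "\<exists>c. g - scale c b \<in> group_closure A"
  then obtain c d where "f - scale c b \<in> group_closure A" "g - scale d b \<in> group_closure A" by blast
  then have "(f - scale c b) - (g - scale d b) \<in> group_closure A" by (rule group_closure.diff)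
  moreover have "(f - scale c b) - (g - scale d b) = f - g - scale (c - d) b"
    by (auto simp: fun_eq_iff algebra_simps)
  ultimately show "\<exists>c. f - g - scale c b \<in> group_closure A" by metis
qed

text \<open>The coefficient at \<open>m n\<close> sees \<open>b n\<close> with a unit and none of
  the generators before it. So the generators are peeled off from the last one downwards, each with
  a multiplier divisible by \<open>p\<close>.\<close>

lemma triangular_triv:
  fixes b :: "nat \<Rightarrow> expansion"
  assumes f: "f \<in> group_closure (range b)"
    and diag: "\<And>n. \<bar>b n q (m n)\<bar> = 1" and above: "\<And>k n. k < n \<Longrightarrow> b k q (m n) = 0"
    and "\<And>n. p dvd f q (m n)"
  shows "triv p f"
proof -
  have "\<exists>N. f \<in> group_closure (b ` {..<N})" using f
  proof (rule group_closure_invariant)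
    fix f assume "f \<in> range b"
    then obtain n where "f = b n" by auto
    then have "f \<in> group_closure (b ` {..<Suc n})" by (intro group_closure.base) auto
    then show "\<exists>N. f \<in> group_closure (b ` {..<N})" by blast
  next
    fix f g assume "\<exists>N. f \<in> group_closure (b ` {..<N})" "\<exists>N. g \<in> group_closure (b ` {..<N})"
    then obtain M N where "f \<in> group_closure (b ` {..<M})" "g \<in> group_closure (b ` {..<N})" by blast
    then have "f - g \<in> group_closure (b ` {..<max M N})"
      by (intro group_closure.diff; elim group_closure_mono) (auto intro!: image_mono)
    then show "\<exists>N. f - g \<in> group_closure (b ` {..<N})" by blast
  qed (metis zero_in_group_closure)
  then obtain N where "f \<in> group_closure (b ` {..<N})" by blast
  then show ?thesis using assms(4)
  proof (induction N arbitrary: f)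
    case 0
    then show ?case by (simp add: triv_def)
  next
    case (Suc N)
    then obtain c where c: "f - scale c (b N) \<in> group_closure (b ` {..<N})"
      using group_closure_insertD[of f "b N" "b ` {..<N}"] by (auto simp: lessThan_Suc)
    from c have "(f - scale c (b N)) q (m N) = 0"
      by (rule group_closure_invariant) (auto simp: above)
    then have "f q (m N) = c * b N q (m N)" by simp
    then have "p dvd c" using Suc.prems(2)[of N] diag[of N]
      by (auto simp: abs_if split: if_splits)
    then have "triv p (scale c (b N))" by (simp add: triv_def)
    moreover from this have "triv p (f - scale c (b N))"
      using Suc.IH[OF c] Suc.prems(2) by (simp add: triv_def)
    ultimately show ?case unfolding triv_def by (metis (no_types) diff_add_cancel dvd_add plus_fun_apply)
  qed
qed

text \<open>Modulo \<open>p\<close> no nonzero element is small at all three places at once. In a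
  partial fraction decomposition at \<open>(i, j)\<close> each place sees only one of the three
  parts outside its ball, and there that part has a triangular basis.\<close>

lemma near_unique:
  assumes f: "f \<in> laurent" and near: "near p i j f f f"
  shows "triv p f"
proof -
  \<comment> \<open>\<open>a\<close> spans the polynomial multiples of \<open>t^i u^j\<close>,
    \<open>b\<close> the part with order below \<open>i\<close> at \<open>t = 0\<close>,
    \<open>c\<close> the part with order below \<open>j\<close> at \<open>u = 0\<close>.\<close>
  define a where "a n = monomial (i + int n) j" for n
  define b where "b n = monomial (i - 1 - int n) j" for n
  define c where "c n = monomial i (j - 1 - int n)" for n
  define D where "D f \<longleftrightarrow> (\<exists>g\<in>group_closure (range a). \<exists>h\<in>group_closure (range b).
      \<exists>k\<in>group_closure (range c). f = g + h + k)" for f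
  have D0: "D 0" unfolding D_def by (auto intro!: bexI[of _ 0])
  have Dd: "D (f - f')" if D: "D f" "D f'" for f f'
  proof -
    obtain g h k where "g \<in> group_closure (range a)" "h \<in> group_closure (range b)"
      "k \<in> group_closure (range c)" "f = g + h + k" using D(1) unfolding D_def by blast
    moreover obtain g' h' k' where "g' \<in> group_closure (range a)" "h' \<in> group_closure (range b)"
      "k' \<in> group_closure (range c)" "f' = g' + h' + k'" using D(2) unfolding D_def by blast
    moreover have "g + h + k - (g' + h' + k') = (g - g') + (h - h') + (k - k')"
      by (simp add: algebra_simps)
    ultimately show ?thesis unfolding D_def
      by (intro bexI[of _ "g - g'"] bexI[of _ "h - h'"] bexI[of _ "k - k'"])
         (simp_all add: group_closure.diff)
  qed
  have Da: "D (a n)" for n unfolding D_def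
    by (intro bexI[of _ "a n"] bexI[of _ 0]) (auto intro: group_closure.base)
  have Db: "D (b n)" for n unfolding D_def
    by (rule bexI[of _ 0], rule bexI[of _ "b n"], rule bexI[of _ 0]) (auto intro: group_closure.base)
  have Dc: "D (c n)" for n unfolding D_def
    by (rule bexI[of _ 0], rule bexI[of _ 0], rule bexI[of _ "c n"]) (auto intro: group_closure.base)
  \<comment> \<open>\<open>row\<close> and \<open>col\<close> are the two regions that
    \<open>monomial_cases_MinusOne\<close> asks for.\<close>
  have row: "D (monomial k (j + int n))" for k n
  proof (induction n arbitrary: k)
    case 0
    show ?case
    proof (cases "i \<le> k")
      case True
      then show ?thesis using Da[of "nat (k - i)"] by (simp add: a_def)
    next
      case False
      then show ?thesis using Db[of "nat (i - 1 - k)"] by (simp add: b_def)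
    qed
  next
    case (Suc n)
    have e: "j + int (Suc n) = j + int n + 1" by simp
    show ?case unfolding e monomial_pascal by (rule closed_under_add[of D, OF Dd D0 Suc Suc])
  qed
  have col: "D (monomial (i + int n) l)" if "i + int n + l < i + j" for n l
    using that
  proof (induction n arbitrary: l)
    case 0
    then show ?case using Dc[of "nat (j - 1 - l)"] by (simp add: c_def)
  next
    case (Suc n)
    have "D (monomial (i + int n) (l + 1) - monomial (i + int n) l)"
      using Suc.prems by (intro Dd Suc.IH) auto
    moreover have "i + int (Suc n) - 1 = i + int n" by simp
    ultimately show ?case unfolding monomial_left[of "i + int (Suc n)" l] by metis
  qed
  have D_mono: "D (monomial k l)" for k l
  proof (rule monomial_cases_MinusOne[of D j i])
    show "D (monomial k l)" if "j \<le> l" for k l using row[of k "nat (l - j)"] that by simp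
    show "D (monomial k l)" if "i \<le> k" "k + l < i + j" for k l
      using col[of "nat (k - i)" l] that by simp
  qed (use Dd D0 in blast)+
  have "D f" using f D0 D_mono Dd by (rule laurent_induct)
  then obtain g h k where g: "g \<in> group_closure (range a)" and h: "h \<in> group_closure (range b)"
    and k: "k \<in> group_closure (range c)" and fghk: "f = g + h + k" unfolding D_def by blast
  have g_Zero: "g Zero n = 0" if "n < i" for n
    using g by (rule group_closure_invariant) (use that in \<open>auto simp: a_def monomial.simps\<close>)
  have g_MinusOne: "g MinusOne n = 0" if "n < j" for n
    using g by (rule group_closure_invariant) (use that in \<open>auto simp: a_def monomial.simps\<close>)
  have h_Infty: "h Infty n = 0" if "i + j \<le> n" for n
    using h by (rule group_closure_invariant) (use that in \<open>auto simp: b_def monomial.simps\<close>)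
  have h_MinusOne: "h MinusOne n = 0" if "n < j" for n
    using h by (rule group_closure_invariant) (use that in \<open>auto simp: b_def monomial.simps\<close>)
  have k_Infty: "k Infty n = 0" if "i + j \<le> n" for n
    using k by (rule group_closure_invariant) (use that in \<open>auto simp: c_def monomial.simps\<close>)
  have k_Zero: "k Zero n = 0" if "n < i" for n
    using k by (rule group_closure_invariant) (use that in \<open>auto simp: c_def monomial.simps\<close>)
  have p: "p dvd g Infty n" if "i + j \<le> n" for n
    using near that h_Infty[OF that] k_Infty[OF that] by (auto simp: near_def ball_defs fghk)
  have q: "p dvd h Zero n" if "n < i" for n
    using near that g_Zero[OF that] k_Zero[OF that] by (auto simp: near_def ball_defs fghk)
  have r: "p dvd k MinusOne n" if "n < j" for n
    using near that g_MinusOne[OF that] h_MinusOne[OF that] by (auto simp: near_def ball_defs fghk)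
  have "triv p g" using g
    by (rule triangular_triv[where q = Infty and m = "\<lambda>n. i + j + int n"]) (auto simp: a_def monomial.simps parity_sign_def intro: p)
  moreover have "triv p h" using h
    by (rule triangular_triv[where q = Zero and m = "\<lambda>n. i - 1 - int n"]) (auto simp: b_def monomial.simps parity_sign_def intro: q)
  moreover have "triv p k" using k
    by (rule triangular_triv[where q = MinusOne and m = "\<lambda>n. j - 1 - int n"]) (auto simp: c_def monomial.simps parity_sign_def intro: r)
  ultimately show ?thesis unfolding triv_def fghk by auto
qed

lemma scale_laurent: "f \<in> laurent \<Longrightarrow> scale c f \<in> laurent"
proof -
  assume f: "f \<in> laurent"
  have n: "scale (int n) f \<in> laurent" for n
  proof (induction n)
    case 0
    have "scale (int 0) f = 0" by (auto simp: fun_eq_iff)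
    then show ?case by (simp only: zero_laurent)
  next
    case (Suc n)
    have "scale (int (Suc n)) f = scale (int n) f + f" by (auto simp: fun_eq_iff algebra_simps)
    then show ?case using Suc f by (simp only: add_laurent)
  qed
  show ?thesis
  proof (cases "0 \<le> c")
    case True
    then show ?thesis using n[of "nat c"] by simp
  next
    case False
    then have "scale c f = 0 - scale (int (nat (- c))) f" by (auto simp: fun_eq_iff)
    then show ?thesis using n by (simp only: diff_laurent zero_laurent)
  qed
qed

text \<open>Only the leading coefficient at infinity stands in the way of
  \<open>near_unique\<close>. The monomial has leading coefficient 1 there and lies in the balls at
  the other two places, so a multiple of it removes the obstruction. Hence an edge of a flat needs
  only a power of \<open>a\<close> and one more letter.\<close>

lemma near_edge:
  assumes f: "f \<in> laurent"
    and "ball_Infty p (i + j + 1) f" "ball_Zero p i f" "ball_MinusOne p j f"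
  shows "triv p (f - scale (f Infty (i + j)) (monomial i j))"
proof (rule near_unique)
  show "near p i j (f - scale (f Infty (i + j)) (monomial i j))
      (f - scale (f Infty (i + j)) (monomial i j)) (f - scale (f Infty (i + j)) (monomial i j))"
    unfolding near_def ball_defs
  proof (intro conjI allI impI)
    fix n assume n: "i + j \<le> n"
    show "p dvd (f - scale (f Infty (i + j)) (monomial i j)) Infty n"
      using assms(2) n unfolding ball_defs by (cases "n = i + j") (auto simp: monomial.simps)
  qed (use assms in \<open>auto simp: ball_defs monomial.simps\<close>)
qed (use f in \<open>simp add: scale_laurent\<close>)

section \<open>The kernel of Baumslag's presentation\<close>

context group
begin

lemma commute_int_pow:
  assumes "x \<in> carrier G" "y \<in> carrier G" "x \<otimes> y = y \<otimes> x"
  shows "x [^] (k::int) \<otimes> y = y \<otimes> x [^] k"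
proof (induction k rule: int_induct[of _ 0])
  case base
  then show ?case using assms by simp
next
  case (step1 k)
  have "x [^] (k + 1) \<otimes> y = x [^] k \<otimes> (x \<otimes> y)" using assms by (simp add: int_pow_mult m_assoc)
  also have "\<dots> = (x [^] k \<otimes> y) \<otimes> x" using assms by (simp add: m_assoc)
  also have "\<dots> = y \<otimes> x [^] (k + 1)" unfolding step1 using assms by (simp add: int_pow_mult m_assoc)
  finally show ?case .
next
  case (step2 k)
  have i: "inv x \<otimes> y = y \<otimes> inv x"
    using assms by (metis inv_closed inv_solve_left inv_solve_right m_assoc m_closed)
  have p: "x [^] (k - 1) = x [^] k \<otimes> inv x" using assms int_pow_mult[of x k "- 1"] by (simp add: int_pow_neg)
  have "x [^] (k - 1) \<otimes> y = (x [^] k \<otimes> y) \<otimes> inv x" using assms by (simp add: p m_assoc i)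
  also have "\<dots> = y \<otimes> x [^] (k - 1)" unfolding step2 p using assms by (simp add: m_assoc)
  finally show ?case .
qed

lemma conj_commute:
  assumes "x \<in> carrier G" "y \<in> carrier G" "d \<in> carrier G" "x \<otimes> y = y \<otimes> x"
  shows "(inv d \<otimes> x \<otimes> d) \<otimes> (inv d \<otimes> y \<otimes> d) = (inv d \<otimes> y \<otimes> d) \<otimes> (inv d \<otimes> x \<otimes> d)"
proof -
  have "(inv d \<otimes> x \<otimes> d) \<otimes> (inv d \<otimes> y \<otimes> d) = inv d \<otimes> (x \<otimes> y) \<otimes> d"
    using assms(1-3) by (simp add: m_assoc)
  also have "\<dots> = (inv d \<otimes> y \<otimes> d) \<otimes> (inv d \<otimes> x \<otimes> d)"
    unfolding assms(4) using assms(1-3) by (simp add: m_assoc)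
  finally show ?thesis .
qed

end

locale baumslag_relations = group G for G (structure) +
  fixes a s t :: 'a and p :: nat
  assumes closed [simp]: "a \<in> carrier G" "s \<in> carrier G" "t \<in> carrier G"
    and a_pow: "a [^] p = \<one>"
    and s_t: "s \<otimes> t = t \<otimes> s"
    and a_t: "(inv t \<otimes> a \<otimes> t) \<otimes> a = a \<otimes> (inv t \<otimes> a \<otimes> t)"
    and a_s: "inv s \<otimes> a \<otimes> s = (inv t \<otimes> a \<otimes> t) \<otimes> a"
begin

definition trans :: "int \<Rightarrow> int \<Rightarrow> 'a" where
  "trans k l = t [^] k \<otimes> s [^] l"

text \<open>The group counterpart of \<open>monomial k l\<close>.\<close>

definition conjugate :: "int \<Rightarrow> int \<Rightarrow> 'a" where
  "conjugate k l = inv (trans k l) \<otimes> a \<otimes> trans k l"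

lemma trans_closed [simp]: "trans k l \<in> carrier G"
  by (simp add: trans_def)

lemma conjugate_closed [simp]: "conjugate k l \<in> carrier G"
  by (simp add: conjugate_def)

lemma trans_add: "trans k l \<otimes> trans k' l' = trans (k + k') (l + l')"
proof -
  have "s [^] l \<otimes> t = t \<otimes> s [^] l" by (rule commute_int_pow) (simp_all add: s_t)
  then have "t [^] k' \<otimes> s [^] l = s [^] l \<otimes> t [^] k'" by (intro commute_int_pow) simp_all
  then have "t [^] k \<otimes> (s [^] l \<otimes> t [^] k') \<otimes> s [^] l' = t [^] k \<otimes> (t [^] k' \<otimes> s [^] l) \<otimes> s [^] l'"
    by simp
  then show ?thesis by (simp add: trans_def int_pow_mult m_assoc)
qed

lemma trans_0: "trans 0 0 = \<one>"
  by (simp add: trans_def)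

lemma trans_simps: "trans 1 0 = t" "trans 0 1 = s"
  by (simp_all add: trans_def)

lemma conjugate_0: "conjugate 0 0 = a"
  by (simp add: conjugate_def trans_0)

lemma conjugate_conj: "inv (trans i j) \<otimes> conjugate k l \<otimes> trans i j = conjugate (k + i) (l + j)"
  unfolding conjugate_def trans_add[symmetric] by (simp add: inv_mult_group m_assoc)

lemma conjugate_pascal: "conjugate k (l + 1) = conjugate (k + 1) l \<otimes> conjugate k l"
proof -
  have "conjugate 0 1 = conjugate 1 0 \<otimes> conjugate 0 0"
    using a_s by (simp add: conjugate_def trans_simps trans_0)
  then have "inv (trans k l) \<otimes> conjugate 0 1 \<otimes> trans k l
      = (inv (trans k l) \<otimes> conjugate 1 0 \<otimes> trans k l) \<otimes> (inv (trans k l) \<otimes> conjugate 0 0 \<otimes> trans k l)"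
    by (simp add: m_assoc)
  then show ?thesis unfolding conjugate_conj by (simp add: add.commute)
qed

lemma conjugate_shift_commute:
  assumes "conjugate k l \<otimes> conjugate k' l' = conjugate k' l' \<otimes> conjugate k l"
  shows "conjugate (k + i) (l + j) \<otimes> conjugate (k' + i) (l' + j)
    = conjugate (k' + i) (l' + j) \<otimes> conjugate (k + i) (l + j)"
  using conj_commute[OF _ _ trans_closed[of i j] assms] unfolding conjugate_conj by simp

text \<open>Conjugating a commutation by \<open>s\<close> and expanding with \<open>conjugate_pascal\<close> produces exactly
  one new commutation.\<close>

lemma conjugate_commute_row_0: "conjugate (int n) 0 \<otimes> conjugate 0 0 = conjugate 0 0 \<otimes> conjugate (int n) 0"
proof (induction n rule: less_induct)
  case (less n)
  consider "n = 0" | "n = 1" | m where "n = Suc m" "m \<ge> 1"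
    by (metis One_nat_def Suc_leI not0_implies_Suc not_gr_zero)
  then show ?case
  proof cases
    case 1
    then show ?thesis by simp
  next
    case 2
    have "conjugate 1 0 = inv t \<otimes> a \<otimes> t" by (simp add: conjugate_def trans_simps)
    then show ?thesis using 2 a_t by (simp add: conjugate_0)
  next
    case 3
    let ?c = "\<lambda>k. conjugate k 0"
    have n: "int n = int m + 1" using 3 by simp
    have m0: "?c (int m) \<otimes> ?c 0 = ?c 0 \<otimes> ?c (int m)" using less 3 by simp
    have m1: "?c (int m) \<otimes> ?c 1 = ?c 1 \<otimes> ?c (int m)"
      using less[of "m - 1"] conjugate_shift_commute[of "int (m - 1)" 0 0 0 1 0] 3 by (simp add: of_nat_diff)
    have n1: "?c (int n) \<otimes> ?c 1 = ?c 1 \<otimes> ?c (int n)"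
      using conjugate_shift_commute[OF m0, of 1 0] by (simp add: n)
    have mn: "conjugate (int m) 1 = ?c (int n) \<otimes> ?c (int m)" "conjugate 0 1 = ?c 1 \<otimes> ?c 0"
      using conjugate_pascal[of "int m" 0] conjugate_pascal[of 0 0] n by simp_all
    have "conjugate (int m) 1 \<otimes> conjugate 0 1 = conjugate 0 1 \<otimes> conjugate (int m) 1"
      using conjugate_shift_commute[OF m0, of 0 1] by simp
    then have eq: "(?c (int n) \<otimes> ?c (int m)) \<otimes> (?c 1 \<otimes> ?c 0) = (?c 1 \<otimes> ?c 0) \<otimes> (?c (int n) \<otimes> ?c (int m))"
      unfolding mn .
    have "(?c (int n) \<otimes> ?c (int m)) \<otimes> (?c 1 \<otimes> ?c 0) = ?c (int n) \<otimes> (?c (int m) \<otimes> ?c 1) \<otimes> ?c 0"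
      by (simp add: m_assoc)
    also have "\<dots> = (?c (int n) \<otimes> ?c 1) \<otimes> (?c (int m) \<otimes> ?c 0)" unfolding m1 by (simp add: m_assoc)
    also have "\<dots> = ?c 1 \<otimes> ((?c (int n) \<otimes> ?c 0) \<otimes> ?c (int m))" unfolding n1 m0 by (simp add: m_assoc)
    finally have "?c 1 \<otimes> ((?c (int n) \<otimes> ?c 0) \<otimes> ?c (int m)) = ?c 1 \<otimes> ((?c 0 \<otimes> ?c (int n)) \<otimes> ?c (int m))"
      using eq by (simp add: m_assoc)
    then show ?thesis by simp
  qed
qed

text \<open>Within a row this is the previous lemma conjugated; for different rows the upper
  conjugate is expanded downwards by \<open>conjugate_pascal\<close>.\<close>

lemma conjugate_commute: "conjugate k l \<otimes> conjugate k' l' = conjugate k' l' \<otimes> conjugate k l"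
proof -
  have row: "conjugate k l \<otimes> conjugate k' l = conjugate k' l \<otimes> conjugate k l" if "k' \<le> k" for k k' l
    using conjugate_shift_commute[OF conjugate_commute_row_0[of "nat (k - k')"], of k' l] that by simp
  have row: "conjugate k l \<otimes> conjugate k' l = conjugate k' l \<otimes> conjugate k l" for k k' l
    using row[of k' k l] row[of k k' l] by (cases "k' \<le> k") auto
  have up: "conjugate k (l + int n) \<otimes> conjugate k' l = conjugate k' l \<otimes> conjugate k (l + int n)" for k k' l n
  proof (induction n arbitrary: k)
    case 0
    then show ?case using row by simp
  next
    case (Suc n)
    let ?x = "conjugate (k + 1) (l + int n)" and ?y = "conjugate k (l + int n)" and ?z = "conjugate k' l"
    have e: "conjugate k (l + int (Suc n)) = ?x \<otimes> ?y" using conjugate_pascal[of k "l + int n"] by (simp add: ac_simps)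
    have "(?x \<otimes> ?y) \<otimes> ?z = ?x \<otimes> (?y \<otimes> ?z)" by (simp add: m_assoc)
    also have "\<dots> = (?x \<otimes> ?z) \<otimes> ?y" unfolding Suc[of k] by (simp add: m_assoc)
    also have "\<dots> = ?z \<otimes> (?x \<otimes> ?y)" unfolding Suc[of "k + 1"] by (simp add: m_assoc)
    finally show ?case unfolding e .
  qed
  show ?thesis
  proof (cases "l' \<le> l")
    case True
    then show ?thesis using up[of k l' "nat (l - l')" k'] by simp
  next
    case False
    then show ?thesis using up[of k' l "nat (l' - l)" k] by simp
  qed
qed

lemma conjugate_int_pow:
  assumes "int p dvd c"
  shows "conjugate k l [^] c = \<one>"
proof -
  have "conjugate k l [^] n = inv (trans k l) \<otimes> a [^] n \<otimes> trans k l" for n :: nat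
    by (induction n) (simp_all add: conjugate_def m_assoc)
  then have "conjugate k l [^] (int p) = \<one>" by (simp add: int_pow_int a_pow)
  moreover obtain z where "c = int p * z" using assms by blast
  ultimately show ?thesis by (simp flip: int_pow_pow)
qed

text \<open>\<open>graph I\<close> is the subgroup generated by the pairs of a monomial with exponents in \<open>I\<close> and the
  corresponding conjugate of \<open>a\<close>.\<close>

inductive graph :: "(int \<times> int) set \<Rightarrow> expansion \<Rightarrow> 'a \<Rightarrow> bool" for I where
  graph_zero: "graph I 0 \<one>"
| graph_add: "graph I f x \<Longrightarrow> (k, l) \<in> I \<Longrightarrow> graph I (f + monomial k l) (x \<otimes> conjugate k l)"
| graph_diff: "graph I f x \<Longrightarrow> (k, l) \<in> I \<Longrightarrow> graph I (f - monomial k l) (x \<otimes> inv (conjugate k l))"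

lemma graph_closed: "graph I f x \<Longrightarrow> x \<in> carrier G"
  by (induction rule: graph.induct) auto

lemma graph_cong: "graph I f x \<Longrightarrow> f = g \<Longrightarrow> x = y \<Longrightarrow> graph I g y"
  by blast

lemma graph_mult:
  assumes "graph I g y" "graph I f x"
  shows "graph I (f + g) (x \<otimes> y)"
  using assms(1)
proof (induction rule: graph.induct)
  case graph_zero
  show ?case by (rule graph_cong[OF assms(2)]) (use graph_closed[OF assms(2)] in \<open>auto simp: fun_eq_iff\<close>)
next
  case (graph_add g y k l)
  show ?case
    by (rule graph_cong[OF graph.graph_add[OF graph_add.IH graph_add.hyps(2)]])
       (use graph_closed[OF assms(2)] graph_closed[OF graph_add.hyps(1)] in \<open>auto simp: m_assoc fun_eq_iff\<close>)
next
  case (graph_diff g y k l)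
  show ?case
    by (rule graph_cong[OF graph.graph_diff[OF graph_diff.IH graph_diff.hyps(2)]])
       (use graph_closed[OF assms(2)] graph_closed[OF graph_diff.hyps(1)] in \<open>auto simp: m_assoc fun_eq_iff\<close>)
qed

lemma graph_gen: "(k, l) \<in> I \<Longrightarrow> graph I (monomial k l) (conjugate k l)"
  using graph_add[OF graph_zero, of k l I] by simp

lemma graph_gen_inv: "(k, l) \<in> I \<Longrightarrow> graph I (- monomial k l) (inv (conjugate k l))"
  using graph_diff[OF graph_zero, of k l I] by simp

lemma graph_inv: "graph I f x \<Longrightarrow> graph I (- f) (inv x)"
proof (induction rule: graph.induct)
  case graph_zero
  show ?case by (rule graph_cong[OF graph.graph_zero]) (auto simp: fun_eq_iff)
next
  case (graph_add f x k l)
  show ?case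
    by (rule graph_cong[OF graph_mult[OF graph_add.IH graph_gen_inv[OF graph_add.hyps(2)]]])
       (use graph_closed[OF graph_add.hyps(1)] in \<open>auto simp: inv_mult_group fun_eq_iff\<close>)
next
  case (graph_diff f x k l)
  show ?case
    by (rule graph_cong[OF graph_mult[OF graph_diff.IH graph_gen[OF graph_diff.hyps(2)]]])
       (use graph_closed[OF graph_diff.hyps(1)] in \<open>auto simp: inv_mult_group fun_eq_iff\<close>)
qed

lemma graph_subst:
  assumes "graph I f x" and gen: "\<And>k l. (k, l) \<in> I \<Longrightarrow> graph J (monomial k l) (conjugate k l)"
  shows "graph J f x"
  using assms(1)
proof (induction rule: graph.induct)
  case graph_zero
  show ?case by (rule graph.graph_zero)
next
  case (graph_add f x k l)
  show ?case by (rule graph_mult[OF gen[OF graph_add.hyps(2)] graph_add.IH])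
next
  case (graph_diff f x k l)
  show ?case
    by (rule graph_cong[OF graph_mult[OF graph_inv[OF gen[OF graph_diff.hyps(2)]] graph_diff.IH]]) (auto simp: fun_eq_iff)
qed

lemma graph_mono: "graph I f x \<Longrightarrow> I \<subseteq> J \<Longrightarrow> graph J f x"
  by (erule graph_subst) (auto intro: graph_gen)

definition row :: "int \<Rightarrow> int \<Rightarrow> (int \<times> int) set" where
  "row k l = {(k', l') | k' l'. k \<le> k' \<and> l' = l}"

text \<open>Pascal's rule pushes a monomial down to row \<open>l\<close> and spreads it to the right
  only, so finitely many monomials fit into one common row.\<close>

lemma graph_row:
  assumes "k \<le> k'" "l \<le> l'"
  shows "graph (row k l) (monomial k' l') (conjugate k' l')"
proof -
  have "graph (row k l) (monomial k' (l + int n)) (conjugate k' (l + int n))" if "k \<le> k'" for n k'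
    using that
  proof (induction n arbitrary: k')
    case 0
    then show ?case by (auto simp: row_def intro: graph_gen)
  next
    case (Suc n)
    have e: "l + int (Suc n) = l + int n + 1" by simp
    have "graph (row k l) (monomial (k' + 1) (l + int n) + monomial k' (l + int n))
        (conjugate (k' + 1) (l + int n) \<otimes> conjugate k' (l + int n))"
      using Suc by (intro graph_mult) auto
    then show ?case unfolding e conjugate_pascal monomial_pascal by (simp only: add.commute)
  qed
  from this[of k' "nat (l' - l)"] show ?thesis using assms by simp
qed

lemma graph_UNIV_row: "graph UNIV f x \<Longrightarrow> \<exists>k l. graph (row k l) f x"
proof (induction rule: graph.induct)
  case graph_zero
  show ?case using graph.graph_zero by blast
next
  case (graph_add f x k l)
  then obtain k' l' where "graph (row k' l') f x" by blast
  then have "graph (row (min k k') (min l l')) f x"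
    by (rule graph_subst) (rule graph_row, auto simp: row_def)
  moreover have "graph (row (min k k') (min l l')) (monomial k l) (conjugate k l)" by (rule graph_row) auto
  ultimately show ?case using graph_mult by blast
next
  case (graph_diff f x k l)
  then obtain k' l' where "graph (row k' l') f x" by blast
  then have "graph (row (min k k') (min l l')) f x"
    by (rule graph_subst) (rule graph_row, auto simp: row_def)
  moreover have "graph (row (min k k') (min l l')) (monomial k l) (conjugate k l)" by (rule graph_row) auto
  ultimately have "graph (row (min k k') (min l l')) (f + - monomial k l) (x \<otimes> inv (conjugate k l))"
    by (intro graph_mult[OF graph_inv])
  then have "graph (row (min k k') (min l l')) (f - monomial k l) (x \<otimes> inv (conjugate k l))" by simp
  then show ?case by blast
qed

lemma graph_commute:
  assumes "graph I f x"
  shows "x \<otimes> conjugate k l [^] (c::int) = conjugate k l [^] c \<otimes> x"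
proof -
  have "x \<otimes> conjugate k l = conjugate k l \<otimes> x" using assms
  proof (induction rule: graph.induct)
    case (graph_add f x k' l')
    have x: "x \<in> carrier G" using graph_closed[OF graph_add.hyps(1)] .
    have "x \<otimes> conjugate k' l' \<otimes> conjugate k l = (x \<otimes> conjugate k l) \<otimes> conjugate k' l'"
      using x conjugate_commute[of k' l' k l] by (simp add: m_assoc)
    then show ?case unfolding graph_add.IH using x by (simp add: m_assoc)
  next
    case (graph_diff f x k' l')
    have x: "x \<in> carrier G" using graph_closed[OF graph_diff.hyps(1)] .
    have "inv (conjugate k' l') \<otimes> conjugate k l = conjugate k l \<otimes> inv (conjugate k' l')"
      using conjugate_commute[of k l k' l']
      by (metis conjugate_closed inv_closed inv_solve_left inv_solve_right m_assoc m_closed)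
    then have "x \<otimes> inv (conjugate k' l') \<otimes> conjugate k l = (x \<otimes> conjugate k l) \<otimes> inv (conjugate k' l')"
      using x by (simp add: m_assoc)
    then show ?case unfolding graph_diff.IH using x by (simp add: m_assoc)
  qed simp
  then show ?thesis using commute_int_pow[of "conjugate k l" x c] graph_closed[OF assms] by simp
qed

lemma graph_insert:
  assumes "graph (insert (k, l) I) f x"
  shows "\<exists>c y. graph I (f - scale c (monomial k l)) y \<and> x = y \<otimes> conjugate k l [^] c"
  using assms
proof (induction rule: graph.induct)
  case graph_zero
  have "0 - scale 0 (monomial k l) = 0" by (auto simp: fun_eq_iff)
  then have "graph I (0 - scale 0 (monomial k l)) \<one>" using graph.graph_zero by metis
  then show ?case by (intro exI[of _ 0] exI[of _ \<one>] conjI) (assumption, simp)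
next
  case (graph_add f x k' l')
  then obtain c y where y: "graph I (f - scale c (monomial k l)) y" "x = y \<otimes> conjugate k l [^] c" by blast
  have yc: "y \<in> carrier G" using graph_closed[OF y(1)] .
  show ?case
  proof (cases "(k', l') = (k, l)")
    case True
    have "graph I (f + monomial k' l' - scale (c + 1) (monomial k l)) y"
      by (rule graph_cong[OF y(1)]) (use True in \<open>auto simp: fun_eq_iff algebra_simps\<close>)
    moreover have "x \<otimes> conjugate k' l' = y \<otimes> conjugate k l [^] (c + 1)"
      using y(2) yc True by (simp add: int_pow_mult m_assoc)
    ultimately show ?thesis by blast
  next
    case False
    have e: "f + monomial k' l' - scale c (monomial k l) = f - scale c (monomial k l) + monomial k' l'"
      by (auto simp: fun_eq_iff)
    have "graph I (f + monomial k' l' - scale c (monomial k l)) (y \<otimes> conjugate k' l')"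
      unfolding e using False graph_add.hyps(2) y by (intro graph.graph_add) auto
    moreover have "x \<otimes> conjugate k' l' = (y \<otimes> conjugate k' l') \<otimes> conjugate k l [^] c"
      using y(2) yc graph_commute[OF graph_gen[of k' l' UNIV], of k l c] by (simp add: m_assoc)
    ultimately show ?thesis by blast
  qed
next
  case (graph_diff f x k' l')
  then obtain c y where y: "graph I (f - scale c (monomial k l)) y" "x = y \<otimes> conjugate k l [^] c" by blast
  have yc: "y \<in> carrier G" using graph_closed[OF y(1)] .
  show ?case
  proof (cases "(k', l') = (k, l)")
    case True
    have "graph I (f - monomial k' l' - scale (c - 1) (monomial k l)) y"
      by (rule graph_cong[OF y(1)]) (use True in \<open>auto simp: fun_eq_iff algebra_simps\<close>)
    moreover have "conjugate k l [^] (c - 1) = conjugate k l [^] c \<otimes> inv (conjugate k l)"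
      using int_pow_mult[of "conjugate k l" c "- 1"] by (simp add: int_pow_neg)
    then have "x \<otimes> inv (conjugate k' l') = y \<otimes> conjugate k l [^] (c - 1)"
      using y(2) yc True by (simp add: m_assoc)
    ultimately show ?thesis by blast
  next
    case False
    have e: "f - monomial k' l' - scale c (monomial k l) = f - scale c (monomial k l) - monomial k' l'"
      by (auto simp: fun_eq_iff)
    have "graph I (f - monomial k' l' - scale c (monomial k l)) (y \<otimes> inv (conjugate k' l'))"
      unfolding e using False graph_diff.hyps(2) y by (intro graph.graph_diff) auto
    moreover have "x \<otimes> inv (conjugate k' l') = (y \<otimes> inv (conjugate k' l')) \<otimes> conjugate k l [^] c"
      using y(2) yc graph_commute[OF graph_gen_inv[of k' l' UNIV], of k l c] by (simp add: m_assoc)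
    ultimately show ?thesis by blast
  qed
qed

text \<open>Every linear relation between monomials modulo \<open>p\<close> also holds between the
  conjugates of \<open>a\<close>. Within one row the monomials are independent, so their multipliers
  are divisible by \<open>p\<close>, and the conjugates have exponent \<open>p\<close>.\<close>

lemma graph_triv:
  assumes "graph UNIV f x" "triv (int p) f"
  shows "x = \<one>"
proof -
  define S where "S k l N = {(k', l') | k' l'. k \<le> k' \<and> k' < k + int N \<and> l' = l}" for k l :: int and N
  obtain k l where "graph (row k l) f x" using assms graph_UNIV_row by blast
  then have "\<exists>N. graph (S k l N) f x"
  proof (induction rule: graph.induct)
    case graph_zero
    show ?case using graph.graph_zero by blast
  next
    case (graph_add f x k' l')
    then obtain N where "graph (S k l N) f x" by blast
    then have "graph (S k l (max N (Suc (nat (k' - k))))) f x" by (rule graph_mono) (auto simp: S_def)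
    then show ?case using graph_add.hyps(2)
      by (intro exI[of _ "max N (Suc (nat (k' - k)))"] graph.graph_add) (auto simp: S_def row_def)
  next
    case (graph_diff f x k' l')
    then obtain N where "graph (S k l N) f x" by blast
    then have "graph (S k l (max N (Suc (nat (k' - k))))) f x" by (rule graph_mono) (auto simp: S_def)
    then show ?case using graph_diff.hyps(2)
      by (intro exI[of _ "max N (Suc (nat (k' - k)))"] graph.graph_diff) (auto simp: S_def row_def)
  qed
  then obtain N where "graph (S k l N) f x" by blast
  then show ?thesis using assms(2)
  proof (induction N arbitrary: k f x)
    case 0
    have "S k l 0 = {}" by (auto simp: S_def)
    then have "graph {} f x" using 0(1) by simp
    then show ?case by (cases rule: graph.cases) auto
  next
    case (Suc N)
    have "S k l (Suc N) = insert (k, l) (S (k + 1) l N)" by (auto simp: S_def)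
    then obtain c y where y: "graph (S (k + 1) l N) (f - scale c (monomial k l)) y"
      "x = y \<otimes> conjugate k l [^] c" using graph_insert Suc.prems(1) by metis
    \<comment> \<open>The other monomials contain higher powers of \<open>t\<close>, so the
      coefficient of \<open>t^k\<close> at 0 isolates the multiplier \<open>c\<close>.\<close>
    from y(1) have "(f - scale c (monomial k l)) Zero k = 0"
      by (induction rule: graph.induct) (auto simp: S_def monomial.simps)
    then have "f Zero k = c" by (simp add: monomial.simps)
    then have c: "int p dvd c" using Suc.prems(2) by (auto simp: triv_def)
    then have "triv (int p) (f - scale c (monomial k l))" using Suc.prems(2) by (simp add: triv_def)
    then have "y = \<one>" using Suc.IH[OF y(1)] by blast
    then show ?case using y(2) conjugate_int_pow[OF c] by simp
  qed
qed

end

section \<open>Walks\<close>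

text \<open>The state \<open>(f, i, j)\<close> stands for the group element with abelian part \<open>f\<close> and image
  \<open>t\<^sup>-\<^sup>i s\<^sup>-\<^sup>j\<close> in the quotient by the normal closure of \<open>a\<close>; words act by right multiplication.\<close>

type_synonym state = "expansion \<times> int \<times> int"

fun step :: "baumslag_gen letter \<Rightarrow> state \<Rightarrow> state" where
  "step (Gen_a, b) (f, i, j) = ((if b then f + monomial i j else f - monomial i j), i, j)"
| "step (Gen_t, b) (f, i, j) = (f, if b then i - 1 else i + 1, j)"
| "step (Gen_s, b) (f, i, j) = (f, i, if b then j - 1 else j + 1)"

definition walk :: "baumslag_gen letter list \<Rightarrow> state \<Rightarrow> state" where
  "walk w st = fold step w st"

lemma walk_simps [simp]: "walk [] st = st" "walk (l # w) st = walk w (step l st)"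
  by (simp_all add: walk_def)

lemma step_inv_letter: "step (inv_letter l) (step l st) = st"
proof -
  obtain x b f i j where "l = (x, b)" "st = (f, i, j)" by (metis prod.exhaust)
  then show ?thesis by (cases x) (auto simp: inv_letter_def)
qed

lemma walk_mult [simp]: "walk (foldr free_cons u v) st = walk v (walk u st)"
proof (induction u arbitrary: st)
  case (Cons l u)
  have "walk (free_cons l w) st = walk w (step l st)" for w
    by (cases w) (auto simp: step_inv_letter)
  then show ?case using Cons by simp
qed simp

lemma walk_inv:
  assumes "w \<in> carrier (free_group UNIV)"
  shows "walk (inv\<^bsub>free_group UNIV\<^esub> w) (walk w st) = st"
proof -
  interpret F: group "free_group (UNIV :: baumslag_gen set)" by (rule group_free_group)
  have "foldr free_cons w (inv\<^bsub>free_group UNIV\<^esub> w) = []" using F.r_inv[OF assms] by simp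
  then show ?thesis using walk_mult[of w "inv\<^bsub>free_group UNIV\<^esub> w" st] by simp
qed

lemma walk_translate: "walk w (f, i, j) = (f', i', j') \<Longrightarrow> walk w (f + h, i, j) = (f' + h, i', j')"
proof (induction w arbitrary: f i j)
  case (Cons l w)
  obtain x b where l: "l = (x, b)" by force
  obtain g k m where g: "step l (f, i, j) = (g, k, m)" by (metis prod.exhaust)
  have "step l (f + h, i, j) = (g + h, k, m)"
    using g by (cases x) (auto simp: l fun_eq_iff)
  moreover have "walk w (g + h, k, m) = (f' + h, i', j')"
    using Cons.prems g by (intro Cons.IH) simp
  ultimately show ?case by (simp only: walk_simps)
qed simp

lemma walk_laurent: "walk w (f, i, j) = (f', i', j') \<Longrightarrow> f \<in> laurent \<Longrightarrow> f' \<in> laurent"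
proof (induction w arbitrary: f i j)
  case (Cons l w)
  obtain x b where l: "l = (x, b)" by force
  obtain g k m where g: "step l (f, i, j) = (g, k, m)" by (metis prod.exhaust)
  have "g \<in> laurent" using g Cons.prems by (cases x) (auto simp: l)
  then show ?case using Cons g by simp
qed simp

text \<open>Every monomial that the walk adds sits at a grid point at distance at most
  \<open>m\<close> from \<open>(i, j)\<close>. Its degree is at most \<open>i + j + m\<close>, and
  since \<open>ball_Infty\<close> asks for strict inequality the bound carries a
  \<open>+ 1\<close>.\<close>

lemma walk_bound:
  assumes "walk w (f, i, j) = (f', i', j')" "length w \<le> m"
  shows "\<bar>i' - i\<bar> + \<bar>j' - j\<bar> \<le> int m"
    and "ball_Infty p (i + j + int m + 1) (f' - f)"
    and "ball_Zero p (i - int m) (f' - f)"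
    and "ball_MinusOne p (j - int m) (f' - f)"
proof -
  have "\<bar>i' - i\<bar> + \<bar>j' - j\<bar> \<le> int m \<and> ball_Infty p (i + j + int m + 1) (f' - f) \<and>
      ball_Zero p (i - int m) (f' - f) \<and> ball_MinusOne p (j - int m) (f' - f)"
    using assms
  proof (induction w arbitrary: f i j m)
    case Nil
    then show ?case by (simp add: ball_defs)
  next
    case (Cons l w)
    obtain x b where l: "l = (x, b)" by force
    obtain g k n where g: "step l (f, i, j) = (g, k, n)" by (metis prod.exhaust)
    obtain m' where m: "m = Suc m'" using Cons.prems by (cases m) auto
    have walk_w: "walk w (g, k, n) = (f', i', j')" and len_w: "length w \<le> m'"
      using Cons.prems g m by simp_all
    have IH: "\<bar>i' - k\<bar> + \<bar>j' - n\<bar> \<le> int m'" "ball_Infty p (k + n + int m' + 1) (f' - g)"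
      "ball_Zero p (k - int m') (f' - g)" "ball_MinusOne p (n - int m') (f' - g)"
      using Cons.IH[of g k n m', OF walk_w len_w] by (blast, blast, blast, blast)
    have kn: "\<bar>k - i\<bar> + \<bar>n - j\<bar> \<le> 1" using g by (cases x) (auto simp: l)
    have mono: "ball_Infty p (i + j + int m + 1) (f' - g)" "ball_Zero p (i - int m) (f' - g)"
      "ball_MinusOne p (j - int m) (f' - g)"
      using IH kn m unfolding ball_defs by auto
    have 1: "ball_Infty p (i + j + int m + 1) (f - g)" "ball_Zero p (i - int m) (f - g)"
      "ball_MinusOne p (j - int m) (f - g)"
      using g by (cases x; auto simp: l ball_defs monomial.simps)+
    have e: "f' - f = (f' - g) - (f - g)" by simp
    have "ball_Infty p (i + j + int m + 1) (f' - f)" "ball_Zero p (i - int m) (f' - f)"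
      "ball_MinusOne p (j - int m) (f' - f)"
      unfolding e by (intro ball_diff mono 1)+
    moreover have "\<bar>i' - i\<bar> + \<bar>j' - j\<bar> \<le> int m" using IH(1) kn m by linarith
    ultimately show ?case by blast
  qed
  then show "\<bar>i' - i\<bar> + \<bar>j' - j\<bar> \<le> int m" "ball_Infty p (i + j + int m + 1) (f' - f)"
    "ball_Zero p (i - int m) (f' - f)" "ball_MinusOne p (j - int m) (f' - f)" by auto
qed

context baumslag_relations
begin

definition gens :: "baumslag_gen \<Rightarrow> 'a" where
  "gens = case_baumslag_gen a s t"

lemma gens_closed: "gens \<in> UNIV \<rightarrow> carrier G"
  by (auto simp: gens_def split: baumslag_gen.split)

text \<open>\<open>inv (trans i j)\<close> represents the position, and \<open>x\<close> collects
  the conjugates of \<open>a\<close> that are met on the way.\<close>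

lemma walk_graph:
  assumes "walk w (f, i, j) = (f', i', j')"
  shows "\<exists>x. graph UNIV (f' - f) x \<and> inv (trans i j) \<otimes> free_lift G gens w = x \<otimes> inv (trans i' j')"
  using assms
proof (induction w arbitrary: f i j)
  case Nil
  then have "graph UNIV (f' - f) \<one>" "inv (trans i j) \<otimes> free_lift G gens [] = \<one> \<otimes> inv (trans i' j')"
    using graph_zero[of UNIV] by simp_all
  then show ?case by blast
next
  case (Cons l w)
  obtain x b where l: "l = (x, b)" by force
  obtain g k n where g: "step l (f, i, j) = (g, k, n)" by (metis prod.exhaust)
  have walk_w: "walk w (g, k, n) = (f', i', j')" using Cons.prems g by simp
  obtain y where y: "graph UNIV (f' - g) y" "inv (trans k n) \<otimes> free_lift G gens w = y \<otimes> inv (trans i' j')"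
    using Cons.IH[of g k n, OF walk_w] by blast
  have w: "free_lift G gens w \<in> carrier G" by (rule free_lift_closed[OF gens_closed]) auto
  let ?l = "if b then gens x else inv (gens x)"
  have lc: "?l \<in> carrier G" using gens_closed by auto
  have "\<exists>z. graph UNIV (g - f) z \<and> inv (trans i j) \<otimes> ?l = z \<otimes> inv (trans k n)"
  proof (cases x)
    case Gen_a
    show ?thesis
    proof (cases b)
      case True
      have "g - f = monomial i j" "k = i" "n = j" using g Gen_a True l by auto
      then show ?thesis using True Gen_a graph_gen[of i j UNIV]
        by (intro exI[of _ "conjugate i j"]) (auto simp: gens_def conjugate_def m_assoc)
    next
      case False
      have "g - f = - monomial i j" "k = i" "n = j" using g Gen_a False l by auto
      then show ?thesis using False Gen_a graph_gen_inv[of i j UNIV]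
        by (intro exI[of _ "inv (conjugate i j)"]) (auto simp: gens_def conjugate_def inv_mult_group m_assoc)
    qed
  next
    case Gen_s
    have e: "g - f = 0" "k = i" "n = (if b then j - 1 else j + 1)" using g Gen_s l by auto
    have "inv (trans i j) \<otimes> ?l = inv (trans i n)"
    proof -
      have *: "trans i j = s \<otimes> trans i (j - 1)" "trans i (j + 1) = s \<otimes> trans i j"
        using trans_add[of 0 1 i "j - 1"] trans_add[of 0 1 i j] by (simp_all add: trans_simps add.commute)
      show ?thesis
      proof (cases b)
        case True
        then show ?thesis using e(3) by (simp add: Gen_s gens_def *(1) inv_mult_group m_assoc)
      next
        case False
        then show ?thesis using e(3) by (simp add: Gen_s gens_def *(2) inv_mult_group)
      qed
    qed
    then show ?thesis using e graph_zero by (intro exI[of _ \<one>]) auto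
  next
    case Gen_t
    have e: "g - f = 0" "n = j" "k = (if b then i - 1 else i + 1)" using g Gen_t l by auto
    have "inv (trans i j) \<otimes> ?l = inv (trans k j)"
    proof -
      have *: "trans i j = t \<otimes> trans (i - 1) j" "trans (i + 1) j = t \<otimes> trans i j"
        using trans_add[of 1 0 "i - 1" j] trans_add[of 1 0 i j] by (simp_all add: trans_simps add.commute)
      show ?thesis
      proof (cases b)
        case True
        then show ?thesis using e(3) by (simp add: Gen_t gens_def *(1) inv_mult_group m_assoc)
      next
        case False
        then show ?thesis using e(3) by (simp add: Gen_t gens_def *(2) inv_mult_group)
      qed
    qed
    then show ?thesis using e graph_zero by (intro exI[of _ \<one>]) auto
  qed
  then obtain z where z: "graph UNIV (g - f) z" "inv (trans i j) \<otimes> ?l = z \<otimes> inv (trans k n)" by blast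
  have zc: "z \<in> carrier G" "y \<in> carrier G" using z y graph_closed by auto
  have "inv (trans i j) \<otimes> free_lift G gens (l # w) = (inv (trans i j) \<otimes> ?l) \<otimes> free_lift G gens w"
    using w lc by (simp add: l m_assoc)
  also have "\<dots> = z \<otimes> (inv (trans k n) \<otimes> free_lift G gens w)" unfolding z(2) using zc w by (simp add: m_assoc)
  also have "\<dots> = (z \<otimes> y) \<otimes> inv (trans i' j')" unfolding y(2) using zc by (simp add: m_assoc)
  finally have "inv (trans i j) \<otimes> free_lift G gens (l # w) = (z \<otimes> y) \<otimes> inv (trans i' j')" .
  moreover have "graph UNIV (f' - f) (z \<otimes> y)"
    by (rule graph_cong[OF graph_mult[OF y(1) z(1)]]) (auto simp: fun_eq_iff)
  ultimately show ?case by blast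
qed

lemma closed_walk_trivial:
  assumes "walk w (f, i, j) = (f', i, j)" "triv (int p) (f' - f)"
  shows "free_lift G gens w = \<one>"
proof -
  have w: "free_lift G gens w \<in> carrier G" by (rule free_lift_closed[OF gens_closed]) auto
  obtain x where "graph UNIV (f' - f) x" "inv (trans i j) \<otimes> free_lift G gens w = x \<otimes> inv (trans i j)"
    using walk_graph[OF assms(1)] by blast
  moreover from this have "x = \<one>" using graph_triv assms(2) by blast
  ultimately have "inv (trans i j) \<otimes> free_lift G gens w = inv (trans i j) \<otimes> \<one>" by simp
  then show ?thesis using w Units_l_cancel[of "inv (trans i j)"] by simp
qed

end

section \<open>The word problem of the presented group\<close>

abbreviation baumslag_free :: "baumslag_gen letter list monoid" where
  "baumslag_free \<equiv> free_group UNIV"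

interpretation FG: group baumslag_free
  by (rule group_free_group)

definition symmetrized_relators :: "nat \<Rightarrow> baumslag_gen letter list set" where
  "symmetrized_relators p = baumslag_relators p \<union> (\<lambda>r. inv\<^bsub>baumslag_free\<^esub> r) ` baumslag_relators p"

definition quot :: "nat \<Rightarrow> baumslag_gen letter list \<Rightarrow> baumslag_gen letter list set" where
  "quot p w = normal_closure baumslag_free (baumslag_relators p) #>\<^bsub>baumslag_free\<^esub> w"

lemma symmetrized_filled: "filled_group baumslag_free (symmetrized_relators p)"
  using baumslag_relators_closed[of p]
  by unfold_locales (auto simp: symmetrized_relators_def subset_iff)

lemma quot_hom: "quot p \<in> hom baumslag_free (baumslag_group p)"
proof -
  interpret N: normal "normal_closure baumslag_free (baumslag_relators p)" baumslag_free
    by (rule FG.normal_closure_normal[OF baumslag_relators_closed])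
  show ?thesis
    unfolding baumslag_group_def presented_group_def using N.r_coset_hom_Mod
    by (simp add: quot_def[abs_def])
qed

lemma quot_surj: "g \<in> carrier (baumslag_group p) \<Longrightarrow> \<exists>w\<in>carrier baumslag_free. quot p w = g"
  unfolding baumslag_group_def presented_group_def quot_def FactGroup_def RCOSETS_def by auto

lemma quot_kernel:
  assumes "w \<in> carrier baumslag_free"
  shows "quot p w = \<one>\<^bsub>baumslag_group p\<^esub> \<longleftrightarrow> (\<exists>m. fills baumslag_free (symmetrized_relators p) m w)"
proof -
  interpret N: normal "normal_closure baumslag_free (baumslag_relators p)" baumslag_free
    by (rule FG.normal_closure_normal[OF baumslag_relators_closed])
  have "quot p w = \<one>\<^bsub>baumslag_group p\<^esub> \<longleftrightarrow> w \<in> normal_closure baumslag_free (baumslag_relators p)"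
    unfolding baumslag_group_def presented_group_def quot_def
    using FG.coset_join1[OF _ assms N.subgroup_axioms] FG.coset_join2[OF assms N.subgroup_axioms] N.subset
    by (auto simp: FactGroup_def)
  then show ?thesis
    using FG.normal_closure_fills_iff[OF baumslag_relators_closed] by (simp add: symmetrized_relators_def)
qed

lemma finite_presentation_baumslag:
  "finite_presentation (baumslag_group p) UNIV (symmetrized_relators p) (quot p)"
proof -
  interpret group "baumslag_group p" by (rule group_baumslag_group)
  have "(UNIV :: baumslag_gen set) = {Gen_a, Gen_s, Gen_t}"
    using baumslag_gen.exhaust by blast
  then have "finite (UNIV :: baumslag_gen set)" by (metis finite.emptyI finite_insert)
  moreover have "finite (symmetrized_relators p)"
    by (simp add: symmetrized_relators_def baumslag_relators_def Let_def)
  ultimately show ?thesis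
    using quot_hom[of p] quot_surj quot_kernel symmetrized_filled[of p] group_axioms
    unfolding finite_presentation_def finite_presentation_axioms_def by blast
qed

lemma relators_walk:
  assumes "r \<in> baumslag_relators p"
  shows "\<exists>f'. walk r (f, i, j) = (f', i, j) \<and> triv (int p) (f' - f)"
proof -
  have pow: "walk ([(Gen_a, True)] [^]\<^bsub>baumslag_free\<^esub> n) (f, i, j) = (f + scale (int n) (monomial i j), i, j)" for n
  proof (induction n)
    case 0
    then show ?case by (simp add: fun_eq_iff)
  next
    case (Suc n)
    then show ?case by (simp add: fun_eq_iff algebra_simps)
  qed
  have undo: "walk (inv\<^bsub>baumslag_free\<^esub> w) st = st'" if "w \<in> carrier baumslag_free" "walk w st' = st" for w st st'
    using walk_inv[OF that(1), of st'] that(2) by simp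
  define c where "c = conj_by baumslag_free (free_gen Gen_a) (free_gen Gen_t)"
  define d where "d = conj_by baumslag_free (free_gen Gen_a) (free_gen Gen_s)"
  have cc: "c \<in> carrier baumslag_free" "d \<in> carrier baumslag_free"
    unfolding c_def d_def conj_by_def
    by (intro FG.m_closed FG.inv_closed free_gen_closed UNIV_I)+
  have c: "walk c (f, i, j) = (f + monomial (i + 1) j, i, j)" for f i j
    by (simp add: c_def conj_by_def free_gen_def inv_letter_word inv_letter_def)
  have d: "walk d (f, i, j) = (f + monomial i (j + 1), i, j)" for f i j
    by (simp add: d_def conj_by_def free_gen_def inv_letter_word inv_letter_def)
  have c': "walk (inv\<^bsub>baumslag_free\<^esub> c) (f, i, j) = (f - monomial (i + 1) j, i, j)" for f i j
    using cc by (intro undo) (auto simp: c fun_eq_iff)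
  have ca: "walk (inv\<^bsub>baumslag_free\<^esub> (c \<otimes>\<^bsub>baumslag_free\<^esub> free_gen Gen_a)) (f, i, j)
      = (f - (monomial i j + monomial (i + 1) j), i, j)" for f i j
    using cc by (intro undo FG.m_closed free_gen_closed UNIV_I) (auto simp: c fun_eq_iff free_gen_def)
  have "r = [(Gen_a, True)] [^]\<^bsub>baumslag_free\<^esub> p \<or> r = commutator baumslag_free (free_gen Gen_s) (free_gen Gen_t) \<or>
      r = commutator baumslag_free c (free_gen Gen_a) \<or>
      r = d \<otimes>\<^bsub>baumslag_free\<^esub> inv\<^bsub>baumslag_free\<^esub> (c \<otimes>\<^bsub>baumslag_free\<^esub> free_gen Gen_a)"
    using assms unfolding baumslag_relators_def Let_def c_def d_def by (auto simp: free_gen_def)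
  then consider (scaled) "walk r (f, i, j) = (f + scale (int p) (monomial i j), i, j)" | (unchanged) "walk r (f, i, j) = (f, i, j)"
  proof (elim disjE)
    assume "r = commutator baumslag_free (free_gen Gen_s) (free_gen Gen_t)"
    then show ?thesis using that(2) by (simp add: commutator_def free_gen_def inv_letter_word inv_letter_def)
  next
    assume r: "r = commutator baumslag_free c (free_gen Gen_a)"
    have "walk r (f, i, j) = (f, i, j)" unfolding r
      by (simp add: commutator_def free_gen_def inv_letter_word inv_letter_def c c' fun_eq_iff)
    then show ?thesis using that(2) by blast
  next
    assume r: "r = d \<otimes>\<^bsub>baumslag_free\<^esub> inv\<^bsub>baumslag_free\<^esub> (c \<otimes>\<^bsub>baumslag_free\<^esub> free_gen Gen_a)"
    have "walk r (f, i, j) = walk (inv\<^bsub>baumslag_free\<^esub> (c \<otimes>\<^bsub>baumslag_free\<^esub> free_gen Gen_a)) (walk d (f, i, j))"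
      unfolding r by (simp only: free_group_simps walk_mult)
    also have "\<dots> = (f, i, j)" unfolding d ca monomial_pascal by (simp add: fun_eq_iff)
    finally show ?thesis using that(2) by blast
  qed (use pow that(1) in simp)
  then show ?thesis
  proof cases
    case scaled
    then show ?thesis by (intro exI[of _ "f + scale (int p) (monomial i j)"]) (auto simp: triv_def)
  next
    case unchanged
    then show ?thesis by (intro exI[of _ f]) (auto simp: triv_def)
  qed
qed

text \<open>A relator closes up modulo \<open>p\<close> wherever it is started. The induction needs
  all starting states, because a conjugating word moves the starting point of the relator.\<close>

lemma fills_walk:
  assumes "fills baumslag_free (symmetrized_relators p) m w"
  shows "\<exists>f'. walk w (f, i, j) = (f', i, j) \<and> triv (int p) (f' - f)"
proof -
  interpret filled_group baumslag_free "symmetrized_relators p" by (rule symmetrized_filled)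
  define loop where "loop w \<longleftrightarrow> (\<forall>f i j. \<exists>f'. walk w (f, i, j) = (f', i, j) \<and> triv (int p) (f' - f))" for w
  have loop_rel: "loop r" if r: "r \<in> symmetrized_relators p" for r
  proof -
    consider "r \<in> baumslag_relators p" | r' where "r' \<in> baumslag_relators p" "r = inv\<^bsub>baumslag_free\<^esub> r'"
      using r unfolding symmetrized_relators_def by blast
    then show ?thesis
    proof cases
      case 1
      then show ?thesis unfolding loop_def using relators_walk by blast
    next
      case 2
      have r': "r' \<in> carrier baumslag_free" using 2 baumslag_relators_closed by blast
      show ?thesis unfolding loop_def
      proof (intro allI)
        fix f i j
        obtain g where g: "walk r' (f, i, j) = (g, i, j)" "triv (int p) (g - f)" using relators_walk[OF 2(1)] by blast
        have "walk r (g, i, j) = (f, i, j)" using walk_inv[OF r', of "(f, i, j)"] g 2 by simp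
        from walk_translate[OF this, of "f - g"] have "walk r (f, i, j) = (f + (f - g), i, j)" by simp
        moreover have "triv (int p) (f + (f - g) - f)" using g(2) by (simp add: triv_def dvd_diff_commute)
        ultimately show "\<exists>f'. walk r (f, i, j) = (f', i, j) \<and> triv (int p) (f' - f)" by blast
      qed
    qed
  qed
  have "loop w" using Q_closed assms
  proof (induction rule: FG.fills_induct)
    case (one m)
    show ?case unfolding loop_def by (auto simp: triv_def)
  next
    case (mult m g r y)
    show ?case unfolding loop_def
    proof (intro allI)
      fix f i j
      obtain f1 i1 j1 where 1: "walk g (f, i, j) = (f1, i1, j1)" by (metis prod.exhaust)
      obtain f2 where 2: "walk r (f1, i1, j1) = (f2, i1, j1)" "triv (int p) (f2 - f1)"
        using loop_rel[OF mult(2)] unfolding loop_def by blast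
      have "walk (inv\<^bsub>baumslag_free\<^esub> g) (f1, i1, j1) = (f, i, j)" using walk_inv[OF mult(1), of "(f, i, j)"] 1 by simp
      from walk_translate[OF this, of "f2 - f1"]
      have 3: "walk (inv\<^bsub>baumslag_free\<^esub> g) (f2, i1, j1) = (f + (f2 - f1), i, j)" by simp
      obtain f3 where 4: "walk y (f + (f2 - f1), i, j) = (f3, i, j)" "triv (int p) (f3 - (f + (f2 - f1)))"
        using mult(4) unfolding loop_def by blast
      have "walk (g \<otimes>\<^bsub>baumslag_free\<^esub> r \<otimes>\<^bsub>baumslag_free\<^esub> inv\<^bsub>baumslag_free\<^esub> g \<otimes>\<^bsub>baumslag_free\<^esub> y) (f, i, j) = (f3, i, j)"
        by (simp add: 1 2(1) 3 4(1))
      moreover have "triv (int p) (f3 - f)"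
        unfolding triv_def
      proof (intro allI)
        fix q n
        have "int p dvd (f3 - (f + (f2 - f1))) q n" "int p dvd (f2 - f1) q n"
          using 2(2) 4(2) unfolding triv_def by blast+
        from dvd_add[OF this] show "int p dvd (f3 - f) q n" by simp
      qed
      ultimately show "\<exists>f'. walk (g \<otimes>\<^bsub>baumslag_free\<^esub> r \<otimes>\<^bsub>baumslag_free\<^esub> inv\<^bsub>baumslag_free\<^esub> g \<otimes>\<^bsub>baumslag_free\<^esub> y) (f, i, j)
          = (f', i, j) \<and> triv (int p) (f' - f)" by blast
    qed
  qed
  then show ?thesis unfolding loop_def by blast
qed

lemma baumslag_relations_quot:
  "baumslag_relations (baumslag_group p) (quot p (free_gen Gen_a)) (quot p (free_gen Gen_s)) (quot p (free_gen Gen_t)) p"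
proof -
  interpret G: group "baumslag_group p" by (rule group_baumslag_group)
  interpret q: group_hom baumslag_free "baumslag_group p" "quot p" by unfold_locales (rule quot_hom)
  interpret fg: filled_group baumslag_free "symmetrized_relators p" by (rule symmetrized_filled)
  define a where "a = free_gen Gen_a"
  define s where "s = free_gen Gen_s"
  define t where "t = free_gen Gen_t"
  have c: "a \<in> carrier baumslag_free" "s \<in> carrier baumslag_free" "t \<in> carrier baumslag_free"
    by (simp_all add: a_def s_def t_def free_gen_closed)
  have rel: "quot p r = \<one>\<^bsub>baumslag_group p\<^esub>" if "r \<in> baumslag_relators p" for r
  proof -
    have "r \<in> symmetrized_relators p" using that by (simp add: symmetrized_relators_def)
    from FG.fills_base[OF fg.Q_closed this] show ?thesis
      using quot_kernel[of r p] that baumslag_relators_closed by blast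
  qed
  have q: "quot p (x \<otimes>\<^bsub>baumslag_free\<^esub> y) = quot p x \<otimes>\<^bsub>baumslag_group p\<^esub> quot p y"
    "quot p (inv\<^bsub>baumslag_free\<^esub> x) = inv\<^bsub>baumslag_group p\<^esub> quot p x"
    if "x \<in> carrier baumslag_free" "y \<in> carrier baumslag_free" for x y
    using that q.hom_mult q.hom_inv by blast+
  have 1: "quot p (a [^]\<^bsub>baumslag_free\<^esub> p) = \<one>\<^bsub>baumslag_group p\<^esub>"
    and 2: "quot p (commutator baumslag_free s t) = \<one>\<^bsub>baumslag_group p\<^esub>"
    and 3: "quot p (commutator baumslag_free (conj_by baumslag_free a t) a) = \<one>\<^bsub>baumslag_group p\<^esub>"
    and 4: "quot p (conj_by baumslag_free a s \<otimes>\<^bsub>baumslag_free\<^esub>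
        inv\<^bsub>baumslag_free\<^esub> (conj_by baumslag_free a t \<otimes>\<^bsub>baumslag_free\<^esub> a)) = \<one>\<^bsub>baumslag_group p\<^esub>"
    by (rule rel; simp only: baumslag_relators_def Let_def a_def s_def t_def insert_iff simp_thms)+
  have comm: "x \<otimes>\<^bsub>baumslag_group p\<^esub> y = y \<otimes>\<^bsub>baumslag_group p\<^esub> x"
    if "commutator (baumslag_group p) x y = \<one>\<^bsub>baumslag_group p\<^esub>"
      "x \<in> carrier (baumslag_group p)" "y \<in> carrier (baumslag_group p)" for x y
  proof -
    have "(y \<otimes>\<^bsub>baumslag_group p\<^esub> x) \<otimes>\<^bsub>baumslag_group p\<^esub> commutator (baumslag_group p) x y = x \<otimes>\<^bsub>baumslag_group p\<^esub> y"
      using that(2,3) by (simp add: commutator_def G.m_assoc)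
    then show ?thesis using that by simp
  qed
  have qcomm: "quot p (commutator baumslag_free x y) = commutator (baumslag_group p) (quot p x) (quot p y)"
    and qconj: "quot p (conj_by baumslag_free x y) = conj_by (baumslag_group p) (quot p x) (quot p y)"
    if "x \<in> carrier baumslag_free" "y \<in> carrier baumslag_free" for x y
    using that by (simp_all only: commutator_def conj_by_def q FG.m_closed FG.inv_closed)
  have cj: "conj_by baumslag_free x y \<in> carrier baumslag_free"
    if "x \<in> carrier baumslag_free" "y \<in> carrier baumslag_free" for x y
    unfolding conj_by_def using that by (intro FG.m_closed FG.inv_closed)
  let ?a = "quot p a" and ?s = "quot p s" and ?t = "quot p t"
  have qc: "?a \<in> carrier (baumslag_group p)" "?s \<in> carrier (baumslag_group p)" "?t \<in> carrier (baumslag_group p)"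
    using c q.hom_closed by blast+
  have pow: "?a [^]\<^bsub>baumslag_group p\<^esub> p = \<one>\<^bsub>baumslag_group p\<^esub>" using 1 q.hom_nat_pow[OF c(1)] by simp
  have st: "?s \<otimes>\<^bsub>baumslag_group p\<^esub> ?t = ?t \<otimes>\<^bsub>baumslag_group p\<^esub> ?s"
    using 2 c qc by (intro comm) (simp_all only: qcomm)
  have at: "conj_by (baumslag_group p) ?a ?t \<otimes>\<^bsub>baumslag_group p\<^esub> ?a = ?a \<otimes>\<^bsub>baumslag_group p\<^esub> conj_by (baumslag_group p) ?a ?t"
    using 3 c qc by (intro comm) (simp_all only: qcomm qconj cj, simp add: conj_by_def)
  have "conj_by (baumslag_group p) ?a ?s \<otimes>\<^bsub>baumslag_group p\<^esub>
      inv\<^bsub>baumslag_group p\<^esub> (conj_by (baumslag_group p) ?a ?t \<otimes>\<^bsub>baumslag_group p\<^esub> ?a) = \<one>\<^bsub>baumslag_group p\<^esub>"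
    using 4 c by (simp only: q qconj cj FG.m_closed FG.inv_closed)
  then have as: "conj_by (baumslag_group p) ?a ?s = conj_by (baumslag_group p) ?a ?t \<otimes>\<^bsub>baumslag_group p\<^esub> ?a"
    using qc G.inv_solve_right[of "\<one>\<^bsub>baumslag_group p\<^esub>" "conj_by (baumslag_group p) ?a ?s"
        "conj_by (baumslag_group p) ?a ?t \<otimes>\<^bsub>baumslag_group p\<^esub> ?a"] by (simp add: conj_by_def)
  show ?thesis
    using qc pow st at as unfolding a_def s_def t_def conj_by_def by unfold_locales
qed

text \<open>Together with \<open>quot_kernel\<close> and \<open>fills_walk\<close> this decides
  triviality: a word is trivial exactly when its walk closes modulo \<open>p\<close>.\<close>

lemma quot_trivial_if_closed_walk:
  assumes "w \<in> carrier baumslag_free" "walk w (f, i, j) = (f', i, j)" "triv (int p) (f' - f)"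
  shows "quot p w = \<one>\<^bsub>baumslag_group p\<^esub>"
proof -
  interpret B: baumslag_relations "baumslag_group p" "quot p (free_gen Gen_a)" "quot p (free_gen Gen_s)"
      "quot p (free_gen Gen_t)" p
    by (rule baumslag_relations_quot)
  have "quot p w = free_lift (baumslag_group p) B.gens w"
  proof (rule B.free_hom_eqI[OF quot_hom B.free_lift_hom[OF B.gens_closed] _ assms(1)])
    fix x :: baumslag_gen
    show "quot p (free_gen x) = free_lift (baumslag_group p) B.gens (free_gen x)"
      using B.free_lift_letter[OF B.gens_closed UNIV_I, of x True]
      unfolding free_gen_def[of x, symmetric] by (cases x) (simp_all add: B.gens_def)
  qed
  then show ?thesis using B.closed_walk_trivial assms(2,3) by simp
qed

section \<open>Flats in Baumslag's group\<close>

locale baumslag_filling =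
  fixes p :: nat
  assumes p_pos: "0 < p"
begin

sublocale filled_group baumslag_free "symmetrized_relators p"
  by (rule symmetrized_filled)

text \<open>There are finitely many words of bounded length and each trivial one has some filling.
  This prices the unit squares of flats and the walks of one letter.\<close>

lemma bounded_fills:
  "\<exists>K. \<forall>w\<in>carrier baumslag_free. length w \<le> n \<longrightarrow> quot p w = \<one>\<^bsub>baumslag_group p\<^esub> \<longrightarrow>
     fills baumslag_free (symmetrized_relators p) K w"
proof -
  interpret finite_presentation "baumslag_group p" UNIV "symmetrized_relators p" "quot p"
    by (rule finite_presentation_baumslag)
  define W where "W = {w \<in> carrier baumslag_free. length w \<le> n \<and> quot p w = \<one>\<^bsub>baumslag_group p\<^esub>}"
  have "W \<subseteq> {w \<in> carrier baumslag_free. length w \<le> n}" by (auto simp: W_def)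
  then have "finite W" using finite_short_words[OF finite_gens] finite_subset by blast
  moreover have "\<forall>w\<in>W. \<exists>m. fills baumslag_free (symmetrized_relators p) m w"
    using quot_kernel by (auto simp: W_def)
  ultimately have "\<exists>K. \<forall>w\<in>W. fills baumslag_free (symmetrized_relators p) K w"
  proof (induction rule: finite_induct)
    case (insert w W)
    then obtain K m where "\<forall>w\<in>W. fills baumslag_free (symmetrized_relators p) K w"
      "fills baumslag_free (symmetrized_relators p) m w" by blast
    then have "\<forall>v\<in>insert w W. fills baumslag_free (symmetrized_relators p) (max K m) v"
      using FG.fills_mono[OF _ max.cobounded1] FG.fills_mono[OF _ max.cobounded2] by blast
    then show ?case by blast
  qed simp
  then show ?thesis unfolding W_def by blast
qed

text \<open>The ring part at the end is compared modulo \<open>p\<close>, since the points of a flat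
  are determined only up to such a congruence.\<close>

definition leads :: "baumslag_gen letter list \<Rightarrow> state \<Rightarrow> state \<Rightarrow> bool" where
  "leads w st st' \<longleftrightarrow> w \<in> carrier baumslag_free \<and>
     (\<exists>f. walk w st = (f, snd st') \<and> triv (int p) (f - fst st'))"

lemma triv_trans: "triv (int p) (f - g) \<Longrightarrow> triv (int p) (g - h) \<Longrightarrow> triv (int p) (f - h)"
  unfolding triv_def
proof (intro allI)
  fix q n
  assume "\<forall>q n. int p dvd (f - g) q n" "\<forall>q n. int p dvd (g - h) q n"
  then have "int p dvd (f - g) q n + (g - h) q n" by (intro dvd_add) blast+
  then show "int p dvd (f - h) q n" by simp
qed

lemma triv_sym: "triv (int p) (f - g) \<Longrightarrow> triv (int p) (g - f)"
  by (simp add: triv_def dvd_diff_commute)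

lemma walk_triv:
  assumes "walk w (f, i, j) = (f', k, l)"
  shows "walk w (g, i, j) = (f' + (g - f), k, l)"
  using walk_translate[OF assms, of "g - f"] by simp

lemma leads_mult:
  assumes "leads u st st'" "leads v st' st''"
  shows "leads (u \<otimes>\<^bsub>baumslag_free\<^esub> v) st st''"
proof -
  obtain f i j where st: "st = (f, i, j)" by (metis prod.exhaust)
  obtain f' i' j' where st': "st' = (f', i', j')" by (metis prod.exhaust)
  obtain f'' i'' j'' where st'': "st'' = (f'', i'', j'')" by (metis prod.exhaust)
  obtain g where g: "walk u (f, i, j) = (g, i', j')" "triv (int p) (g - f')"
    using assms(1) by (auto simp: leads_def st st')
  obtain h where h: "walk v (f', i', j') = (h, i'', j'')" "triv (int p) (h - f'')"
    using assms(2) by (auto simp: leads_def st' st'')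
  have "walk v (g, i', j') = (h + (g - f'), i'', j'')" using walk_triv[OF h(1)] .
  then have "walk (u \<otimes>\<^bsub>baumslag_free\<^esub> v) st = (h + (g - f'), i'', j'')" by (simp add: st g(1))
  moreover have "triv (int p) (h + (g - f') - h)" using g(2) by simp
  then have "triv (int p) (h + (g - f') - f'')" using h(2) triv_trans by blast
  moreover have "u \<otimes>\<^bsub>baumslag_free\<^esub> v \<in> carrier baumslag_free"
    using assms by (intro FG.m_closed) (auto simp: leads_def)
  ultimately show ?thesis unfolding leads_def st'' by (simp only: snd_conv fst_conv) blast
qed

lemma leads_inv:
  assumes "leads u st st'"
  shows "leads (inv\<^bsub>baumslag_free\<^esub> u) st' st"
proof -
  obtain f i j where st: "st = (f, i, j)" by (metis prod.exhaust)
  obtain f' i' j' where st': "st' = (f', i', j')" by (metis prod.exhaust)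
  have u: "u \<in> carrier baumslag_free" using assms by (simp add: leads_def)
  obtain g where g: "walk u (f, i, j) = (g, i', j')" "triv (int p) (g - f')"
    using assms by (auto simp: leads_def st st')
  have "walk (inv\<^bsub>baumslag_free\<^esub> u) (g, i', j') = (f, i, j)" using walk_inv[OF u, of "(f, i, j)"] g(1) by simp
  then have "walk (inv\<^bsub>baumslag_free\<^esub> u) (f', i', j') = (f + (f' - g), i, j)" by (rule walk_triv)
  moreover have "triv (int p) (f + (f' - g) - f)" using triv_sym[OF g(2)] by simp
  ultimately show ?thesis unfolding leads_def st st'
    using FG.inv_closed[OF u] by (simp only: snd_conv fst_conv) blast
qed

lemma leads_refl: "leads \<one>\<^bsub>baumslag_free\<^esub> st st"
  by (cases st) (simp add: leads_def triv_def free_group_carrier)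

lemma leads_quot:
  assumes "leads u st st'" "leads v st st'"
  shows "quot p (u \<otimes>\<^bsub>baumslag_free\<^esub> inv\<^bsub>baumslag_free\<^esub> v) = \<one>\<^bsub>baumslag_group p\<^esub>"
proof -
  obtain f i j where st: "st = (f, i, j)" by (metis prod.exhaust)
  have "leads (u \<otimes>\<^bsub>baumslag_free\<^esub> inv\<^bsub>baumslag_free\<^esub> v) st st"
    by (rule leads_mult[OF assms(1) leads_inv[OF assms(2)]])
  then obtain g where "walk (u \<otimes>\<^bsub>baumslag_free\<^esub> inv\<^bsub>baumslag_free\<^esub> v) (f, i, j) = (g, i, j)"
    "triv (int p) (g - f)" "u \<otimes>\<^bsub>baumslag_free\<^esub> inv\<^bsub>baumslag_free\<^esub> v \<in> carrier baumslag_free"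
    unfolding leads_def st fst_conv snd_conv by blast
  then show ?thesis by (intro quot_trivial_if_closed_walk)
qed

lemma leads_seg:
  assumes "\<And>i. leads (s i) (st i) (st (i + 1))"
  shows "leads (FG.seg s i j) (st i) (st j)"
proof -
  have s: "s i \<in> carrier baumslag_free" for i using assms by (simp add: leads_def)
  show ?thesis
  proof (induction j rule: int_induct[of _ i])
    case base
    then show ?case using leads_refl by (simp add: FG.seg_refl[OF s])
  next
    case (step1 j)
    then show ?case unfolding FG.seg_Suc[OF s] using assms leads_mult by blast
  next
    case (step2 j)
    have "leads (inv\<^bsub>baumslag_free\<^esub> s (j - 1)) (st j) (st (j - 1))"
      using leads_inv[OF assms[of "j - 1"]] by simp
    with step2 show ?case unfolding FG.seg_pred[OF s] using leads_mult by blast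
  qed
qed

lemma length_seg:
  assumes s: "\<And>i. s i \<in> carrier baumslag_free" and B: "\<And>i. length (s i) \<le> B"
  shows "length (FG.seg s i j) \<le> B * nat \<bar>j - i\<bar>"
proof (induction j rule: int_induct[of _ i])
  case base
  then show ?case by (simp add: FG.seg_refl[OF s])
next
  case (step1 j)
  have "length (FG.seg s i (j + 1)) \<le> length (FG.seg s i j) + length (s j)"
    unfolding FG.seg_Suc[OF s] using length_foldr_free_cons by simp
  also have "\<dots> \<le> B * nat \<bar>j - i\<bar> + B" using step1 B by (intro add_mono) auto
  also have "\<dots> = B * nat \<bar>j + 1 - i\<bar>" 
  proof -
    have "nat \<bar>j + 1 - i\<bar> = Suc (nat \<bar>j - i\<bar>)" using step1 by simp
    then show ?thesis by (simp only: mult_Suc_right add.commute)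
  qed
  finally show ?case .
next
  case (step2 j)
  have "length (FG.seg s i (j - 1)) \<le> length (FG.seg s i j) + length (inv\<^bsub>baumslag_free\<^esub> s (j - 1))"
    unfolding FG.seg_pred[OF s] using length_foldr_free_cons by simp
  also have "\<dots> \<le> B * nat \<bar>j - i\<bar> + B"
    using step2 B length_free_inv[OF s] by (intro add_mono) (auto intro: le_trans)
  also have "\<dots> = B * Suc (nat \<bar>j - i\<bar>)" by simp
  also have "Suc (nat \<bar>j - i\<bar>) = nat \<bar>j - 1 - i\<bar>" using step2 by simp
  finally show ?case .
qed

section \<open>Flats as triples of ring elements\<close>

type_synonym flat = "expansion \<times> expansion \<times> expansion"

text \<open>Expansions that are not in \<open>laurent\<close> are replaced by \<open>0\<close>, so that every triple defines a flat.\<close>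

definition trim :: "expansion \<Rightarrow> expansion" where
  "trim f = (if f \<in> laurent then f else 0)"

fun same :: "flat \<Rightarrow> flat \<Rightarrow> int \<Rightarrow> int \<Rightarrow> bool" where
  "same (f, g, h) (f', g', h') i j \<longleftrightarrow>
     near (int p) i j (trim f - trim f') (trim g - trim g') (trim h - trim h')"

text \<open>Such a \<open>c\<close> exists by \<open>near_exists\<close> and is unique modulo
  \<open>p\<close> by \<open>near_unique\<close>, so the choice is harmless, and flats related by
  \<open>same\<close> have congruent points.\<close>

definition point :: "flat \<Rightarrow> int \<Rightarrow> int \<Rightarrow> expansion" where
  "point \<phi> i j = (SOME c. c \<in> laurent \<and>
     near (int p) i j (trim (fst \<phi>) - c) (trim (fst (snd \<phi>)) - c) (trim (snd (snd \<phi>)) - c))"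

lemma point:
  "point \<phi> i j \<in> laurent"
  "near (int p) i j (trim (fst \<phi>) - point \<phi> i j) (trim (fst (snd \<phi>)) - point \<phi> i j) (trim (snd (snd \<phi>)) - point \<phi> i j)"
proof -
  have "trim f \<in> laurent" for f by (simp add: trim_def)
  then have "\<exists>c. c \<in> laurent \<and>
     near (int p) i j (trim (fst \<phi>) - c) (trim (fst (snd \<phi>)) - c) (trim (snd (snd \<phi>)) - c)"
    using near_exists[of "trim (fst \<phi>)" "trim (fst (snd \<phi>))" "trim (snd (snd \<phi>))" "int p" i j] by blast
  from someI_ex[OF this] show "point \<phi> i j \<in> laurent"
    "near (int p) i j (trim (fst \<phi>) - point \<phi> i j) (trim (fst (snd \<phi>)) - point \<phi> i j) (trim (snd (snd \<phi>)) - point \<phi> i j)"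
    unfolding point_def by auto
qed

lemma point_same:
  assumes "same \<phi> \<psi> i j"
  shows "triv (int p) (point \<phi> i j - point \<psi> i j)"
proof -
  obtain f g h f' g' h' where e: "\<phi> = (f, g, h)" "\<psi> = (f', g', h')" by (metis prod.exhaust)
  have "near (int p) i j (trim f - trim f') (trim g - trim g') (trim h - trim h')"
    using assms by (simp add: e)
  from near_diff[OF near_diff[OF this point(2)[of i j \<phi>]] near_diff[OF near_zero point(2)[of i j \<psi>]]]
  have "near (int p) i j (point \<phi> i j - point \<psi> i j) (point \<phi> i j - point \<psi> i j) (point \<phi> i j - point \<psi> i j)"
    by (simp add: e)
  then show ?thesis by (rule near_unique[OF diff_laurent[OF point(1) point(1)]])
qed

text \<open>Diagonal flats pass through every state with ring part \<open>f\<close>, so connections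
  can start and end at arbitrary states over \<open>laurent\<close>.\<close>

lemma point_diagonal:
  assumes "f \<in> laurent"
  shows "triv (int p) (point (f, f, f) i j - f)"
proof -
  have "near (int p) i j (f - point (f, f, f) i j) (f - point (f, f, f) i j) (f - point (f, f, f) i j)"
    using point(2)[of i j "(f, f, f)"] assms by (simp add: trim_def)
  then have "triv (int p) (f - point (f, f, f) i j)"
    by (rule near_unique[OF diff_laurent[OF assms point(1)]])
  then show ?thesis by (rule triv_sym)
qed

text \<open>The last letter is an inverse because \<open>step\<close> raises a coordinate on inverse
  letters.\<close>

definition edge_word :: "nat \<Rightarrow> baumslag_gen \<Rightarrow> baumslag_gen letter list" where
  "edge_word c x = replicate c (Gen_a, True) @ [(x, False)]"

lemma edge_word_closed: "x \<noteq> Gen_a \<Longrightarrow> edge_word c x \<in> carrier baumslag_free"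
proof -
  assume x: "x \<noteq> Gen_a"
  have "reduced (edge_word c x)"
  proof (induction c)
    case (Suc c)
    then show ?case using x by (cases c) (auto simp: edge_word_def inv_letter_def)
  qed (simp add: edge_word_def)
  then show ?thesis by (auto simp: free_group_carrier)
qed

lemma walk_edge_word: "walk (edge_word c x) (f, i, j) = step (x, False) (f + scale (int c) (monomial i j), i, j)"
proof -
  have "walk (replicate c (Gen_a, True) @ w) (f, i, j) = walk w (f + scale (int c) (monomial i j), i, j)" for w
  proof (induction c arbitrary: f)
    case 0
    have "f + scale 0 (monomial i j) = f" by (simp add: fun_eq_iff)
    then show ?case by simp
  next
    case (Suc c)
    have "f + monomial i j + scale (int c) (monomial i j) = f + scale (int (Suc c)) (monomial i j)"
      by (simp add: fun_eq_iff algebra_simps)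
    then show ?case using Suc[of "f + monomial i j"] by (simp only: replicate_Suc append_Cons walk_simps step.simps if_True)
  qed
  then show ?thesis by (simp add: edge_word_def)
qed

text \<open>The exponent is read off from the expansion at infinity, where the monomial \<open>t\<^sup>i u\<^sup>j\<close> has
  leading term \<open>t\<^sup>i\<^sup>+\<^sup>j\<close>.\<close>

definition digit :: "expansion \<Rightarrow> expansion \<Rightarrow> int \<Rightarrow> nat" where
  "digit f g m = nat ((g Infty m - f Infty m) mod int p)"

definition hs :: "flat \<Rightarrow> int \<Rightarrow> int \<Rightarrow> baumslag_gen letter list" where
  "hs \<phi> i j = edge_word (digit (point \<phi> i j) (point \<phi> (i + 1) j) (i + j)) Gen_t"

definition vs :: "flat \<Rightarrow> int \<Rightarrow> int \<Rightarrow> baumslag_gen letter list" where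
  "vs \<phi> i j = edge_word (digit (point \<phi> i j) (point \<phi> i (j + 1)) (i + j)) Gen_s"

lemma hs_closed: "hs \<phi> i j \<in> carrier baumslag_free"
  by (simp add: hs_def edge_word_closed)

lemma vs_closed: "vs \<phi> i j \<in> carrier baumslag_free"
  by (simp add: vs_def edge_word_closed)

lemma length_edge: "length (hs \<phi> i j) \<le> p" "length (vs \<phi> i j) \<le> p"
proof -
  have "digit f g m < p" for f g m
    using p_pos by (simp add: digit_def nat_less_iff)
  from this[THEN Suc_leI] show "length (hs \<phi> i j) \<le> p" "length (vs \<phi> i j) \<le> p"
    by (auto simp: hs_def vs_def edge_word_def)
qed

lemma digit_same:
  assumes "triv (int p) (f - f')" "triv (int p) (g - g')"
  shows "digit f g m = digit f' g' m"
proof -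
  have "int p dvd (f - f') Infty m" "int p dvd (g - g') Infty m" using assms unfolding triv_def by blast+
  from dvd_diff[OF this(2,1)] have "int p dvd (g Infty m - f Infty m) - (g' Infty m - f' Infty m)"
    by (simp add: algebra_simps)
  then have "(g Infty m - f Infty m) mod int p = (g' Infty m - f' Infty m) mod int p"
    by (simp only: mod_eq_dvd_iff)
  then show ?thesis by (simp only: digit_def)
qed

lemma edge_triv:
  assumes "f \<in> laurent" "g \<in> laurent" "ball_Infty (int p) (i + j + 1) (g - f)"
    "ball_Zero (int p) i (g - f)" "ball_MinusOne (int p) j (g - f)"
  shows "triv (int p) (f + scale (int (digit f g (i + j))) (monomial i j) - g)"
proof -
  have *: "triv (int p) ((g - f) - scale ((g - f) Infty (i + j)) (monomial i j))"
    using assms by (intro near_edge) auto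
  show ?thesis unfolding triv_def
  proof (intro allI)
    fix q n
    let ?x = "g Infty (i + j) - f Infty (i + j)" and ?m = "monomial i j q n"
    have d: "int (digit f g (i + j)) = ?x mod int p" using p_pos by (simp add: digit_def)
    have 1: "int p dvd (g - f) q n - ?x * ?m" using * unfolding triv_def by simp
    have "int p dvd ?x - ?x mod int p" by (rule dvd_minus_mod)
    then have 2: "int p dvd (?x - ?x mod int p) * ?m" by simp
    have "(f + scale (int (digit f g (i + j))) (monomial i j) - g) q n
        = - ((g - f) q n - ?x * ?m) - (?x - ?x mod int p) * ?m"
      unfolding d[symmetric] by (simp add: algebra_simps)
    then show "int p dvd (f + scale (int (digit f g (i + j))) (monomial i j) - g) q n"
      using 1 2 by (simp only: dvd_diff dvd_minus_iff)
  qed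
qed

lemma ball_mono:
  "ball_Infty q m f \<Longrightarrow> m \<le> n \<Longrightarrow> ball_Infty q n f"
  "ball_Zero q m f \<Longrightarrow> n \<le> m \<Longrightarrow> ball_Zero q n f"
  "ball_MinusOne q m f \<Longrightarrow> n \<le> m \<Longrightarrow> ball_MinusOne q n f"
  by (auto simp: ball_defs)

text \<open>Both points approximate the same triple. Moving up by one relaxes the condition at
  infinity by one and relaxes no other, which is precisely the situation of
  \<open>near_edge\<close>.\<close>

lemma point_step:
  assumes "(i', j') = (i + 1, j) \<or> (i', j') = (i, j + 1)"
  shows "ball_Infty (int p) (i + j + 1) (point \<phi> i' j' - point \<phi> i j)"
    "ball_Zero (int p) i (point \<phi> i' j' - point \<phi> i j)"
    "ball_MinusOne (int p) j (point \<phi> i' j' - point \<phi> i j)"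
proof -
  have e: "point \<phi> i' j' - point \<phi> i j = (f - point \<phi> i j) - (f - point \<phi> i' j')" for f by simp
  note n = point(2)[of i j \<phi>, unfolded near_def] point(2)[of i' j' \<phi>, unfolded near_def]
  show "ball_Infty (int p) (i + j + 1) (point \<phi> i' j' - point \<phi> i j)"
    unfolding e[of "trim (fst \<phi>)"] using n assms by - (rule ball_diff(1)[OF ball_mono(1)[where m = "i + j"] ball_mono(1)[where m = "i' + j'"]], auto)
  show "ball_Zero (int p) i (point \<phi> i' j' - point \<phi> i j)"
    unfolding e[of "trim (fst (snd \<phi>))"] using n assms by - (rule ball_diff(2)[OF ball_mono(2)[where m = "i"] ball_mono(2)[where m = "i'"]], auto)
  show "ball_MinusOne (int p) j (point \<phi> i' j' - point \<phi> i j)"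
    unfolding e[of "trim (snd (snd \<phi>))"] using n assms by - (rule ball_diff(3)[OF ball_mono(3)[where m = "j"] ball_mono(3)[where m = "j'"]], auto)
qed

lemma leads_hs: "leads (hs \<phi> i j) (point \<phi> i j, i, j) (point \<phi> (i + 1) j, i + 1, j)"
  unfolding leads_def using hs_closed edge_triv[OF point(1) point(1) point_step[of "i + 1" j i j \<phi>]]
  by (simp add: hs_def walk_edge_word del: minus_apply plus_fun_apply)

lemma leads_vs: "leads (vs \<phi> i j) (point \<phi> i j, i, j) (point \<phi> i (j + 1), i, j + 1)"
  unfolding leads_def using vs_closed edge_triv[OF point(1) point(1) point_step[of i "j + 1" i j \<phi>]]
  by (simp add: vs_def walk_edge_word del: minus_apply plus_fun_apply)

text \<open>The boundary of a unit square has four edges, each of length at most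
  \<open>p\<close>.\<close>

definition square_cost :: nat where
  "square_cost = (SOME K. \<forall>w\<in>carrier baumslag_free. length w \<le> 4 * p \<longrightarrow>
     quot p w = \<one>\<^bsub>baumslag_group p\<^esub> \<longrightarrow> fills baumslag_free (symmetrized_relators p) K w)"

sublocale flat_complex baumslag_free "symmetrized_relators p" hs vs same square_cost
proof (unfold_locales, goal_cases)
  case (1 \<phi> i j)
  show ?case by (rule hs_closed)
next
  case (2 \<phi> i j)
  show ?case by (rule vs_closed)
next
  case (3 \<phi> i j)
  let ?u = "hs \<phi> i j \<otimes>\<^bsub>baumslag_free\<^esub> vs \<phi> (i + 1) j" and ?v = "vs \<phi> i j \<otimes>\<^bsub>baumslag_free\<^esub> hs \<phi> i (j + 1)"
  have c: "?u \<in> carrier baumslag_free" "?v \<in> carrier baumslag_free"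
    by (intro FG.m_closed hs_closed vs_closed)+
  have "quot p (?u \<otimes>\<^bsub>baumslag_free\<^esub> inv\<^bsub>baumslag_free\<^esub> ?v) = \<one>\<^bsub>baumslag_group p\<^esub>"
    by (rule leads_quot[OF leads_mult[OF leads_hs leads_vs] leads_mult[OF leads_vs leads_hs]])
  moreover have "length (?u \<otimes>\<^bsub>baumslag_free\<^esub> inv\<^bsub>baumslag_free\<^esub> ?v) \<le> 4 * p"
  proof -
    have "length ?u \<le> 2 * p" "length ?v \<le> 2 * p"
      using length_foldr_free_cons[of "hs \<phi> i j" "vs \<phi> (i + 1) j"] length_foldr_free_cons[of "vs \<phi> i j" "hs \<phi> i (j + 1)"]
        length_edge[of \<phi> i j] length_edge[of \<phi> "i + 1" j] length_edge[of \<phi> i "j + 1"] by simp_all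
    then show ?thesis
      using length_foldr_free_cons[of ?u "inv\<^bsub>baumslag_free\<^esub> ?v"] length_free_inv[OF c(2)] by simp
  qed
  moreover have "?u \<otimes>\<^bsub>baumslag_free\<^esub> inv\<^bsub>baumslag_free\<^esub> ?v \<in> carrier baumslag_free"
    by (rule FG.m_closed[OF c(1) FG.inv_closed[OF c(2)]])
  ultimately have "fills baumslag_free (symmetrized_relators p) square_cost (?u \<otimes>\<^bsub>baumslag_free\<^esub> inv\<^bsub>baumslag_free\<^esub> ?v)"
    using someI_ex[OF bounded_fills[of "4 * p"]] unfolding square_cost_def by blast
  then show ?case unfolding homotopic_def using c by blast
next
  case (4 \<phi> \<psi> i j)
  then show ?case unfolding hs_def using digit_same[OF point_same point_same] by simp
next
  case (5 \<phi> \<psi> i j)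
  then show ?case unfolding vs_def using digit_same[OF point_same point_same] by simp
qed

lemma leads_leg: "leads (leg \<phi> (i, j) (i', j')) (point \<phi> i j, i, j) (point \<phi> i' j', i', j')"
proof -
  have "leads (vert \<phi> i j j') (point \<phi> i j, i, j) (point \<phi> i j', i, j')"
    unfolding vert_def by (rule leads_seg[of _ "\<lambda>j. (point \<phi> i j, i, j)"]) (rule leads_vs)
  moreover have "leads (hor \<phi> j' i i') (point \<phi> i j', i, j') (point \<phi> i' j', i', j')"
    unfolding hor_def by (rule leads_seg[of _ "\<lambda>i. (point \<phi> i j', i, j')"]) (rule leads_hs)
  ultimately show ?thesis unfolding leg_def fst_conv snd_conv by (rule leads_mult)
qed

lemma length_leg:
  assumes "\<bar>i' - i\<bar> \<le> int D" "\<bar>j' - j\<bar> \<le> int D"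
  shows "length (leg \<phi> (i, j) (i', j')) \<le> 2 * p * D"
proof -
  have "length (vert \<phi> i j j') \<le> p * nat \<bar>j' - j\<bar>" unfolding vert_def
    by (rule length_seg) (simp_all add: vs_closed length_edge)
  moreover have "length (hor \<phi> j' i i') \<le> p * nat \<bar>i' - i\<bar>" unfolding hor_def
    by (rule length_seg) (simp_all add: hs_closed length_edge)
  moreover have "p * nat \<bar>j' - j\<bar> \<le> p * D" "p * nat \<bar>i' - i\<bar> \<le> p * D" using assms by auto
  moreover have "length (leg \<phi> (i, j) (i', j')) \<le> length (vert \<phi> i j j') + length (hor \<phi> j' i i')"
    using length_foldr_free_cons[of "vert \<phi> i j j'" "hor \<phi> j' i i'"] by (simp add: leg_def)
  ultimately have "length (leg \<phi> (i, j) (i', j')) \<le> p * D + p * D" by linarith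
  then show ?thesis by simp
qed

end

section \<open>Connections through the corners of a triangle\<close>

context baumslag_filling
begin

text \<open>This is what a walk of length \<open>m\<close> between two states, one of them at \<open>(i, j)\<close>, implies for their
  expansions.\<close>

definition close :: "int \<Rightarrow> int \<Rightarrow> int \<Rightarrow> expansion \<Rightarrow> expansion \<Rightarrow> bool" where
  "close m i j f g \<longleftrightarrow> f \<in> laurent \<and> g \<in> laurent \<and> ball_Infty (int p) (i + j + m + 1) (f - g) \<and>
     ball_Zero (int p) (i - m) (f - g) \<and> ball_MinusOne (int p) (j - m) (f - g)"

lemma close_sym: "close m i j f g \<Longrightarrow> close m i j g f"
  unfolding close_def ball_defs by (simp add: dvd_diff_commute)

lemma close_refl: "f \<in> laurent \<Longrightarrow> close m i j f f"
  by (simp add: close_def ball_defs)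

lemma close_trans:
  assumes "close m i j f g" "close m i j f h"
  shows "close m i j g h"
proof -
  have e: "g - h = (f - h) - (f - g)" by simp
  show ?thesis using assms unfolding close_def e by (simp only: ball_diff)
qed

lemma close_walk:
  assumes "walk w (f, i, j) = (f', i', j')" "length w \<le> m" "f \<in> laurent"
  shows "close (int m) i j f f'"
  using walk_bound[OF assms(1,2)] walk_laurent[OF assms(1,3)] assms(3)
  by (rule_tac close_sym) (simp add: close_def)

text \<open>Each coordinate is either unchanged, or free because \<open>(x, y)\<close> lies in its
  half plane.\<close>

lemma sameI:
  assumes "close m i j f f'" "close m i j g g'" "close m i j h h'"
    and "f = f' \<or> i + j + m + 1 \<le> x + y" "g = g' \<or> x \<le> i - m" "h = h' \<or> y \<le> j - m"
  shows "same (f, g, h) (f', g', h') x y"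
proof -
  have "ball_Infty (int p) (x + y) (f - f')"
    using assms(1,4) unfolding close_def by (auto intro: ball_mono simp: ball_defs)
  moreover have "ball_Zero (int p) x (g - g')"
    using assms(2,5) unfolding close_def by (auto intro: ball_mono simp: ball_defs)
  moreover have "ball_MinusOne (int p) y (h - h')"
    using assms(3,6) unfolding close_def by (auto intro: ball_mono simp: ball_defs)
  moreover have "f \<in> laurent" "f' \<in> laurent" "g \<in> laurent" "g' \<in> laurent" "h \<in> laurent" "h' \<in> laurent"
    using assms(1-3) by (auto simp: close_def)
  ultimately show ?thesis by (simp add: trim_def near_def)
qed

text \<open>Here x, y, z are the entries of a flat at infinity, 0 and -1, and the name lists those
  that may be changed at the apex. The offsets \<open>2 * N\<close> and \<open>- N\<close> leave a
  margin \<open>N\<close> in each of the two inequalities involved.\<close>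

definition apex_xz :: "int \<Rightarrow> int \<Rightarrow> int \<Rightarrow> int \<times> int" where
  "apex_xz N i j = (i + 2 * N, j - N)"

definition apex_xy :: "int \<Rightarrow> int \<Rightarrow> int \<Rightarrow> int \<times> int" where
  "apex_xy N i j = (i - N, j + 2 * N)"

definition apex_yz :: "int \<Rightarrow> int \<Rightarrow> int \<Rightarrow> int \<times> int" where
  "apex_yz N i j = (i - N, j - N)"

lemmas apex_defs = apex_xz_def apex_xy_def apex_yz_def

text \<open>The first apex switches the entries x and z to \<open>f'\<close>, the second one the
  remaining entry y. The third apex \<open>apex_yz\<close> occurs only in fillings.\<close>

definition conn :: "int \<Rightarrow> int \<Rightarrow> int \<Rightarrow> expansion \<Rightarrow> int \<times> int \<Rightarrow> expansion \<Rightarrow> int \<times> int \<Rightarrow> baumslag_gen letter list" where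
  "conn N i j f P f' P' =
     connection (f, f, f) (f', f, f') (f', f', f') P (apex_xz N i j) (apex_xy N i j) P'"

lemma leads_cong:
  assumes "leads w (f, k, l) (g, k', l')" "triv (int p) (f' - f)" "triv (int p) (g - g')"
  shows "leads w (f', k, l) (g', k', l')"
proof -
  have 1: "leads \<one>\<^bsub>baumslag_free\<^esub> (f', k, l) (f, k, l)" "leads \<one>\<^bsub>baumslag_free\<^esub> (g, k', l') (g', k', l')"
    using assms(2,3) by (simp_all add: leads_def free_group_carrier)
  have "w \<in> carrier baumslag_free" using assms(1) by (simp add: leads_def)
  then show ?thesis
    using leads_mult[OF leads_mult[OF 1(1) assms(1)] 1(2)] FG.l_one FG.r_one by metis
qed

text \<open>The margin has to reach \<open>m + 1\<close> because of the \<open>+ 1\<close> in the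
  condition of \<open>close\<close> at infinity.\<close>

lemma leads_conn:
  assumes "close m i j f f'" "m + 1 \<le> N" "0 \<le> m"
  shows "leads (conn N i j f (k, l) f' (k', l')) (f, k, l) (f', k', l')"
proof -
  have f: "f \<in> laurent" "f' \<in> laurent" using assms by (auto simp: close_def)
  have cl: "close m i j f f'" "close m i j f f" "close m i j f' f'" using assms f close_refl by auto
  define P where "P = apex_xz N i j"
  define P' where "P' = apex_xy N i j"
  have e: "P = (fst P, snd P)" "P' = (fst P', snd P')" by simp_all
  have s1: "same (f, f, f) (f', f, f') (fst P) (snd P)"
    using cl assms(2,3) by (intro sameI[of m i j]) (auto simp: P_def apex_defs)
  have s2: "same (f', f, f') (f', f', f') (fst P') (snd P')"
    using cl assms(2,3) by (intro sameI[of m i j]) (auto simp: P'_def apex_defs)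
  have l1: "leads (leg (f, f, f) (k, l) P) (f, k, l) (point (f', f, f') (fst P) (snd P), P)"
    using leads_cong[OF leads_leg[of "(f, f, f)" k l "fst P" "snd P"] triv_sym[OF point_diagonal[OF f(1)]] point_same[OF s1]]
    by simp
  have l2: "leads (leg (f', f, f') P P') (point (f', f, f') (fst P) (snd P), P) (point (f', f', f') (fst P') (snd P'), P')"
    using leads_cong[OF leads_leg[of "(f', f, f')" "fst P" "snd P" "fst P'" "snd P'"] _ point_same[OF s2]]
    by (simp add: triv_def)
  have l3: "leads (leg (f', f', f') P' (k', l')) (point (f', f', f') (fst P') (snd P'), P') (f', k', l')"
    using leads_cong[OF leads_leg[of "(f', f', f')" "fst P'" "snd P'" k' l'] _ point_diagonal[OF f(2)]]
    by (simp add: triv_def)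
  show ?thesis unfolding conn_def connection_def P_def[symmetric] P'_def[symmetric]
    by (rule leads_mult[OF leads_mult[OF l1 l2] l3])
qed

lemma length_conn:
  assumes "in_box D {(k, l), apex_xz N i j, apex_xy N i j, (k', l')}"
  shows "length (conn N i j f (k, l) f' (k', l')) \<le> 6 * p * D"
proof -
  define P where "P = apex_xz N i j"
  define P' where "P' = apex_xy N i j"
  note b = in_boxD[OF assms, folded P_def P'_def]
  have leg: "length (leg \<phi> A B) \<le> 2 * p * D" if "A \<in> {(k, l), P, P', (k', l')}" "B \<in> {(k, l), P, P', (k', l')}" for \<phi> A B
    using length_leg[of "fst B" "fst A" D "snd B" "snd A" \<phi>] b[OF that(2,1)] by simp
  have "length (conn N i j f (k, l) f' (k', l')) \<le> length (leg (f, f, f) (k, l) P) + length (leg (f', f, f') P P')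
      + length (leg (f', f', f') P' (k', l'))"
    unfolding conn_def connection_def P_def[symmetric] P'_def[symmetric] free_group_simps
    using length_foldr_free_cons[of "foldr free_cons (leg (f, f, f) (k, l) P) (leg (f', f, f') P P')" "leg (f', f', f') P' (k', l')"]
      length_foldr_free_cons[of "leg (f, f, f) (k, l) P" "leg (f', f, f') P P'"] by linarith
  also have "\<dots> \<le> 2 * p * D + 2 * p * D + 2 * p * D" by (intro add_mono leg) auto
  finally show ?thesis by (simp add: ac_simps)
qed

lemma in_boxI:
  assumes "\<And>S. S \<in> A \<Longrightarrow> a \<le> fst S \<and> fst S \<le> a + int D \<and> b \<le> snd S \<and> snd S \<le> b + int D"
  shows "in_box D A"
  unfolding in_box_def
proof (intro ballI)
  fix S S' assume "S \<in> A" "S' \<in> A"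
  from this[THEN assms] show "\<bar>fst S - fst S'\<bar> \<le> int D \<and> \<bar>snd S - snd S'\<bar> \<le> int D" by linarith
qed

text \<open>Recentres and enlarges the triangle of a subword to that of the whole word. The
  condition \<open>m' + d \<le> m\<close> keeps the legs between old and new apexes in the half
  planes that are free for \<open>f\<close> and \<open>f'\<close>.\<close>

lemma conn_change:
  assumes cl: "close m' i' j' f f'" and m: "1 \<le> m'" "m' + d \<le> m" and d: "\<bar>i' - i\<bar> + \<bar>j' - j\<bar> \<le> d"
    and P: "\<bar>fst P - i\<bar> \<le> m" "\<bar>snd P - j\<bar> \<le> m" and P': "\<bar>fst P' - i\<bar> \<le> m" "\<bar>snd P' - j\<bar> \<le> m"
  shows "homotopic (4 * (square_cost * nat (6 * m) * nat (6 * m)))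
    (conn (2 * m') i' j' f P f' P') (conn (2 * m) i j f P f' P')"
  unfolding conn_def
proof (rule connection_change)
  have n: "int (nat (6 * m)) = 6 * m" using m d by linarith
  have dd: "i' - i \<le> d" "i - i' \<le> d" "j' - j \<le> d" "j - j' \<le> d" "i' + j' \<le> i + j + d" "0 \<le> d"
    using d by linarith+
  note b = P[unfolded abs_le_iff] P'[unfolded abs_le_iff]
  show "in_box (nat (6 * m)) {P, P', apex_xz (2 * m') i' j', apex_xy (2 * m') i' j',
      apex_xz (2 * m) i j, apex_xy (2 * m) i j}"
  \<comment> \<open>With \<open>N = 2 * m\<close> the apexes have offsets between
    \<open>- 2 * m\<close> and \<open>4 * m\<close>, so the box has side
    \<open>6 * m\<close>.\<close>
  proof (rule in_boxI[of _ "i - 2 * m" _ "j - 2 * m"])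
    fix S assume "S \<in> {P, P', apex_xz (2 * m') i' j', apex_xy (2 * m') i' j', apex_xz (2 * m) i j, apex_xy (2 * m) i j}"
    then consider "S = P" | "S = P'" | "S = (i' + 4 * m', j' - 2 * m')" | "S = (i' - 2 * m', j' + 4 * m')"
      | "S = (i + 4 * m, j - 2 * m)" | "S = (i - 2 * m, j + 4 * m)"
      by (auto simp: apex_defs)
    then show "i - 2 * m \<le> fst S \<and> fst S \<le> i - 2 * m + int (nat (6 * m)) \<and>
        j - 2 * m \<le> snd S \<and> snd S \<le> j - 2 * m + int (nat (6 * m))"
      unfolding n using m dd b by cases auto
  qed
  have f: "f \<in> laurent" "f' \<in> laurent" using cl by (auto simp: close_def)
  have c: "close m' i' j' f f'" "close m' i' j' f f" "close m' i' j' f' f'" using cl f close_refl by auto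
  show "same_leg (f, f, f) (f', f, f') (apex_xz (2 * m) i j) (apex_xz (2 * m') i' j')"
    unfolding same_leg_def apex_defs fst_conv snd_conv
    using m dd by (intro conjI allI impI; intro sameI[OF c(1) c(2) c(1)])
      ((rule disjI1, rule refl | rule disjI2, linarith)+)
  show "same_leg (f', f, f') (f', f', f') (apex_xy (2 * m') i' j') (apex_xy (2 * m) i j)"
    unfolding same_leg_def apex_defs fst_conv snd_conv
    using m dd by (intro conjI allI impI; intro sameI[OF c(3) c(1) c(3)])
      ((rule disjI1, rule refl | rule disjI2, linarith)+)
qed

lemma conn_triangle:
  assumes c: "close m i j f g" "close m i j f h" and m: "1 \<le> m"
    and P: "\<bar>fst P - i\<bar> \<le> m" "\<bar>snd P - j\<bar> \<le> m" and P': "\<bar>fst P' - i\<bar> \<le> m" "\<bar>snd P' - j\<bar> \<le> m"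
    and P'': "\<bar>fst P'' - i\<bar> \<le> m" "\<bar>snd P'' - j\<bar> \<le> m"
  shows "homotopic (6 * (square_cost * nat (6 * m) * nat (6 * m)))
    (conn (2 * m) i j f P g P' \<otimes>\<^bsub>baumslag_free\<^esub> conn (2 * m) i j g P' h P'') (conn (2 * m) i j f P h P'')"
  unfolding conn_def
\<comment> \<open>These are the flats of the loop with first entry reset to \<open>f\<close>. In the
  cyclic order \<open>(f, f, g)\<close>, \<open>(f, g, g)\<close>, \<open>(f, g, h)\<close>,
  \<open>(f, f, h)\<close> neighbours differ in at most one of the last two entries, alternately the
  second and the third.\<close>
proof (rule connection_triangle[where C = "apex_yz (2 * m) i j" and \<xi>\<^sub>0\<^sub>1 = "(f, f, g)" and \<xi>\<^sub>1\<^sub>1 = "(f, g, g)"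
      and \<xi>\<^sub>1\<^sub>2 = "(f, g, h)" and \<xi>\<^sub>0\<^sub>2 = "(f, f, h)"])
  have n: "int (nat (6 * m)) = 6 * m" using m by linarith
  note b = P[unfolded abs_le_iff] P'[unfolded abs_le_iff] P''[unfolded abs_le_iff]
  have l: "f \<in> laurent" "g \<in> laurent" "h \<in> laurent" using c by (auto simp: close_def)
  have cl: "close m i j a b" if "a \<in> {f, g, h}" "b \<in> {f, g, h}" for a b
  proof -
    have "close m i j f a" "close m i j f b" using that c close_refl[OF l(1)] by auto
    then show ?thesis by (rule close_trans)
  qed
  show "in_box (nat (6 * m)) {P, P', P'', apex_xz (2 * m) i j, apex_xy (2 * m) i j, apex_yz (2 * m) i j}"
  proof (rule in_boxI[of _ "i - 2 * m" _ "j - 2 * m"])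
    fix S assume "S \<in> {P, P', P'', apex_xz (2 * m) i j, apex_xy (2 * m) i j, apex_yz (2 * m) i j}"
    then consider "S = P" | "S = P'" | "S = P''" | "S = (i + 4 * m, j - 2 * m)" | "S = (i - 2 * m, j + 4 * m)"
      | "S = (i - 2 * m, j - 2 * m)"
      by (auto simp: apex_defs)
    then show "i - 2 * m \<le> fst S \<and> fst S \<le> i - 2 * m + int (nat (6 * m)) \<and>
        j - 2 * m \<le> snd S \<and> snd S \<le> j - 2 * m + int (nat (6 * m))"
      unfolding n using m b by cases auto
  qed
  have xz_xy: "same_leg (a, b, c) (d, b, c) (apex_xz (2 * m) i j) (apex_xy (2 * m) i j)"
    if "a \<in> {f, g, h}" "b \<in> {f, g, h}" "c \<in> {f, g, h}" "d \<in> {f, g, h}" for a b c d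
    unfolding same_leg_def apex_defs fst_conv snd_conv using m
    by (intro conjI allI impI; intro sameI[OF cl[OF that(1,4)] cl[OF that(2,2)] cl[OF that(3,3)]])
      ((rule disjI1, rule refl | rule disjI2, linarith)+)
  have xz_yz: "same_leg (a, b, c) (a, b, d) (apex_xz (2 * m) i j) (apex_yz (2 * m) i j)"
    if "a \<in> {f, g, h}" "b \<in> {f, g, h}" "c \<in> {f, g, h}" "d \<in> {f, g, h}" for a b c d
    unfolding same_leg_def apex_defs fst_conv snd_conv using m
    by (intro conjI allI impI; intro sameI[OF cl[OF that(1,1)] cl[OF that(2,2)] cl[OF that(3,4)]])
      ((rule disjI1, rule refl | rule disjI2, linarith)+)
  have yz_xy: "same_leg (a, b, c) (a, d, c) (apex_yz (2 * m) i j) (apex_xy (2 * m) i j)"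
    if "a \<in> {f, g, h}" "b \<in> {f, g, h}" "c \<in> {f, g, h}" "d \<in> {f, g, h}" for a b c d
    unfolding same_leg_def apex_defs fst_conv snd_conv using m
    by (intro conjI allI impI; intro sameI[OF cl[OF that(1,1)] cl[OF that(2,4)] cl[OF that(3,3)]])
      ((rule disjI1, rule refl | rule disjI2, linarith)+)
  show "same_leg (g, f, g) (f, f, g) (apex_xz (2 * m) i j) (apex_xy (2 * m) i j)" by (rule xz_xy) simp_all
  show "same_leg (g, g, g) (f, g, g) (apex_xz (2 * m) i j) (apex_xy (2 * m) i j)" by (rule xz_xy) simp_all
  show "same_leg (h, g, h) (f, g, h) (apex_xz (2 * m) i j) (apex_xy (2 * m) i j)" by (rule xz_xy) simp_all
  show "same_leg (h, f, h) (f, f, h) (apex_xz (2 * m) i j) (apex_xy (2 * m) i j)" by (rule xz_xy) simp_all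
  show "same_leg (f, f, g) (f, f, h) (apex_xz (2 * m) i j) (apex_yz (2 * m) i j)" by (rule xz_yz) simp_all
  show "same_leg (f, f, g) (f, g, g) (apex_yz (2 * m) i j) (apex_xy (2 * m) i j)" by (rule yz_xy) simp_all
  show "same_leg (f, g, g) (f, g, h) (apex_xz (2 * m) i j) (apex_yz (2 * m) i j)" by (rule xz_yz) simp_all
  show "same_leg (f, g, h) (f, f, h) (apex_yz (2 * m) i j) (apex_xy (2 * m) i j)" by (rule yz_xy) simp_all
qed


section \<open>Filling a word by repeated halving\<close>

lemma dyadic_arith:
  fixes E C m :: nat
  assumes "2 \<le> m" "3 * E \<le> C"
  shows "C * (m div 2)\<^sup>2 + C * (m - m div 2)\<^sup>2 + E * m\<^sup>2 \<le> C * m\<^sup>2"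
proof -
  define a where "a = m div 2"
  define b where "b = m - m div 2"
  have m: "m = a + b" by (simp add: a_def b_def)
  have ab: "1 \<le> a" "a \<le> b" "b \<le> a + 1" using assms by (auto simp: a_def b_def)
  have "b = a \<or> b = a + 1" using ab by linarith
  \<comment> \<open>Halving saves \<open>2 * C * a * b\<close>. This pays for \<open>E * m^2\<close>
    as soon as \<open>3 * E \<le> C\<close>, since nearly equal halves satisfy
    \<open>m^2 <= 6 * a * b\<close>.\<close>
  then have "m\<^sup>2 \<le> 6 * (a * b)"
  proof
    assume "b = a + 1"
    moreover have "1 \<le> a * a" using ab(1) by (cases a) auto
    ultimately show ?thesis by (simp add: m power2_eq_square algebra_simps)
  qed (simp add: m power2_eq_square algebra_simps)
  then have "E * m\<^sup>2 \<le> (3 * E) * (2 * (a * b))" by (simp add: mult.left_commute)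
  also have "\<dots> \<le> C * (2 * (a * b))" using assms(2) by (rule mult_le_mono1)
  finally show ?thesis unfolding a_def[symmetric] b_def[symmetric]
    by (simp add: m power2_eq_square algebra_simps)
qed

definition reduce :: "baumslag_gen letter list \<Rightarrow> baumslag_gen letter list" where
  "reduce w = foldr free_cons w []"

lemma reduce_closed: "reduce w \<in> carrier baumslag_free"
  unfolding reduce_def free_group_carrier by (simp add: reduced_foldr foldr_in_lists)

lemma reduce_append: "reduce (u @ v) = reduce u \<otimes>\<^bsub>baumslag_free\<^esub> reduce v"
  by (simp add: reduce_def foldr_free_cons_assoc reduced_foldr)

lemma walk_append: "walk (u @ v) st = walk v (walk u st)"
  by (simp add: walk_def)

lemma letter_conn: "\<exists>B. \<forall>w f i j f' i' j'. length w = 1 \<longrightarrow> f \<in> laurent \<longrightarrow> walk w (f, i, j) = (f', i', j') \<longrightarrow>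
    homotopic B (reduce w) (conn 2 i j f (i, j) f' (i', j'))"
proof -
  \<comment> \<open>One letter plus a connection in a box of side 6, whose length is at most
    \<open>6 * p * 6\<close>.\<close>
  obtain B where B: "\<And>w. w \<in> carrier baumslag_free \<Longrightarrow> length w \<le> 1 + 6 * p * 6 \<Longrightarrow>
      quot p w = \<one>\<^bsub>baumslag_group p\<^esub> \<Longrightarrow> fills baumslag_free (symmetrized_relators p) B w"
    using bounded_fills by meson
  have "homotopic B (reduce w) (conn 2 i j f (i, j) f' (i', j'))"
    if w: "length w = 1" "f \<in> laurent" "walk w (f, i, j) = (f', i', j')" for w f i j f' i' j'
  proof -
    let ?c = "conn 2 i j f (i, j) f' (i', j')"
    have "close 1 i j f f'" using close_walk[OF w(3), of 1] w by simp
    then have "leads ?c (f, i, j) (f', i', j')" by (intro leads_conn) auto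
    moreover have "leads (reduce w) (f, i, j) (f', i', j')"
      unfolding leads_def using reduce_closed w(3) by (simp add: reduce_def triv_def)
    ultimately have q: "quot p (reduce w \<otimes>\<^bsub>baumslag_free\<^esub> inv\<^bsub>baumslag_free\<^esub> ?c) = \<one>\<^bsub>baumslag_group p\<^esub>"
      by (rule_tac leads_quot)
    have c: "?c \<in> carrier baumslag_free" using \<open>leads ?c _ _\<close> by (simp add: leads_def)
    have b: "\<bar>i' - i\<bar> \<le> 1" "\<bar>j' - j\<bar> \<le> 1" using walk_bound(1)[OF w(3), of 1] w(1) by auto
    have "in_box 6 {(i, j), apex_xz 2 i j, apex_xy 2 i j, (i', j')}"
      using b by (intro in_boxI[of _ "i - 2" _ "j - 2"]) (auto simp: apex_defs)
    then have "length ?c \<le> 6 * p * 6" by (rule length_conn)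
    moreover have "length (reduce w) \<le> 1" using length_foldr_free_cons[of w "[]"] w(1) by (simp add: reduce_def)
    ultimately have "length (reduce w \<otimes>\<^bsub>baumslag_free\<^esub> inv\<^bsub>baumslag_free\<^esub> ?c) \<le> 1 + 6 * p * 6"
      using length_foldr_free_cons[of "reduce w" "inv\<^bsub>baumslag_free\<^esub> ?c"] length_free_inv[OF c]
      unfolding free_group_simps by linarith
    from B[OF FG.m_closed[OF reduce_closed FG.inv_closed[OF c]] this q]
    show ?thesis unfolding homotopic_def using reduce_closed c by blast
  qed
  then show ?thesis by blast
qed

lemma walk_conn: "\<exists>C. \<forall>w f i j f' i' j'. w \<noteq> [] \<longrightarrow> f \<in> laurent \<longrightarrow> walk w (f, i, j) = (f', i', j') \<longrightarrow>
    homotopic (C * (length w)\<^sup>2) (reduce w) (conn (2 * int (length w)) i j f (i, j) f' (i', j'))"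
proof -
  obtain B where B: "\<And>w f i j f' i' j'. length w = 1 \<Longrightarrow> f \<in> laurent \<Longrightarrow> walk w (f, i, j) = (f', i', j') \<Longrightarrow>
    homotopic B (reduce w) (conn 2 i j f (i, j) f' (i', j'))"
    using letter_conn by blast
  \<comment> \<open>\<open>504 = (4 + 4 + 6) * 36\<close>: two applications of
    \<open>conn_change\<close> and one of \<open>conn_triangle\<close>, each in a box of side
    \<open>6 * m\<close>.\<close>
  define E where "E = 504 * square_cost"
  \<comment> \<open>\<open>3 * E\<close> is demanded by \<open>dyadic_arith\<close>, and
    \<open>B\<close> covers single letters.\<close>
  define C where "C = 3 * E + B"
  have "homotopic (C * (length w)\<^sup>2) (reduce w) (conn (2 * int (length w)) i j f (i, j) f' (i', j'))"
    if "w \<noteq> []" "f \<in> laurent" "walk w (f, i, j) = (f', i', j')" for w f i j f' i' j'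
    using that
  proof (induction "length w" arbitrary: w f i j f' i' j' rule: less_induct)
    case less
    show ?case
    proof (cases "length w = 1")
      case True
      from B[OF this less.prems(2,3)] have "homotopic C (reduce w) (conn 2 i j f (i, j) f' (i', j'))"
        by (rule homotopic_mono) (simp add: C_def)
      then show ?thesis using True by simp
    next
      case False
      define m where "m = length w"
      define u where "u = take (m div 2) w"
      define v where "v = drop (m div 2) w"
      have m: "2 \<le> m" using False less.prems(1) by (cases w) (auto simp: m_def Suc_le_eq)
      have uv: "w = u @ v" "length u = m div 2" "length v = m - m div 2" "u \<noteq> []" "v \<noteq> []"
        "length u < length w" "length v < length w"
        using m by (auto simp: u_def v_def m_def)
      obtain g k l where g: "walk u (f, i, j) = (g, k, l)" by (metis prod.exhaust)
      have v: "walk v (g, k, l) = (f', i', j')" using less.prems(3) g by (simp add: uv(1) walk_append)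
      have gl: "g \<in> laurent" using walk_laurent[OF g less.prems(2)] .
      let ?M = "int m" and ?U = "int (length u)" and ?V = "int (length v)"
      have M: "?M = ?U + ?V" "1 \<le> ?U" "1 \<le> ?V" using uv m by auto
      have kl: "\<bar>k - i\<bar> + \<bar>l - j\<bar> \<le> ?U" using walk_bound(1)[OF g order_refl] .
      have ij': "\<bar>i' - i\<bar> + \<bar>j' - j\<bar> \<le> ?M" using walk_bound(1)[OF less.prems(3), of m] by (simp add: m_def)
      let ?D = "square_cost * nat (6 * ?M) * nat (6 * ?M)"
      have hu: "homotopic (C * (length u)\<^sup>2) (reduce u) (conn (2 * ?U) i j f (i, j) g (k, l))"
        using uv g less.prems(2) by (intro less.hyps) auto
      have hv: "homotopic (C * (length v)\<^sup>2) (reduce v) (conn (2 * ?V) k l g (k, l) f' (i', j'))"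
        using uv v gl by (intro less.hyps) auto
      have cu: "homotopic (4 * ?D) (conn (2 * ?U) i j f (i, j) g (k, l)) (conn (2 * ?M) i j f (i, j) g (k, l))"
        using M kl by (intro conn_change[OF close_walk[OF g order_refl less.prems(2)], of 0]) auto
      \<comment> \<open>The second half starts at distance at most the length of \<open>u\<close>
        from \<open>(i, j)\<close>, so its own length plus this displacement is exactly
        \<open>m\<close>.\<close>
      have cv: "homotopic (4 * ?D) (conn (2 * ?V) k l g (k, l) f' (i', j')) (conn (2 * ?M) i j g (k, l) f' (i', j'))"
        using M kl ij' by (intro conn_change[OF close_walk[OF v order_refl gl], of ?U]) auto
      have "close ?M i j f g" "close ?M i j f f'"
        using uv(2) by (intro close_walk[OF g _ less.prems(2)] close_walk[OF less.prems(3) _ less.prems(2)];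
          simp only: m_def[symmetric] div_le_dividend order_refl)+
      then have t: "homotopic (6 * ?D) (conn (2 * ?M) i j f (i, j) g (k, l) \<otimes>\<^bsub>baumslag_free\<^esub> conn (2 * ?M) i j g (k, l) f' (i', j'))
          (conn (2 * ?M) i j f (i, j) f' (i', j'))"
        using M kl ij' by (intro conn_triangle) auto
      from homotopic_trans[OF homotopic_mult[OF homotopic_trans[OF hu cu] homotopic_trans[OF hv cv]] t]
      have h: "homotopic (C * (length u)\<^sup>2 + 4 * ?D + (C * (length v)\<^sup>2 + 4 * ?D) + 6 * ?D) (reduce w)
          (conn (2 * ?M) i j f (i, j) f' (i', j'))"
        unfolding uv(1) reduce_append .
      have "14 * ?D = E * m\<^sup>2" by (simp add: E_def nat_mult_distrib power2_eq_square)
      then have "C * (length u)\<^sup>2 + 4 * ?D + (C * (length v)\<^sup>2 + 4 * ?D) + 6 * ?D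
          = C * (m div 2)\<^sup>2 + C * (m - m div 2)\<^sup>2 + E * m\<^sup>2"
        unfolding uv(2,3) by linarith
      also have "\<dots> \<le> C * m\<^sup>2" using m by (intro dyadic_arith) (auto simp: C_def)
      finally show ?thesis using homotopic_mono[OF h] by (simp add: m_def)
    qed
  qed
  then show ?thesis by blast
qed

theorem quadratic_filling:
  "\<exists>C. \<forall>w\<in>carrier baumslag_free. quot p w = \<one>\<^bsub>baumslag_group p\<^esub> \<longrightarrow>
     fills baumslag_free (symmetrized_relators p) (C * (length w)\<^sup>2 + C) w"
proof -
  obtain C where C: "\<And>w f i j f' i' j'. w \<noteq> [] \<Longrightarrow> f \<in> laurent \<Longrightarrow> walk w (f, i, j) = (f', i', j') \<Longrightarrow>
    homotopic (C * (length w)\<^sup>2) (reduce w) (conn (2 * int (length w)) i j f (i, j) f' (i', j'))"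
    using walk_conn by blast
  define C' where "C' = C + 72 * square_cost"
  have "fills baumslag_free (symmetrized_relators p) (C' * (length w)\<^sup>2 + C') w"
    if w: "w \<in> carrier baumslag_free" "quot p w = \<one>\<^bsub>baumslag_group p\<^esub>" for w
  proof (cases "w = []")
    case True
    then show ?thesis using FG.fills_one by simp
  next
    case False
    define m where "m = length w"
    have m: "1 \<le> m" using False by (cases w) (auto simp: m_def)
    obtain k where "fills baumslag_free (symmetrized_relators p) k w" using quot_kernel[OF w(1)] w(2) by blast
    then obtain g where g: "walk w (0, 0, 0) = (g, 0, 0)" "triv (int p) (g - 0)" using fills_walk by blast
    have gl: "g \<in> laurent" using walk_laurent[OF g(1)] by simp
    have triv: "triv (int p) (a - b)" "trim a = a" if "a \<in> {0, g}" "b \<in> {0, g}" for a b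
      using that g(2) gl by (auto simp: triv_def trim_def)
    \<comment> \<open>Since \<open>g\<close> vanishes modulo \<open>p\<close>, all flats with
      entries 0 and \<open>g\<close> carry the same words. The connection from 0 to \<open>g\<close>
      thus lies in one flat, where \<open>connection_self\<close> fills it.\<close>
    have same: "same (a, b, c) (a', b', c') x y"
      if "a \<in> {0, g}" "a' \<in> {0, g}" "b \<in> {0, g}" "b' \<in> {0, g}" "c \<in> {0, g}" "c' \<in> {0, g}" for a b c a' b' c' x y
      using triv[OF that(1,2)] triv[OF that(2,1)] triv[OF that(3,4)] triv[OF that(4,3)] triv[OF that(5,6)] triv[OF that(6,5)]
      unfolding same.simps near_def ball_defs triv_def by metis
    let ?P = "apex_xz (2 * int m) 0 0" and ?P' = "apex_xy (2 * int m) 0 0"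
    have leg: "leg (a, b, c) A A' = leg (0, 0, 0) A A'" if "a \<in> {0, g}" "b \<in> {0, g}" "c \<in> {0, g}" for a b c A A'
      by (rule leg_same, unfold same_leg_def, intro conjI allI impI) (rule same; use that in blast)+
    have "conn (2 * int m) 0 0 0 (0, 0) g (0, 0) = connection (0, 0, 0) (0, 0, 0) (0, 0, 0) (0, 0) ?P ?P' (0, 0)"
      unfolding conn_def connection_def leg[of g 0 g, simplified] leg[of g g g, simplified] ..
    moreover have "homotopic (2 * (square_cost * (6 * m) * (6 * m))) (connection (0, 0, 0) (0, 0, 0) (0, 0, 0) (0, 0) ?P ?P' (0, 0)) \<one>\<^bsub>baumslag_free\<^esub>"
      by (rule connection_self) (auto simp: apex_defs)
    moreover have "homotopic (C * m\<^sup>2) (reduce w) (conn (2 * int m) 0 0 0 (0, 0) g (0, 0))"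
      unfolding m_def using False g(1) by (intro C) auto
    ultimately have "homotopic (C * m\<^sup>2 + 2 * (square_cost * (6 * m) * (6 * m))) (reduce w) \<one>\<^bsub>baumslag_free\<^esub>"
      using homotopic_trans by metis
    moreover have "reduce w = w" using w(1) by (simp add: reduce_def free_group_carrier foldr_free_cons_Nil)
    ultimately have "fills baumslag_free (symmetrized_relators p) (C * m\<^sup>2 + 2 * (square_cost * (6 * m) * (6 * m))) w"
      by (simp only: homotopic_one_iff)
    moreover have "C * m\<^sup>2 + 2 * (square_cost * (6 * m) * (6 * m)) \<le> C' * m\<^sup>2 + C'"
      by (simp add: C'_def power2_eq_square algebra_simps)
    ultimately show ?thesis unfolding m_def by (rule FG.fills_mono)
  qed
  then show ?thesis by blast
qed

end

section \<open>The lower bound\<close>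

text \<open>Relations of \<open>\<int>\<^sup>2\<close> lift to central elements of the Heisenberg group. A conjugate of a short
  relation contributes a bounded amount to the centre, while the commutator of \<open>t\<^sup>n\<close> and \<open>s\<^sup>n\<close>
  contributes about \<open>n\<^sup>2\<close>.\<close>

definition heis :: "(int \<times> int \<times> int) monoid" where
  "heis = \<lparr>carrier = UNIV, monoid.mult = (\<lambda>(x, y, z) (x', y', z'). (x + x', y + y', z + z' + x * y')),
     one = (0, 0, 0)\<rparr>"

lemma heis_simps [simp]:
  "carrier heis = UNIV" "\<one>\<^bsub>heis\<^esub> = (0, 0, 0)"
  "(x, y, z) \<otimes>\<^bsub>heis\<^esub> (x', y', z') = (x + x', y + y', z + z' + x * y')"
  by (simp_all add: heis_def)

lemma group_heis: "group heis"
proof (rule groupI)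
  fix g h k :: "int \<times> int \<times> int"
  show "g \<otimes>\<^bsub>heis\<^esub> h \<otimes>\<^bsub>heis\<^esub> k = g \<otimes>\<^bsub>heis\<^esub> (h \<otimes>\<^bsub>heis\<^esub> k)"
    by (cases g; cases h; cases k) (simp add: algebra_simps)
  show "\<one>\<^bsub>heis\<^esub> \<otimes>\<^bsub>heis\<^esub> g = g" by (cases g) simp
  obtain x y z where "g = (x, y, z)" by (cases g)
  then show "\<exists>h\<in>carrier heis. h \<otimes>\<^bsub>heis\<^esub> g = \<one>\<^bsub>heis\<^esub>"
    by (intro bexI[of _ "(- x, - y, x * y - z)"]) simp_all
qed simp_all

interpretation H: group heis
  by (rule group_heis)

lemma heis_inv: "inv\<^bsub>heis\<^esub> (x, y, z) = (- x, - y, x * y - z)"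
  by (rule H.inv_equality) simp_all

lemma heis_pow:
  "(x, 0, z) [^]\<^bsub>heis\<^esub> n = (int n * x, 0, int n * z)" "(0, y, z) [^]\<^bsub>heis\<^esub> n = (0, int n * y, int n * z)"
  by (induction n) (simp_all add: algebra_simps)

text \<open>A lift of the quotient map onto \<open>Z^2\<close> that kills \<open>a\<close>.\<close>

definition heis_gen :: "baumslag_gen \<Rightarrow> int \<times> int \<times> int" where
  "heis_gen = case_baumslag_gen (0, 0, 0) (0, 1, 0) (1, 0, 0)"

definition heis_map :: "baumslag_gen letter list \<Rightarrow> int \<times> int \<times> int" where
  "heis_map = free_lift heis heis_gen"

lemma heis_map_hom: "heis_map \<in> hom baumslag_free heis"
  unfolding heis_map_def by (rule H.free_lift_hom) simp

interpretation hm: group_hom baumslag_free heis heis_map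
  by unfold_locales (rule heis_map_hom)

definition central :: "int \<times> int \<times> int \<Rightarrow> bool" where
  "central g \<longleftrightarrow> (\<exists>z. g = (0, 0, z))"

lemma central_simps: "central (x, y, z) \<longleftrightarrow> x = 0 \<and> y = 0"
  by (auto simp: central_def)

lemma central_commutator: "central (commutator heis g h)"
  by (cases g; cases h) (simp add: commutator_def heis_inv central_simps)

lemma central_conj: "central g \<Longrightarrow> h \<otimes>\<^bsub>heis\<^esub> g \<otimes>\<^bsub>heis\<^esub> inv\<^bsub>heis\<^esub> h = g"
  by (cases g; cases h) (simp add: heis_inv central_simps)

lemma central_mult: "central g \<Longrightarrow> central h \<Longrightarrow> central (g \<otimes>\<^bsub>heis\<^esub> h)"
  by (cases g; cases h) (simp add: central_simps)

lemma central_inv: "central g \<Longrightarrow> central (inv\<^bsub>heis\<^esub> g)"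
  by (cases g) (simp add: heis_inv central_simps)

lemma heis_map_gen: "heis_map (free_gen x) = heis_gen x"
  using H.r_one[of "heis_gen x"] by (simp add: heis_map_def free_gen_def del: H.r_one)

lemma heis_map_relator:
  assumes "r \<in> baumslag_relators p"
  shows "central (heis_map r)"
proof -
  let ?F = baumslag_free
  define a where "a = (free_gen Gen_a :: baumslag_gen letter list)"
  define s where "s = (free_gen Gen_s :: baumslag_gen letter list)"
  define t where "t = (free_gen Gen_t :: baumslag_gen letter list)"
  have c: "a \<in> carrier ?F" "s \<in> carrier ?F" "t \<in> carrier ?F"
    by (simp_all add: a_def s_def t_def free_gen_closed)
  have ha: "heis_map a = \<one>\<^bsub>heis\<^esub>" by (simp add: a_def heis_map_gen heis_gen_def)
  have q: "heis_map (x \<otimes>\<^bsub>?F\<^esub> y) = heis_map x \<otimes>\<^bsub>heis\<^esub> heis_map y"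
    "heis_map (inv\<^bsub>?F\<^esub> x) = inv\<^bsub>heis\<^esub> heis_map x" if "x \<in> carrier ?F" "y \<in> carrier ?F" for x y
    using that hm.hom_mult hm.hom_inv by blast+
  have comm: "heis_map (commutator ?F x y) = commutator heis (heis_map x) (heis_map y)"
    if "x \<in> carrier ?F" "y \<in> carrier ?F" for x y
    using that by (simp only: commutator_def q FG.m_closed FG.inv_closed)
  have cj: "conj_by ?F x y \<in> carrier ?F" if "x \<in> carrier ?F" "y \<in> carrier ?F" for x y
    unfolding conj_by_def using that by (intro FG.m_closed FG.inv_closed)
  have conj: "heis_map (conj_by ?F a x) = \<one>\<^bsub>heis\<^esub>" if "x \<in> carrier ?F" for x
  proof -
    have "heis_map (conj_by ?F a x) = inv\<^bsub>heis\<^esub> heis_map x \<otimes>\<^bsub>heis\<^esub> \<one>\<^bsub>heis\<^esub> \<otimes>\<^bsub>heis\<^esub> heis_map x"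
      using that c by (simp only: conj_by_def q FG.m_closed FG.inv_closed ha)
    also have "\<dots> = \<one>\<^bsub>heis\<^esub>" by (cases "heis_map x") (simp add: heis_inv)
    finally show ?thesis .
  qed
  have "r = a [^]\<^bsub>?F\<^esub> p \<or> r = commutator ?F s t \<or> r = commutator ?F (conj_by ?F a t) a \<or>
      r = conj_by ?F a s \<otimes>\<^bsub>?F\<^esub> inv\<^bsub>?F\<^esub> (conj_by ?F a t \<otimes>\<^bsub>?F\<^esub> a)"
    using assms unfolding baumslag_relators_def Let_def a_def s_def t_def by blast
  then show ?thesis
  proof (elim disjE)
    assume "r = a [^]\<^bsub>?F\<^esub> p"
    then have "heis_map r = \<one>\<^bsub>heis\<^esub> [^]\<^bsub>heis\<^esub> p" using hm.hom_nat_pow[OF c(1)] ha by simp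
    then have "heis_map r = \<one>\<^bsub>heis\<^esub>" using H.nat_pow_one by metis
    then show ?thesis by (simp add: central_simps)
  next
    assume "r = conj_by ?F a s \<otimes>\<^bsub>?F\<^esub> inv\<^bsub>?F\<^esub> (conj_by ?F a t \<otimes>\<^bsub>?F\<^esub> a)"
    then have "heis_map r = \<one>\<^bsub>heis\<^esub> \<otimes>\<^bsub>heis\<^esub> inv\<^bsub>heis\<^esub> (\<one>\<^bsub>heis\<^esub> \<otimes>\<^bsub>heis\<^esub> \<one>\<^bsub>heis\<^esub>)"
      using c by (simp only: q cj FG.m_closed FG.inv_closed conj ha)
    then show ?thesis by (simp add: central_simps heis_inv)
  qed (use c cj comm central_commutator in auto)
qed

text \<open>The relators become central, and conjugation does not move central elements, so every
  product of their conjugates is central.\<close>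

lemma heis_map_kernel:
  assumes "w \<in> carrier baumslag_free" "quot p w = \<one>\<^bsub>baumslag_group p\<^esub>"
  shows "central (heis_map w)"
proof -
  interpret fg: filled_group baumslag_free "symmetrized_relators p" by (rule symmetrized_filled)
  have rel: "central (heis_map r)" if r: "r \<in> symmetrized_relators p" for r
  proof -
    obtain r' where r': "r' \<in> baumslag_relators p" "r = r' \<or> r = inv\<^bsub>baumslag_free\<^esub> r'"
      using r unfolding symmetrized_relators_def by blast
    then have "r' \<in> carrier baumslag_free" using baumslag_relators_closed by blast
    then show ?thesis using r' heis_map_relator[OF r'(1)] central_inv hm.hom_inv by metis
  qed
  obtain m where "fills baumslag_free (symmetrized_relators p) m w" using assms quot_kernel by blast
  with fg.Q_closed show ?thesis
  proof (induction rule: FG.fills_induct)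
    case (one m)
    then show ?case using hm.hom_one by (simp add: central_simps)
  next
    case (mult m g r y)
    have c: "g \<in> carrier baumslag_free" "r \<in> carrier baumslag_free" "y \<in> carrier baumslag_free"
      using mult fg.Q_closed FG.fills_closed by blast+
    have "heis_map (g \<otimes>\<^bsub>baumslag_free\<^esub> r \<otimes>\<^bsub>baumslag_free\<^esub> inv\<^bsub>baumslag_free\<^esub> g \<otimes>\<^bsub>baumslag_free\<^esub> y)
        = heis_map g \<otimes>\<^bsub>heis\<^esub> heis_map r \<otimes>\<^bsub>heis\<^esub> inv\<^bsub>heis\<^esub> heis_map g \<otimes>\<^bsub>heis\<^esub> heis_map y"
      using c by (simp only: hm.hom_mult hm.hom_inv FG.m_closed FG.inv_closed)
    then show ?case using central_conj[OF rel[OF mult(2)]] central_mult[OF rel[OF mult(2)] mult(4)] by metis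
  qed
qed

section \<open>Heisenberg values over an arbitrary generating set\<close>

context
  fixes p :: nat and S :: "baumslag_gen letter list set set"
  assumes S: "finite S" "symmetric_generating_set (baumslag_group p) S"
begin

interpretation fp: finite_presentation "baumslag_group p" UNIV "symmetrized_relators p" "quot p"
  by (rule finite_presentation_baumslag)

interpretation FS: group "free_group S"
  by (rule group_free_group)

definition heis_S :: "baumslag_gen letter list set letter list \<Rightarrow> int \<times> int \<times> int" where
  "heis_S v = heis_map (fp.to_X v)"

lemma heis_S_hom: "heis_S \<in> hom (free_group S) heis"
  using Group.hom_compose[OF fp.to_X_hom[OF S] heis_map_hom] by (simp add: heis_S_def[abs_def] comp_def)

interpretation hS: group_hom "free_group S" heis heis_S
  by unfold_locales (rule heis_S_hom)

lemma heis_S_central: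
  assumes "v \<in> carrier (free_group S)" "free_lift (baumslag_group p) (\<lambda>s. s) v = \<one>\<^bsub>baumslag_group p\<^esub>"
  shows "central (heis_S v)"
  unfolding heis_S_def
  using heis_map_kernel[of "fp.to_X v" p] fp.q_to_X[OF S assms(1)] assms(2) hom_in_carrier[OF fp.to_X_hom[OF S] assms(1)]
  by simp

text \<open>The central coordinate is additive and blind to conjugation, so each relator changes it
  by at most \<open>D\<close>; its size bounds the area from below.\<close>

lemma heis_S_fills:
  assumes T: "T \<subseteq> carrier (free_group S)"
    and rel: "\<And>r. r \<in> T \<Longrightarrow> central (heis_S r) \<and> \<bar>snd (snd (heis_S r))\<bar> \<le> int D"
    and "fills (free_group S) T m v"
  shows "central (heis_S v) \<and> \<bar>snd (snd (heis_S v))\<bar> \<le> int D * int m"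
  using T assms(3)
proof (induction rule: FS.fills_induct)
  case (one m)
  then show ?case using hS.hom_one by (simp add: central_simps)
next
  case (mult m g r y)
  have c: "g \<in> carrier (free_group S)" "r \<in> carrier (free_group S)" "y \<in> carrier (free_group S)"
    using mult T FS.fills_closed by blast+
  have "heis_S (g \<otimes>\<^bsub>free_group S\<^esub> r \<otimes>\<^bsub>free_group S\<^esub> inv\<^bsub>free_group S\<^esub> g \<otimes>\<^bsub>free_group S\<^esub> y)
      = heis_S g \<otimes>\<^bsub>heis\<^esub> heis_S r \<otimes>\<^bsub>heis\<^esub> inv\<^bsub>heis\<^esub> heis_S g \<otimes>\<^bsub>heis\<^esub> heis_S y"
    using c by (simp only: hS.hom_mult hS.hom_inv FS.m_closed FS.inv_closed)
  also have "\<dots> = heis_S r \<otimes>\<^bsub>heis\<^esub> heis_S y" using central_conj rel[OF mult(2)] by metis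
  finally have e: "heis_S (g \<otimes>\<^bsub>free_group S\<^esub> r \<otimes>\<^bsub>free_group S\<^esub> inv\<^bsub>free_group S\<^esub> g \<otimes>\<^bsub>free_group S\<^esub> y)
      = heis_S r \<otimes>\<^bsub>heis\<^esub> heis_S y" .
  obtain z z' where z: "heis_S r = (0, 0, z)" "heis_S y = (0, 0, z')"
    using rel[OF mult(2)] mult(4) unfolding central_def by blast
  have "\<bar>z\<bar> \<le> int D" "\<bar>z'\<bar> \<le> int D * int m" using rel[OF mult(2)] mult(4) z by auto
  then have "\<bar>z + z'\<bar> \<le> int D * int (Suc m)" by (simp add: algebra_simps)
  then show ?case unfolding e z by (simp add: central_simps)
qed

text \<open>A word over \<open>S\<close> that represents \<open>quot p w\<close> has the Heisenberg
  value of \<open>w\<close> only up to a central error \<open>z\<close>, because it passes through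
  the choices made in \<open>to_X\<close>.\<close>

lemma heis_S_word:
  assumes "g = quot p w" "w \<in> carrier baumslag_free"
  obtains v z where "v \<in> lists S" "word_prod (baumslag_group p) v = g"
    "heis_S (free_word S v) = (0, 0, z) \<otimes>\<^bsub>heis\<^esub> heis_map w"
proof -
  have "g \<in> carrier (baumslag_group p)" using assms hom_in_carrier[OF quot_hom] by blast
  then obtain v where v: "v \<in> lists S" "word_prod (baumslag_group p) v = g"
    using fp.symmetric_generating_set_words[OF S(2)] by blast
  let ?x = "fp.to_X (free_word S v)"
  have fw: "free_word S v \<in> carrier (free_group S)" using v by (rule_tac free_word_closed)
  have x: "?x \<in> carrier baumslag_free" using hom_in_carrier[OF fp.to_X_hom[OF S] fw] .
  have "quot p ?x = quot p w"
    using fp.q_to_X[OF S fw] fp.free_lift_free_word[OF fp.S_closed[OF S] v(1)] v(2) assms(1) by simp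
  moreover interpret q: group_hom baumslag_free "baumslag_group p" "quot p" by unfold_locales (rule quot_hom)
  have "quot p (?x \<otimes>\<^bsub>baumslag_free\<^esub> inv\<^bsub>baumslag_free\<^esub> w) = quot p ?x \<otimes>\<^bsub>baumslag_group p\<^esub> inv\<^bsub>baumslag_group p\<^esub> quot p w"
    using x assms(2) by (simp only: q.hom_mult q.hom_inv FG.inv_closed)
  ultimately have "quot p (?x \<otimes>\<^bsub>baumslag_free\<^esub> inv\<^bsub>baumslag_free\<^esub> w) = \<one>\<^bsub>baumslag_group p\<^esub>"
    using q.hom_closed[OF assms(2)] fp.r_inv by metis
  from heis_map_kernel[OF _ this] x assms(2) obtain z where
    z: "heis_map (?x \<otimes>\<^bsub>baumslag_free\<^esub> inv\<^bsub>baumslag_free\<^esub> w) = (0, 0, z)"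
    unfolding central_def using FG.m_closed FG.inv_closed by blast
  have "heis_map ?x = heis_map ((?x \<otimes>\<^bsub>baumslag_free\<^esub> inv\<^bsub>baumslag_free\<^esub> w) \<otimes>\<^bsub>baumslag_free\<^esub> w)"
    using x assms(2) by (simp only: FG.m_assoc FG.inv_closed FG.l_inv FG.r_one)
  also have "\<dots> = (0, 0, z) \<otimes>\<^bsub>heis\<^esub> heis_map w"
    using x assms(2) z by (simp only: hm.hom_mult FG.m_closed FG.inv_closed)
  finally show thesis using that v unfolding heis_S_def by blast
qed

lemma free_word_append:
  "u \<in> lists S \<Longrightarrow> v \<in> lists S \<Longrightarrow> free_word S (u @ v) = free_word S u \<otimes>\<^bsub>free_group S\<^esub> free_word S v"
  unfolding free_word_def map_append by (rule FS.word_prod_append) (auto simp: free_gen_closed)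

lemma word_power:
  assumes "v \<in> lists S"
  shows "concat (replicate n v) \<in> lists S"
    "word_prod (baumslag_group p) (concat (replicate n v)) = word_prod (baumslag_group p) v [^]\<^bsub>baumslag_group p\<^esub> n"
    "heis_S (free_word S (concat (replicate n v))) = heis_S (free_word S v) [^]\<^bsub>heis\<^esub> n"
    "length (concat (replicate n v)) = n * length v"
proof -
  show l: "concat (replicate n v) \<in> lists S" for n using assms by (induction n) auto
  have SC: "lists S \<subseteq> lists (carrier (baumslag_group p))" using fp.S_closed[OF S] by (rule lists_mono)
  show "word_prod (baumslag_group p) (concat (replicate n v)) = word_prod (baumslag_group p) v [^]\<^bsub>baumslag_group p\<^esub> n"
  proof (induction n)
    case 0
    then show ?case by (simp add: word_prod_def)
  next
    case (Suc n)
    have "concat (replicate (Suc n) v) = concat (replicate n v) @ v"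
      using replicate_append_same[of n v] by (metis concat.simps(1,2) concat_append append_Nil2 replicate_Suc)
    then show ?case using Suc fp.word_prod_append[of "concat (replicate n v)" v] l[of n] assms SC
      by (simp only: fp.nat_pow_Suc) blast
  qed
  show "heis_S (free_word S (concat (replicate n v))) = heis_S (free_word S v) [^]\<^bsub>heis\<^esub> n"
  proof (induction n)
    case 0
    then show ?case using hS.hom_one by simp
  next
    case (Suc n)
    have "concat (replicate (Suc n) v) = concat (replicate n v) @ v"
      using replicate_append_same[of n v] by (metis concat.simps(1,2) concat_append append_Nil2 replicate_Suc)
    then have "heis_S (free_word S (concat (replicate (Suc n) v)))
        = heis_S (free_word S (concat (replicate n v))) \<otimes>\<^bsub>heis\<^esub> heis_S (free_word S v)"
      using free_word_append[OF l assms] hS.hom_mult[OF free_word_closed[OF l] free_word_closed[OF assms]] by simp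
    then show ?case using Suc by (simp only: H.nat_pow_Suc)
  qed
  show "length (concat (replicate n v)) = n * length v" by (induction n) simp_all
qed

text \<open>The words spell the commutator of the \<open>n\<close>-th powers of \<open>t\<close> and
  \<open>s\<close>. Each of the four words for a letter or its inverse contributes its central error
  \<open>n\<close> times, which gives the linear term.\<close>

lemma commutator_words:
  obtains L c where "\<And>n::nat. \<exists>w\<in>relations (baumslag_group p) S. length w \<le> L * n \<and>
    heis_S (free_word S w) = (0, 0, (int n)\<^sup>2 + c * int n)"
proof -
  let ?G = "baumslag_group p"
  interpret B: baumslag_relations ?G "quot p (free_gen Gen_a)" "quot p (free_gen Gen_s)" "quot p (free_gen Gen_t)" p
    by (rule baumslag_relations_quot)
  interpret q: group_hom baumslag_free ?G "quot p" by unfold_locales (rule quot_hom)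
  define s where "s = quot p (free_gen Gen_s)"
  define t where "t = quot p (free_gen Gen_t)"
  have st: "s \<in> carrier ?G" "t \<in> carrier ?G" "s \<otimes>\<^bsub>?G\<^esub> t = t \<otimes>\<^bsub>?G\<^esub> s"
    using B.closed B.s_t by (simp_all add: s_def t_def)
  have gc: "free_gen Gen_s \<in> carrier baumslag_free" "free_gen Gen_t \<in> carrier baumslag_free"
    by (simp_all add: free_gen_closed)
  have inv: "inv\<^bsub>?G\<^esub> s = quot p (inv\<^bsub>baumslag_free\<^esub> free_gen Gen_s)" "inv\<^bsub>?G\<^esub> t = quot p (inv\<^bsub>baumslag_free\<^esub> free_gen Gen_t)"
    using gc q.hom_inv by (simp_all add: s_def t_def)
  have hs: "heis_map (free_gen Gen_s) = (0, 1, 0)" "heis_map (free_gen Gen_t) = (1, 0, 0)"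
    "heis_map (inv\<^bsub>baumslag_free\<^esub> free_gen Gen_s) = (0, - 1, 0)" "heis_map (inv\<^bsub>baumslag_free\<^esub> free_gen Gen_t) = (- 1, 0, 0)"
    using gc hm.hom_inv by (simp_all add: heis_map_gen heis_gen_def heis_inv)
  obtain v1 z1 where 1: "v1 \<in> lists S" "word_prod ?G v1 = t" "heis_S (free_word S v1) = (1, 0, z1)"
    by (rule heis_S_word[OF t_def gc(2)]) (simp add: hs)
  obtain v2 z2 where 2: "v2 \<in> lists S" "word_prod ?G v2 = s" "heis_S (free_word S v2) = (0, 1, z2)"
    by (rule heis_S_word[OF s_def gc(1)]) (simp add: hs)
  obtain v3 z3 where 3: "v3 \<in> lists S" "word_prod ?G v3 = inv\<^bsub>?G\<^esub> t" "heis_S (free_word S v3) = (- 1, 0, z3)"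
    by (rule heis_S_word[OF inv(2) FG.inv_closed[OF gc(2)]]) (simp add: hs)
  obtain v4 z4 where 4: "v4 \<in> lists S" "word_prod ?G v4 = inv\<^bsub>?G\<^esub> s" "heis_S (free_word S v4) = (0, - 1, z4)"
    by (rule heis_S_word[OF inv(1) FG.inv_closed[OF gc(1)]]) (simp add: hs)
  define L where "L = length v1 + length v2 + length v3 + length v4"
  have "\<exists>w\<in>relations ?G S. length w \<le> L * n \<and> heis_S (free_word S w) = (0, 0, (int n)\<^sup>2 + (z1 + z2 + z3 + z4) * int n)" for n
  proof -
    define r where "r v = concat (replicate n v)" for v :: "baumslag_gen letter list set list"
    define w where "w = r v1 @ r v2 @ r v3 @ r v4"
    have l: "r v1 \<in> lists S" "r v2 \<in> lists S" "r v3 \<in> lists S" "r v4 \<in> lists S"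
      unfolding r_def using 1 2 3 4 word_power(1) by blast+
    have wl: "w \<in> lists S" using l by (simp add: w_def)
    have SC: "lists S \<subseteq> lists (carrier ?G)" using fp.S_closed[OF S] by (rule lists_mono)
    have l34: "r v3 @ r v4 \<in> lists S" "r v2 @ r v3 @ r v4 \<in> lists S" using l by auto
    have lG: "r v1 \<in> lists (carrier ?G)" "r v2 \<in> lists (carrier ?G)" "r v3 \<in> lists (carrier ?G)" "r v4 \<in> lists (carrier ?G)"
      "r v3 @ r v4 \<in> lists (carrier ?G)" "r v2 @ r v3 @ r v4 \<in> lists (carrier ?G)"
      using l l34 SC by blast+
    have tn: "t [^]\<^bsub>?G\<^esub> n \<in> carrier ?G" "s [^]\<^bsub>?G\<^esub> n \<in> carrier ?G" using st by auto
    have "s [^]\<^bsub>?G\<^esub> int n \<otimes>\<^bsub>?G\<^esub> t = t \<otimes>\<^bsub>?G\<^esub> s [^]\<^bsub>?G\<^esub> int n" using st by (intro fp.commute_int_pow) auto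
    then have "t [^]\<^bsub>?G\<^esub> int n \<otimes>\<^bsub>?G\<^esub> s [^]\<^bsub>?G\<^esub> int n = s [^]\<^bsub>?G\<^esub> int n \<otimes>\<^bsub>?G\<^esub> t [^]\<^bsub>?G\<^esub> int n"
      using st by (intro fp.commute_int_pow) auto
    then have com: "t [^]\<^bsub>?G\<^esub> n \<otimes>\<^bsub>?G\<^esub> s [^]\<^bsub>?G\<^esub> n = s [^]\<^bsub>?G\<^esub> n \<otimes>\<^bsub>?G\<^esub> t [^]\<^bsub>?G\<^esub> n" by (simp add: int_pow_int)
    have "word_prod ?G w = word_prod ?G (r v1) \<otimes>\<^bsub>?G\<^esub> (word_prod ?G (r v2) \<otimes>\<^bsub>?G\<^esub> (word_prod ?G (r v3) \<otimes>\<^bsub>?G\<^esub> word_prod ?G (r v4)))"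
      unfolding w_def by (simp only: fp.word_prod_append lG)
    also have "\<dots> = t [^]\<^bsub>?G\<^esub> n \<otimes>\<^bsub>?G\<^esub> (s [^]\<^bsub>?G\<^esub> n \<otimes>\<^bsub>?G\<^esub> (inv\<^bsub>?G\<^esub> (t [^]\<^bsub>?G\<^esub> n) \<otimes>\<^bsub>?G\<^esub> inv\<^bsub>?G\<^esub> (s [^]\<^bsub>?G\<^esub> n)))"
      unfolding r_def using 1 2 3 4 word_power(2) st fp.nat_pow_inv by simp
    also have "\<dots> = (t [^]\<^bsub>?G\<^esub> n \<otimes>\<^bsub>?G\<^esub> s [^]\<^bsub>?G\<^esub> n) \<otimes>\<^bsub>?G\<^esub> inv\<^bsub>?G\<^esub> (s [^]\<^bsub>?G\<^esub> n \<otimes>\<^bsub>?G\<^esub> t [^]\<^bsub>?G\<^esub> n)"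
      using tn by (simp add: fp.inv_mult_group fp.m_assoc)
    also have "\<dots> = \<one>\<^bsub>?G\<^esub>" unfolding com using tn by (intro fp.r_inv fp.m_closed)
    finally have "w \<in> relations ?G S" using wl by (simp add: relations_def)
    moreover have "length w \<le> L * n"
      unfolding w_def r_def L_def by (simp add: word_power(4)[OF 1(1)] word_power(4)[OF 2(1)] word_power(4)[OF 3(1)] word_power(4)[OF 4(1)] algebra_simps)
    moreover have "heis_S (free_word S w) = heis_S (free_word S (r v1)) \<otimes>\<^bsub>heis\<^esub> (heis_S (free_word S (r v2)) \<otimes>\<^bsub>heis\<^esub>
        (heis_S (free_word S (r v3)) \<otimes>\<^bsub>heis\<^esub> heis_S (free_word S (r v4))))"
      unfolding w_def using l l34 by (simp only: free_word_append hS.hom_mult free_word_closed FS.m_closed)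
    then have "heis_S (free_word S w) = (0, 0, (int n)\<^sup>2 + (z1 + z2 + z3 + z4) * int n)"
      unfolding r_def using 1 2 3 4 word_power(3)
      by (simp add: heis_pow power2_eq_square algebra_simps)
    ultimately show ?thesis by blast
  qed
  then show thesis by (rule that)
qed


section \<open>Bounds on the area and the Dehn function\<close>

lemma area_lower_bound:
  assumes "presented_in_length (baumslag_group p) S l"
  obtains L D c :: nat where "\<And>n. \<exists>w\<in>relations (baumslag_group p) S. length w \<le> L * n \<and>
    n\<^sup>2 \<le> D * area (baumslag_group p) S l w + c * n"
proof -
  let ?G = "baumslag_group p" and ?T = "short_relators (baumslag_group p) S l"
  interpret T: filled_group "free_group S" ?T by (rule fp.short_relators_filled[OF S])
  have "finite {r \<in> relations ?G S. length r \<le> l}"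
    by (rule finite_subset[OF _ finite_lists_length_le[OF S(1), of l]]) (auto simp: relations_def)
  then have finT: "finite ?T" by (simp add: short_relators_def)
  define D where "D = Max (insert 0 ((\<lambda>r. nat \<bar>snd (snd (heis_S r))\<bar>) ` ?T))"
  have rel: "central (heis_S r) \<and> \<bar>snd (snd (heis_S r))\<bar> \<le> int D" if "r \<in> ?T" for r
  proof
    show "central (heis_S r)"
      using that T.Q_closed fp.eval_short_relators[OF S that] by (intro heis_S_central) auto
    have "nat \<bar>snd (snd (heis_S r))\<bar> \<le> D" unfolding D_def using finT that by (intro Max_ge) auto
    then show "\<bar>snd (snd (heis_S r))\<bar> \<le> int D" by linarith
  qed
  obtain L c where Lc: "\<And>n::nat. \<exists>w\<in>relations ?G S. length w \<le> L * n \<and>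
    heis_S (free_word S w) = (0, 0, (int n)\<^sup>2 + c * int n)" using commutator_words by blast
  have "\<exists>w\<in>relations ?G S. length w \<le> L * n \<and> n\<^sup>2 \<le> D * area ?G S l w + nat \<bar>c\<bar> * n" for n
  proof -
    obtain w where w: "w \<in> relations ?G S" "length w \<le> L * n"
      "heis_S (free_word S w) = (0, 0, (int n)\<^sup>2 + c * int n)" using Lc by blast
    have wl: "w \<in> lists S" "word_prod ?G w = \<one>\<^bsub>?G\<^esub>" using w(1) by (simp_all add: relations_def)
    have "\<exists>m. fills (free_group S) ?T m (free_word S w)"
      using fp.presented_fills[OF S assms free_word_closed[OF wl(1)]]
        fp.free_lift_free_word[OF fp.S_closed[OF S] wl(1)] wl(2) by simp
    from LeastI_ex[OF this] have "fills (free_group S) ?T (area ?G S l w) (free_word S w)"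
      unfolding area_eq_Least_fills .
    from heis_S_fills[OF T.Q_closed rel this]
    have "(int n)\<^sup>2 + c * int n \<le> int D * int (area ?G S l w)" unfolding w(3) by auto
    moreover have "- (c * int n) \<le> \<bar>c\<bar> * int n" by (simp add: abs_if mult_right_mono)
    ultimately have "(int n)\<^sup>2 \<le> int D * int (area ?G S l w) + \<bar>c\<bar> * int n" by linarith
    also have "\<dots> = int (D * area ?G S l w + nat \<bar>c\<bar> * n)" by simp
    finally have "int (n\<^sup>2) \<le> int (D * area ?G S l w + nat \<bar>c\<bar> * n)" by simp
    then have "n\<^sup>2 \<le> D * area ?G S l w + nat \<bar>c\<bar> * n" by (simp only: of_nat_le_iff)
    with w show ?thesis by blast
  qed
  then show thesis by (rule that)
qed

lemma area_upper_bound: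
  assumes "0 < p" "presented_in_length (baumslag_group p) S l"
  obtains D where "\<And>w. w \<in> relations (baumslag_group p) S \<Longrightarrow> area (baumslag_group p) S l w \<le> D * (length w)\<^sup>2 + D"
proof -
  interpret baumslag_filling p by unfold_locales (rule assms)
  obtain C where "\<And>w. w \<in> carrier baumslag_free \<Longrightarrow> quot p w = \<one>\<^bsub>baumslag_group p\<^esub> \<Longrightarrow>
     fills baumslag_free (symmetrized_relators p) (C * (length w)\<^sup>2 + C) w"
    using quadratic_filling by blast
  from fp.quadratic_fills[OF S this assms(2)] obtain D where
    "\<And>w. w \<in> relations (baumslag_group p) S \<Longrightarrow>
      fills (free_group S) (short_relators (baumslag_group p) S l) (D * (length w)\<^sup>2 + D) (free_word S w)"
    by blast
  then show thesis using that Least_le unfolding area_eq_Least_fills by metis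
qed

lemma dehn_function_quadratic:
  assumes "0 < p" "presented_in_length (baumslag_group p) S l"
  shows "dehn_equiv (dehn_function (baumslag_group p) S l) (\<lambda>x. x\<^sup>2)"
proof -
  let ?G = "baumslag_group p"
  let ?W = "\<lambda>x::real. {w \<in> relations ?G S. real (length w) \<le> x}"
  obtain D where D: "\<And>w. w \<in> relations ?G S \<Longrightarrow> area ?G S l w \<le> D * (length w)\<^sup>2 + D"
    using area_upper_bound[OF assms] by blast
  obtain L E c where E: "\<And>n. \<exists>w\<in>relations ?G S. length w \<le> L * n \<and> n\<^sup>2 \<le> E * area ?G S l w + c * n"
    using area_lower_bound[OF assms(2)] by blast
  have area: "area ?G S l w \<le> D * (nat \<lfloor>x\<rfloor>)\<^sup>2 + D" if "w \<in> ?W x" for w x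
  proof -
    have "length w \<le> nat \<lfloor>x\<rfloor>" using that by (simp add: le_nat_floor)
    then have "D * (length w)\<^sup>2 + D \<le> D * (nat \<lfloor>x\<rfloor>)\<^sup>2 + D" by (intro add_mono mult_le_mono power_mono) auto
    moreover have "area ?G S l w \<le> D * (length w)\<^sup>2 + D" using that D by simp
    ultimately show ?thesis by linarith
  qed
  have upper: "dehn_function ?G S l x \<le> real D * x\<^sup>2 + real D" if x: "0 \<le> x" for x
  proof -
    have "[] \<in> ?W x" using x by (simp add: relations_def word_prod_def)
    then have "(SUP w\<in>?W x. area ?G S l w) \<le> D * (nat \<lfloor>x\<rfloor>)\<^sup>2 + D"
      by (intro cSUP_least area) auto
    then have "dehn_function ?G S l x \<le> real (D * (nat \<lfloor>x\<rfloor>)\<^sup>2 + D)"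
      unfolding dehn_function_def by (simp only: of_nat_le_iff)
    also have "\<dots> = real D * (real (nat \<lfloor>x\<rfloor>))\<^sup>2 + real D" by simp
    also have "\<dots> \<le> real D * x\<^sup>2 + real D" using x by (intro add_mono mult_left_mono power_mono) auto
    finally show ?thesis .
  qed
  have lower: "(real n)\<^sup>2 \<le> real E * dehn_function ?G S l x + real c * real n" if n: "real (L * n) \<le> x" for n x
  proof -
    obtain w where w: "w \<in> relations ?G S" "length w \<le> L * n" "n\<^sup>2 \<le> E * area ?G S l w + c * n"
      using E by blast
    have "w \<in> ?W x" using w n by (simp flip: of_nat_mult)
    then have "area ?G S l w \<le> (SUP w\<in>?W x. area ?G S l w)"
      using area by (intro cSUP_upper) (auto intro!: bdd_aboveI2)
    then have "real (area ?G S l w) \<le> dehn_function ?G S l x" unfolding dehn_function_def by (simp only: of_nat_le_iff)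
    then have "real E * real (area ?G S l w) \<le> real E * dehn_function ?G S l x" by (intro mult_left_mono) auto
    moreover have "real (n\<^sup>2) \<le> real (E * area ?G S l w + c * n)" using w(3) by (simp only: of_nat_le_iff)
    ultimately show ?thesis by simp
  qed
  \<comment> \<open>The summands 1 in the factors keep the constants positive, as
    \<open>dehn_equiv\<close> demands. Replacing \<open>x\<close> by its integer part loses at most
    \<open>2 * x + 1\<close> in the square, whence \<open>real c + 2\<close> and the last 1.\<close>
  have "1 / (real D + 1) * dehn_function ?G S l (1 * x) - 1 * x - 1 \<le> x\<^sup>2 \<and>
      x\<^sup>2 \<le> (real E + 1) * dehn_function ?G S l ((real L + 1) * x) + (real c + 2) * x + 1" if x: "0 \<le> x" for x
  proof
    have "real D * x\<^sup>2 + real D \<le> (real D + 1) * (x\<^sup>2 + 1)" by (simp add: algebra_simps)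
    with upper[OF x] have "dehn_function ?G S l x \<le> (real D + 1) * (x\<^sup>2 + 1)" by linarith
    then have "1 / (real D + 1) * dehn_function ?G S l x \<le> x\<^sup>2 + 1" by (simp add: divide_le_eq mult.commute)
    then show "1 / (real D + 1) * dehn_function ?G S l (1 * x) - 1 * x - 1 \<le> x\<^sup>2" using x by simp
    define n where "n = nat \<lfloor>x\<rfloor>"
    have n: "real n \<le> x" "x \<le> real n + 1" using x by (auto simp: n_def)
    have "real L * real n \<le> (real L + 1) * x" using n x by (intro mult_mono) auto
    then have "(real n)\<^sup>2 \<le> real E * dehn_function ?G S l ((real L + 1) * x) + real c * real n" by (intro lower) simp
    moreover have "0 \<le> dehn_function ?G S l ((real L + 1) * x)" by (simp add: dehn_function_def)
    moreover have "real c * real n \<le> real c * x" using n by (intro mult_left_mono) auto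
    moreover have "x\<^sup>2 \<le> (real n)\<^sup>2 + 2 * x + 1"
    proof -
      have "x\<^sup>2 \<le> (real n + 1)\<^sup>2" using n x by (intro power_mono) auto
      also have "\<dots> = (real n)\<^sup>2 + 2 * real n + 1" by (simp add: power2_eq_square algebra_simps)
      finally show ?thesis using n by linarith
    qed
    ultimately show "x\<^sup>2 \<le> (real E + 1) * dehn_function ?G S l ((real L + 1) * x) + (real c + 2) * x + 1"
      unfolding distrib_right by linarith
  qed
  then show ?thesis unfolding dehn_equiv_def
    by (rule_tac exI[of _ "1 / (real D + 1)"], rule_tac exI[of _ 1], rule_tac exI[of _ 1], rule_tac exI[of _ 1],
        rule_tac exI[of _ "real E + 1"], rule_tac exI[of _ "real L + 1"], rule_tac exI[of _ "real c + 2"],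
        rule_tac exI[of _ 1]) (intro conjI; simp)
qed

end

lemma finitely_presented_baumslag: "finitely_presented (baumslag_group p)"
proof -
  interpret fp: finite_presentation "baumslag_group p" UNIV "symmetrized_relators p" "quot p"
    by (rule finite_presentation_baumslag)
  interpret q: group_hom baumslag_free "baumslag_group p" "quot p" by unfold_locales (rule quot_hom)
  define S where "S = (\<lambda>l. quot p [l]) ` UNIV"
  have "finite S" unfolding S_def using fp.finite_gens by (intro finite_imageI) (metis UNIV_Times_UNIV finite_SigmaI finite)
  moreover have "symmetric_generating_set (baumslag_group p) S"
    unfolding symmetric_generating_set_def
  proof (intro conjI ballI)
    have c: "[l] \<in> carrier baumslag_free" for l :: "baumslag_gen letter" by (cases l) simp
    show S: "S \<subseteq> carrier (baumslag_group p)" unfolding S_def using c q.hom_closed by blast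
    show "inv\<^bsub>baumslag_group p\<^esub> s \<in> S" if s: "s \<in> S" for s
    proof -
      obtain x b where xb: "s = quot p [(x, b)]" using s unfolding S_def by auto
      have "inv\<^bsub>baumslag_group p\<^esub> s = quot p [(x, \<not> b)]"
        using q.hom_inv[OF c[of "(x, b)"]] inv_letter_word[of x UNIV b] xb by simp
      then show ?thesis unfolding S_def by blast
    qed
    have gen: "quot p w \<in> generate (baumslag_group p) S" if "w \<in> carrier baumslag_free" for w
      using that
    proof (induction rule: free_induct)
      case Nil
      show ?case using q.hom_one generate.one by simp
    next
      case (Cons x b w)
      have "quot p [(x, b)] \<in> generate (baumslag_group p) S" by (rule generate.incl) (auto simp: S_def)
      then show ?case unfolding Cons(4) using q.hom_mult[OF c Cons(2)] Cons(5) generate.eng by metis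
    qed
    show "generate (baumslag_group p) S = carrier (baumslag_group p)"
    proof
      show "generate (baumslag_group p) S \<subseteq> carrier (baumslag_group p)" using fp.generate_incl[OF S] .
      show "carrier (baumslag_group p) \<subseteq> generate (baumslag_group p) S" using gen quot_surj by blast
    qed
  qed
  ultimately show ?thesis unfolding finitely_presented_def using fp.presented_in_length_exists by blast
qed

theorem theorem2:
  fixes p :: nat
  assumes "prime p"
  shows "has_quadratic_dehn_function (baumslag_group p)"
proof -
  have "0 < p" using assms by (rule prime_gt_0_nat)
  then show ?thesis
    unfolding has_quadratic_dehn_function_def
    using finitely_presented_baumslag dehn_function_quadratic
    by (auto simp: presented_in_length_def)
qed

end
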